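(* Let $A$ be a Henselian valuation ring, not a field, with field of fractions $K$. Let $L$ be a finite Galois extension of $K$ and let $B$ be the integral closure of $A$ in $L$. Then for any finite subset $S$ of $B$, there is an $A$-subalgebra $B'$ of $B$ which is free of finite rank as an $A$-module and of complete intersection over $A$ such that $S\subset B'$.
   Context: "Of complete intersection over $A$" means that the (finite, flat, finitely presented) homomorphism $A\to B'$ is a relative complete intersection. *)

theory Defs
  imports
    "HOL-Algebra.Algebraic_Closure_Type"
    "HOL-Library.Poly_Mapping"
    "Jordan_Normal_Form.Matrix"
begin

text \<open>
  Throughout, \<open>\<iota> :: 'k \<Rightarrow> 'l\<close> is a field homomorphism, making the field \<open>L\<close> (the type \<open>'l\<close>) an
  extension of the field \<open>K\<close> (the type \<open>'k\<close>). Subrings of \<open>K\<close> and \<open>L\<close> are carrier sets; the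
  following record makes the ring-theoretic notions of HOL-Algebra applicable to them.
\<close>

abbreviation ring_on :: "'a::comm_ring_1 set \<Rightarrow> 'a ring"
  where "ring_on T \<equiv> ring_of_type_algebra\<lparr>carrier := T\<rparr>"

abbreviation is_subring :: "'a::comm_ring_1 set \<Rightarrow> bool"
  where "is_subring T \<equiv> subring T ring_of_type_algebra"


section \<open>Henselian valuation rings\<close>

text \<open>The field of fractions of such an \<open>A\<close> is the whole ambient field, see the lemma below.\<close>

definition valuation_ring :: "'k::field set \<Rightarrow> bool"
  where "valuation_ring A \<longleftrightarrow> is_subring A \<and> (\<forall>x. x \<in> A \<or> inverse x \<in> A)"

lemma valuation_ring_fractions:
  assumes "valuation_ring A"
  shows "\<exists>a\<in>A. \<exists>b\<in>A. b \<noteq> 0 \<and> x = a / b"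
proof -
  have "subring A ring_of_type_algebra"
    using assms by (simp add: valuation_ring_def)
  then have one: "1 \<in> A"
    using subring.axioms(2) submonoid.one_closed by (fastforce simp: ring_of_type_algebra_def)
  have "x \<in> A \<or> inverse x \<in> A"
    using assms by (simp add: valuation_ring_def)
  then show ?thesis
  proof
    assume "x \<in> A"
    then show ?thesis using one by (intro bexI[of _ x] bexI[of _ 1]) auto
  next
    assume inv: "inverse x \<in> A"
    show ?thesis
    proof (cases "x = 0")
      case True
      then show ?thesis using one inv by (intro bexI[of _ "inverse x"] bexI[of _ 1]) auto
    next
      case False
      then show ?thesis
        using one inv by (intro bexI[of _ 1] bexI[of _ "inverse x"]) (auto simp: field_simps)
    qed
  qed
qed

text \<open>A local ring \<open>A\<close> with maximal ideal \<open>M\<close> in which simple roots modulo \<open>M\<close> of monic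
  polynomials lift.\<close>

definition henselian :: "'k::field set \<Rightarrow> bool"
  where "henselian A \<longleftrightarrow>
    (\<exists>M. maximalideal M (ring_on A) \<and> (\<forall>N. maximalideal N (ring_on A) \<longrightarrow> N = M) \<and>
      (\<forall>f a\<^sub>0. (\<forall>i. Polynomial.coeff f i \<in> A) \<and> lead_coeff f = 1 \<and> a\<^sub>0 \<in> A \<and>
          poly f a\<^sub>0 \<in> M \<and> poly (pderiv f) a\<^sub>0 \<notin> M \<longrightarrow>
        (\<exists>a\<in>A. poly f a = 0 \<and> a - a\<^sub>0 \<in> M)))"


section \<open>Finite Galois extensions and integral closures\<close>

definition finite_extension :: "('k::field \<Rightarrow> 'l::field) \<Rightarrow> bool"
  where "finite_extension \<iota> \<longleftrightarrow> (\<exists>E. finite E \<and> module.span (\<lambda>c x. \<iota> c * x) E = UNIV)"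

definition normal_extension :: "('k::field \<Rightarrow> 'l::field) \<Rightarrow> bool"
  where "normal_extension \<iota> \<longleftrightarrow>
    (\<forall>p. Factorial_Ring.irreducible p \<and> (\<exists>x. poly (map_poly \<iota> p) x = 0) \<longrightarrow>
      (\<exists>rs. map_poly \<iota> p = Polynomial.smult (\<iota> (lead_coeff p)) (\<Prod>r\<leftarrow>rs. [:- r, 1:])))"

definition separable_extension :: "('k::field \<Rightarrow> 'l::field) \<Rightarrow> bool"
  where "separable_extension \<iota> \<longleftrightarrow>
    (\<forall>x. \<exists>p. Factorial_Ring.irreducible p \<and> poly (map_poly \<iota> p) x = 0 \<and> coprime p (pderiv p))"

definition finite_galois :: "('k::field \<Rightarrow> 'l::field) \<Rightarrow> bool"
  where "finite_galois \<iota> \<longleftrightarrow>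
    finite_extension \<iota> \<and> normal_extension \<iota> \<and> separable_extension \<iota>"

definition integral_closure_in :: "('k::field \<Rightarrow> 'l::field) \<Rightarrow> 'k set \<Rightarrow> 'l set"
  where "integral_closure_in \<iota> A =
    {x. \<exists>p. (\<forall>i. Polynomial.coeff p i \<in> A) \<and> lead_coeff p = 1 \<and> poly (map_poly \<iota> p) x = 0}"


section \<open>Subalgebras, free of finite rank\<close>

definition subalgebra_of :: "('k::field \<Rightarrow> 'l::field) \<Rightarrow> 'k set \<Rightarrow> 'l set \<Rightarrow> 'l set \<Rightarrow> bool"
  where "subalgebra_of \<iota> A T B \<longleftrightarrow> is_subring T \<and> \<iota> ` A \<subseteq> T \<and> T \<subseteq> B"

definition free_of_finite_rank :: "('k::field \<Rightarrow> 'l::field) \<Rightarrow> 'k set \<Rightarrow> 'l set \<Rightarrow> bool"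
  where "free_of_finite_rank \<iota> A T \<longleftrightarrow>
    (\<exists>E. finite E \<and> E \<subseteq> T \<and>
      (\<forall>x\<in>T. \<exists>c. (\<forall>e\<in>E. c e \<in> A) \<and> x = (\<Sum>e\<in>E. \<iota> (c e) * e)) \<and>
      (\<forall>c. (\<forall>e\<in>E. c e \<in> A) \<and> (\<Sum>e\<in>E. \<iota> (c e) * e) = 0 \<longrightarrow> (\<forall>e\<in>E. c e = 0)))"


section \<open>Relative complete intersections\<close>

text \<open>\<open>mpolys A n\<close> is the polynomial ring $A[X_0,\dots,X_{n-1}]$: monomials are finitely
  supported exponent functions, polynomials finitely supported coefficient functions.\<close>

type_synonym 'k mpoly = "(nat \<Rightarrow>\<^sub>0 nat) \<Rightarrow>\<^sub>0 'k"

definition mpolys :: "'k::field set \<Rightarrow> nat \<Rightarrow> 'k mpoly set"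
  where "mpolys A n =
    {p. (\<forall>m. Poly_Mapping.lookup p m \<in> A) \<and> (\<forall>m\<in>Poly_Mapping.keys p. Poly_Mapping.keys m \<subseteq> {..<n})}"

definition mpoly_eval :: "('k::field \<Rightarrow> 'l::field) \<Rightarrow> (nat \<Rightarrow> 'l) \<Rightarrow> 'k mpoly \<Rightarrow> 'l"
  where "mpoly_eval \<iota> x p =
    (\<Sum>m\<in>Poly_Mapping.keys p. \<iota> (Poly_Mapping.lookup p m) * (\<Prod>i\<in>Poly_Mapping.keys m. x i ^ Poly_Mapping.lookup m i))"

text \<open>\<open>X\<^sub>i \<mapsto> x i\<close> induces an isomorphism from $A[X_0,\dots,X_{n-1}]/(f_0,\dots,f_{c-1})$ onto \<open>T\<close>.\<close>

definition presentation ::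
    "('k::field \<Rightarrow> 'l::field) \<Rightarrow> 'k set \<Rightarrow> 'l set \<Rightarrow> nat \<Rightarrow> nat \<Rightarrow> (nat \<Rightarrow> 'l) \<Rightarrow> (nat \<Rightarrow> 'k mpoly) \<Rightarrow> bool"
  where "presentation \<iota> A T n c x f \<longleftrightarrow>
    (\<forall>j<c. f j \<in> mpolys A n) \<and>
    mpoly_eval \<iota> x ` mpolys A n = T \<and>
    {p \<in> mpolys A n. mpoly_eval \<iota> x p = 0} = genideal (ring_on (mpolys A n)) (f ` {..<c})"

text \<open>The fibre of \<open>Spec T \<rightarrow> Spec A\<close> over \<open>P\<close>. It is isomorphic, as an ordered set, to the spectrum
  of \<open>T \<otimes>\<^sub>A \<kappa>(P)\<close>, so the Krull dimension of the latter is the supremum of the lengths of chains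
  in it.\<close>

definition spec_fibre :: "('k::field \<Rightarrow> 'l::field) \<Rightarrow> 'k set \<Rightarrow> 'l set \<Rightarrow> 'k set \<Rightarrow> 'l set set"
  where "spec_fibre \<iota> A T P = {Q. primeideal Q (ring_on T) \<and> {a\<in>A. \<iota> a \<in> Q} = P}"

definition has_chain :: "'a set set \<Rightarrow> nat \<Rightarrow> bool"
  where "has_chain F d \<longleftrightarrow> (\<exists>Q. (\<forall>i\<le>d. Q i \<in> F) \<and> (\<forall>i<d. Q i \<subset> Q (Suc i)))"

definition has_krull_dim :: "'a set set \<Rightarrow> nat \<Rightarrow> bool"
  where "has_krull_dim F d \<longleftrightarrow> has_chain F d \<and> \<not> has_chain F (Suc d)"

text \<open>A presentation by \<open>n\<close> generators and \<open>c\<close> relations such that all nonempty fibres have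
  dimension \<open>n - c\<close>. Flatness and finite presentation are consequences.\<close>

definition relative_global_complete_intersection ::
    "('k::field \<Rightarrow> 'l::field) \<Rightarrow> 'k set \<Rightarrow> 'l set \<Rightarrow> bool"
  where "relative_global_complete_intersection \<iota> A T \<longleftrightarrow>
    (\<exists>n c x f. c \<le> n \<and> presentation \<iota> A T n c x f \<and>
      (\<forall>P. primeideal P (ring_on A) \<and> spec_fibre \<iota> A T P \<noteq> {} \<longrightarrow>
        has_krull_dim (spec_fibre \<iota> A T P) (n - c)))"

text \<open>The localisation \<open>T[1/g]\<close>, formed inside the field \<open>L\<close>.\<close>

definition localise_at :: "'l::field set \<Rightarrow> 'l \<Rightarrow> 'l set"
  where "localise_at T g = {t / g ^ k | t k. t \<in> T}"

text \<open>Relative complete intersections are defined locally on \<open>Spec T\<close>: every point has a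
  basic open neighbourhood which is a relative global complete intersection over \<open>A\<close>.\<close>

definition relative_complete_intersection ::
    "('k::field \<Rightarrow> 'l::field) \<Rightarrow> 'k set \<Rightarrow> 'l set \<Rightarrow> bool"
  where "relative_complete_intersection \<iota> A T \<longleftrightarrow>
    (\<forall>Q. primeideal Q (ring_on T) \<longrightarrow>
      (\<exists>g\<in>T - Q. relative_global_complete_intersection \<iota> A (localise_at T g)))"

end

theory Submission
  imports Defs "HOL-Algebra.Sylow"
begin

text \<open>
  It suffices to find, inside the integral closure \<open>B\<close>, a tower
  \<open>A \<subseteq> A[x\<^sub>1] \<subseteq> \<dots> \<subseteq> A[x\<^sub>1, \<dots>, x\<^sub>n]\<close> containing \<open>S\<close> in which every \<open>x\<^sub>i\<close> has a monic minimal
  polynomial with coefficients in the previous ring: such a ring is free over \<open>A\<close>, it is presented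
  by \<open>n\<close> generators and \<open>n\<close> relations, and its fibres have dimension \<open>0\<close> because it is integral.

  Since \<open>A\<close> is Henselian, its integral closure \<open>V\<close> in the algebraic closure of \<open>L\<close> is a valuation
  ring and is stable under conjugation. For an intermediate field \<open>F \<noteq> L\<close> there is a proper
  extension \<open>F' \<subseteq> L\<close> of \<open>F\<close> such that every finite subset of \<open>V \<inter> F'\<close> lies in a monogenic
  \<open>(V \<inter> F)[w] \<subseteq> V \<inter> F'\<close>; induction along \<open>F\<close> then gives the tower. If the residue extension of
  \<open>L/F\<close> is not purely inseparable, \<open>w\<close> lifts a separable residue class. If there is tame
  ramification, \<open>F'\<close> is generated by a root of prime order \<open>l\<close>, and \<open>w\<close> is chosen in a coset of the
  value group of \<open>F\<close> that is coinitial in the positive values outside of it. Otherwise the Galois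
  group may be replaced by a \<open>p\<close>-group, where \<open>p\<close> is the residue characteristic, and \<open>F' = F(x)\<close> has
  degree \<open>p\<close>; either one of the previous constructions applies to \<open>F'\<close>, or the elements of \<open>F\<close>
  approximate \<open>x\<close> without a best approximation. In the last case, roots of polynomials of degree
  less than \<open>p\<close> do not approximate \<open>x\<close> better than all elements of \<open>F\<close> do, so that a given \<open>g(x)\<close>
  with \<open>deg g < p\<close> lies in \<open>(V \<inter> F)[w]\<close> with \<open>w = (x - a) / (b - a)\<close> for suitable \<open>a, b \<in> F\<close>.
\<close>

section \<open>Subrings, subfields and polynomials over them\<close>

text \<open>The ring \<open>V\<close> \<inter> F' need not be finitely generated over
  \<open>V\<close> \<inter> F: value groups may be dense and extensions may have defect. This is why
  everything is phrased through finite subsets; the induction hands down to F just the finitely many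
  coefficients of one minimal polynomial and of the expressions for the given elements. The
  Henselian property enters through conjugates: it gives them all the same value, so a minimal
  polynomial of an element of \<open>V\<close> has coefficients in \<open>V\<close>. All fields are
  placed in one algebraically closed field because the defect case compares an element of L with
  roots that need not lie in L. That A is not a field makes K infinite, which primitive elements
  require. The bound p on degrees comes from averaging. Without tame steps every nonzero e in L has
  a power with exponent p^k in F (1 + \<mm>), so all conjugates of e lie in e (1 + \<mm>). A sum of
  n of them is then congruent to n e, which is informative exactly when n is a unit in the residue
  field, in particular for 0 < n < p.\<close>

lemma is_subring_iff:
  "is_subring R \<longleftrightarrow> 1 \<in> R \<and> (\<forall>x\<in>R. \<forall>y\<in>R. x - y \<in> R) \<and> (\<forall>x\<in>R. \<forall>y\<in>R. x * y \<in> R)"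
proof -
  interpret U: cring "ring_of_type_algebra :: 'a ring" by (rule cring_from_type_algebra)
  have minus: "\<ominus>\<^bsub>ring_of_type_algebra\<^esub> x = - x" for x :: 'a
    using U.minus_equality[of "- x" x] by (simp add: ring_of_type_algebra_def)
  show ?thesis
  proof
    assume R: "is_subring R"
    note E = subringE[OF R]
    have "1 \<in> R" "\<And>x y. x \<in> R \<Longrightarrow> y \<in> R \<Longrightarrow> x * y \<in> R" "\<And>x y. x \<in> R \<Longrightarrow> y \<in> R \<Longrightarrow> x + y \<in> R"
      using E(3,6,7) by (auto simp: ring_of_type_algebra_def)
    moreover have "- x \<in> R" if "x \<in> R" for x
      using E(5)[OF that] by (simp add: minus)
    ultimately show "1 \<in> R \<and> (\<forall>x\<in>R. \<forall>y\<in>R. x - y \<in> R) \<and> (\<forall>x\<in>R. \<forall>y\<in>R. x * y \<in> R)"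
      by (metis diff_conv_add_uminus)
  next
    assume *: "1 \<in> R \<and> (\<forall>x\<in>R. \<forall>y\<in>R. x - y \<in> R) \<and> (\<forall>x\<in>R. \<forall>y\<in>R. x * y \<in> R)"
    then have "0 \<in> R" by (metis diff_self)
    with * have "- x \<in> R" if "x \<in> R" for x
      using that by (metis diff_0)
    moreover from this * have "x + y \<in> R" if "x \<in> R" "y \<in> R" for x y
      using that by (metis diff_minus_eq_add)
    ultimately show "is_subring R"
      using * by (intro U.subringI) (auto simp: minus, auto simp: ring_of_type_algebra_def)
  qed
qed

context
  fixes R :: "'a::comm_ring_1 set"
  assumes R: "is_subring R"
begin

lemma subring_1: "1 \<in> R" and subring_diff: "x \<in> R \<Longrightarrow> y \<in> R \<Longrightarrow> x - y \<in> R"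
  and subring_mult: "x \<in> R \<Longrightarrow> y \<in> R \<Longrightarrow> x * y \<in> R"
  using R by (auto simp: is_subring_iff)

lemma subring_0: "0 \<in> R"
  using subring_diff[OF subring_1 subring_1] by simp

lemma subring_minus: "x \<in> R \<Longrightarrow> - x \<in> R"
  using subring_diff[OF subring_0] by simp

lemma subring_add: "x \<in> R \<Longrightarrow> y \<in> R \<Longrightarrow> x + y \<in> R"
  using subring_diff[of x "- y"] subring_minus by simp

lemma subring_power: "x \<in> R \<Longrightarrow> x ^ n \<in> R"
  by (induction n) (auto intro: subring_1 subring_mult)

lemma subring_sum: "(\<And>i. i \<in> I \<Longrightarrow> f i \<in> R) \<Longrightarrow> sum f I \<in> R"
  by (induction I rule: infinite_finite_induct) (auto intro: subring_0 subring_add)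

lemma subring_prod: "(\<And>i. i \<in> I \<Longrightarrow> f i \<in> R) \<Longrightarrow> prod f I \<in> R"
  by (induction I rule: infinite_finite_induct) (auto intro: subring_1 subring_mult)

lemma subring_of_nat: "of_nat n \<in> R"
  by (induction n) (auto intro: subring_0 subring_1 subring_add)

end

lemmas subring_intros = subring_0 subring_1 subring_diff subring_mult subring_minus subring_add
  subring_power subring_sum subring_prod subring_of_nat

lemma is_subring_Int: "is_subring R \<Longrightarrow> is_subring S \<Longrightarrow> is_subring (R \<inter> S)"
  by (auto simp: is_subring_iff)

definition is_subfield :: "'a::field set \<Rightarrow> bool"
  where "is_subfield F \<longleftrightarrow> is_subring F \<and> (\<forall>x\<in>F. inverse x \<in> F)"

lemma subfield_subring: "is_subfield F \<Longrightarrow> is_subring F"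
  and subfield_inverse: "is_subfield F \<Longrightarrow> x \<in> F \<Longrightarrow> inverse x \<in> F"
  by (auto simp: is_subfield_def)

lemma subfield_divide: "is_subfield F \<Longrightarrow> x \<in> F \<Longrightarrow> y \<in> F \<Longrightarrow> x / y \<in> F"
  by (auto simp: is_subfield_def is_subring_iff divide_inverse)

lemmas subfield_intros = subring_intros[OF subfield_subring] subfield_inverse subfield_divide

definition polys_over :: "'a::zero set \<Rightarrow> 'a poly set"
  where "polys_over R = {p. \<forall>i. coeff p i \<in> R}"

lemma polys_overI: "(\<And>i. coeff p i \<in> R) \<Longrightarrow> p \<in> polys_over R"
  and polys_overD: "p \<in> polys_over R \<Longrightarrow> coeff p i \<in> R"
  by (auto simp: polys_over_def)

lemma polys_over_mono: "R \<subseteq> S \<Longrightarrow> polys_over R \<subseteq> polys_over S"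
  by (auto simp: polys_over_def)

lemma polys_over_Int: "polys_over (R \<inter> S) = polys_over R \<inter> polys_over S"
  by (auto simp: polys_over_def)

lemma is_subring_polys_over:
  assumes "is_subring R"
  shows "is_subring (polys_over R)"
  unfolding is_subring_iff
proof (intro conjI ballI)
  show "1 \<in> polys_over R"
    by (rule polys_overI) (auto simp: coeff_1 intro: subring_intros[OF assms])
next
  fix p q assume "p \<in> polys_over R" "q \<in> polys_over R"
  then show "p - q \<in> polys_over R" "p * q \<in> polys_over R"
    by (auto simp: polys_over_def coeff_mult intro!: subring_intros[OF assms])
qed

context
  fixes R :: "'a::comm_ring_1 set"
  assumes R: "is_subring R"
begin

lemmas polys_over_ring = subring_intros[OF is_subring_polys_over[OF R]]

lemma polys_over_pCons: "a \<in> R \<Longrightarrow> p \<in> polys_over R \<Longrightarrow> pCons a p \<in> polys_over R"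
  by (auto simp: polys_over_def coeff_pCons split: nat.split)

lemma polys_over_smult: "a \<in> R \<Longrightarrow> p \<in> polys_over R \<Longrightarrow> smult a p \<in> polys_over R"
  by (auto simp: polys_over_def intro: subring_mult[OF R])

lemma polys_over_monom: "a \<in> R \<Longrightarrow> monom a n \<in> polys_over R"
  by (auto simp: polys_over_def intro: subring_0[OF R])

lemma polys_over_const: "a \<in> R \<Longrightarrow> [:a:] \<in> polys_over R"
  by (intro polys_over_pCons polys_over_ring)

lemma polys_over_linear: "a \<in> R \<Longrightarrow> [:- a, 1:] \<in> polys_over R"
  by (intro polys_over_pCons polys_over_ring subring_intros[OF R])

lemma poly_in_subring: "p \<in> polys_over R \<Longrightarrow> x \<in> R \<Longrightarrow> poly p x \<in> R"
  by (auto simp: poly_altdef polys_over_def intro!: subring_intros[OF R])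

lemma polys_over_pcompose: "p \<in> polys_over R \<Longrightarrow> q \<in> polys_over R \<Longrightarrow> pcompose p q \<in> polys_over R"
proof (induction p)
  case (pCons a p)
  then have "a \<in> R" "p \<in> polys_over R"
    using polys_overD[OF pCons.prems(1), of 0] polys_overD[OF pCons.prems(1), of "Suc _"]
    by (auto intro: polys_overI)
  with pCons show ?case
    by (auto simp: pcompose_pCons intro!: polys_over_ring polys_over_const)
qed simp

lemma polys_over_prod_mset:
  "(\<And>x. x \<in># M \<Longrightarrow> f x \<in> polys_over R) \<Longrightarrow> (\<Prod>x\<in>#M. f x) \<in> polys_over R"
  by (induction M) (auto intro: polys_over_ring)

end

lemma polys_over_pderiv:
  fixes R :: "'a::idom set"
  assumes "is_subring R" "p \<in> polys_over R"
  shows "pderiv p \<in> polys_over R"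
proof (rule polys_overI)
  fix i
  have "of_nat (Suc i) * coeff p (Suc i) \<in> R"
    by (intro subring_mult subring_of_nat assms polys_overD)
  then show "coeff (pderiv p) i \<in> R" by (simp only: coeff_pderiv)
qed

lemma poly_in_subring':
  "is_subring S \<Longrightarrow> R \<subseteq> S \<Longrightarrow> p \<in> polys_over R \<Longrightarrow> x \<in> S \<Longrightarrow> poly p x \<in> S"
  using poly_in_subring polys_over_mono by blast

text \<open>The zero polynomial has degree \<open>0\<close>, hence the first alternative for the remainder.\<close>

lemma polys_over_division:
  fixes m :: "'a::comm_ring_1 poly"
  assumes R: "is_subring R" and m: "m \<in> polys_over R" "lead_coeff m = 1"
  shows "p \<in> polys_over R \<Longrightarrow>
    \<exists>s\<in>polys_over R. \<exists>r\<in>polys_over R. p = m * s + r \<and> (r = 0 \<or> degree r < degree m)"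
proof (induction "degree p" arbitrary: p rule: less_induct)
  case less
  note intros = polys_over_ring[OF R] polys_over_monom[OF R] polys_overD
  show ?case
  proof (cases "p = 0 \<or> degree p < degree m")
    case True
    then show ?thesis
      using less.prems by (intro bexI[of _ 0] bexI[of _ p]) (auto intro: intros)
  next
    case False
    then have p: "p \<noteq> 0" and deg: "degree m \<le> degree p" by auto
    define t where "t = monom (lead_coeff p) (degree p - degree m)"
    have t: "t \<in> polys_over R" unfolding t_def using less.prems by (intro intros)
    define q where "q = p - m * t"
    have q: "q \<in> polys_over R" unfolding q_def using less.prems t m by (intro intros)
    have mt: "degree (m * t) \<le> degree p"
      unfolding t_def using deg degree_mult_le[of m "monom (lead_coeff p) (degree p - degree m)"]
        degree_monom_le[of "lead_coeff p" "degree p - degree m"] by linarith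
    have "coeff (m * t) (degree p) = lead_coeff p"
      unfolding t_def using deg m(2)
      by (subst mult.commute) (simp add: coeff_monom_mult)
    then have top: "coeff q (degree p) = 0" by (simp add: q_def)
    have degq: "degree q \<le> degree p" unfolding q_def using mt by (intro degree_diff_le) auto
    have "q = 0 \<or> degree q < degree p"
      using top degq by (metis le_neq_implies_less leading_coeff_0_iff)
    then obtain s r where sr: "s \<in> polys_over R" "r \<in> polys_over R" "q = m * s + r"
        "r = 0 \<or> degree r < degree m"
    proof
      assume "q = 0"
      then show thesis using that[of 0 0] by (auto intro: intros)
    next
      assume "degree q < degree p"
      then show thesis using less.hyps[OF _ q] that by blast
    qed
    have "p = m * (s + t) + r" using sr(3) by (simp add: q_def algebra_simps)
    then show ?thesis using sr t by (intro bexI[of _ "s + t"] bexI[of _ r]) (auto intro: intros)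
  qed
qed

lemma degree_pderiv_less:
  fixes p :: "'a::idom poly"
  assumes "degree p > 0"
  shows "degree (pderiv p) < degree p"
proof -
  have "degree (pderiv p) \<le> degree p - 1"
    by (rule degree_le) (auto simp: coeff_pderiv coeff_eq_0)
  then show ?thesis using assms by linarith
qed

lemma monic_power_minus_const:
  assumes "n > 0"
  shows "degree (monom 1 n - [:c :: 'a::comm_ring_1:]) = n" "lead_coeff (monom 1 n - [:c:]) = 1"
proof -
  show "degree (monom 1 n - [:c:]) = n"
    using assms degree_add_eq_left[of "- [:c:]" "monom 1 n"]
    unfolding diff_conv_add_uminus by (simp add: degree_monom_eq)
  then show "lead_coeff (monom 1 n - [:c:]) = 1"
    using assms by (simp add: coeff_pCons split: nat.split)
qed

lemma poly_eq_sum_less: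
  fixes p :: "'a::comm_ring_1 poly"
  assumes "p = 0 \<or> degree p < n"
  shows "poly p x = (\<Sum>i<n. coeff p i * x ^ i)"
proof -
  have "poly p x = (\<Sum>i\<le>degree p. coeff p i * x ^ i)" by (rule poly_altdef)
  also have "\<dots> = (\<Sum>i<n. coeff p i * x ^ i)"
  proof (cases "p = 0")
    case False
    then show ?thesis using assms by (intro sum.mono_neutral_left) (auto simp: coeff_eq_0)
  qed simp
  finally show ?thesis .
qed

section \<open>Algebraic elements, minimal polynomials and conjugates\<close>

definition alg_over :: "'a::field set \<Rightarrow> 'a \<Rightarrow> bool"
  where "alg_over F x \<longleftrightarrow> (\<exists>p\<in>polys_over F. p \<noteq> 0 \<and> poly p x = 0)"

definition minimal_poly :: "'a::field set \<Rightarrow> 'a \<Rightarrow> 'a poly \<Rightarrow> bool"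
  where "minimal_poly F x m \<longleftrightarrow> m \<in> polys_over F \<and> lead_coeff m = 1 \<and> poly m x = 0 \<and>
    (\<forall>q\<in>polys_over F. poly q x = 0 \<longrightarrow> q = 0 \<or> degree m \<le> degree q)"

text \<open>Conjugacy is an inclusion of vanishing ideals instead of the existence of an
  automorphism, so it also covers inseparable elements and elements outside a normal extension. The
  relation is one-sided: everything is related to a transcendental x, and symmetry holds for
  algebraic x.\<close>

definition conj_over :: "'a::field set \<Rightarrow> 'a \<Rightarrow> 'a \<Rightarrow> bool"
  where "conj_over F x y \<longleftrightarrow> (\<forall>p\<in>polys_over F. poly p x = 0 \<longrightarrow> poly p y = 0)"

lemma alg_over_mono: "F \<subseteq> F' \<Longrightarrow> alg_over F x \<Longrightarrow> alg_over F' x"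
  unfolding alg_over_def using polys_over_mono by blast

lemma minimal_poly_exists:
  assumes F: "is_subfield F" and x: "alg_over F x"
  obtains m where "minimal_poly F x m"
proof -
  define P where "P p \<longleftrightarrow> p \<in> polys_over F \<and> p \<noteq> 0 \<and> poly p x = 0" for p
  obtain p where "P p" using x by (auto simp: alg_over_def P_def)
  then obtain p where p: "P p" and min: "\<And>q. P q \<Longrightarrow> degree p \<le> degree q"
    using exists_least_iff[of "\<lambda>n. \<exists>p. P p \<and> degree p = n"] by (metis not_le_imp_less)
  define m where "m = smult (inverse (lead_coeff p)) p"
  have "lead_coeff p \<noteq> 0" using p by (simp add: P_def)
  moreover have "m \<in> polys_over F"
    unfolding m_def using p subfield_subring[OF F]
    by (auto simp: P_def intro!: polys_over_smult subfield_inverse[OF F] polys_overD)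
  ultimately have "minimal_poly F x m"
    unfolding minimal_poly_def using p min by (auto simp: m_def P_def)
  then show ?thesis by (rule that)
qed

lemma minimal_poly_dvd:
  assumes F: "is_subfield F" and m: "minimal_poly F x m" and q: "q \<in> polys_over F" "poly q x = 0"
  obtains s where "s \<in> polys_over F" "q = m * s"
proof -
  obtain s r where sr: "s \<in> polys_over F" "r \<in> polys_over F" "q = m * s + r"
      "r = 0 \<or> degree r < degree m"
    using polys_over_division[OF subfield_subring[OF F], of m q] m q by (auto simp: minimal_poly_def)
  have "poly r x = 0" using sr(3) q m by (simp add: minimal_poly_def)
  then have "r = 0" using m sr by (fastforce simp: minimal_poly_def)
  with sr that show ?thesis by simp
qed

lemma minimal_poly_degree_pos: "minimal_poly F x m \<Longrightarrow> degree m > 0"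
  by (auto simp: minimal_poly_def intro!: Nat.gr0I elim!: degree_eq_zeroE)

lemma minimal_polyD:
  assumes "minimal_poly F x m"
  shows "m \<in> polys_over F" "lead_coeff m = 1" "m \<noteq> 0" "poly m x = 0"
    "q \<in> polys_over F \<Longrightarrow> poly q x = 0 \<Longrightarrow> degree q < degree m \<Longrightarrow> q = 0"
  using assms by (auto simp: minimal_poly_def)

lemma minimal_poly_alg: "minimal_poly F x m \<Longrightarrow> alg_over F x"
  using minimal_polyD[of F x m] by (auto simp: alg_over_def)

lemma minimal_poly_degree_1:
  assumes "is_subfield F" "minimal_poly F x m" "degree m = 1"
  shows "x \<in> F"
proof -
  have "m = [:coeff m 0, 1:]"
    using assms(3) minimal_polyD(2)[OF assms(2)]
    by (intro poly_eqI) (auto simp: coeff_pCons coeff_eq_0 split: nat.split)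
  then have "coeff m 0 + x = 0"
    using minimal_polyD(4)[OF assms(2)] by (metis add.right_neutral mult.right_neutral mult_zero_right poly_0 poly_pCons)
  then have "x = - coeff m 0" by (simp add: eq_neg_iff_add_eq_0 add.commute)
  then show ?thesis
    using polys_overD[OF minimal_polyD(1)[OF assms(2)]] subring_minus[OF subfield_subring[OF assms(1)]] by simp
qed

lemma conj_over_refl: "conj_over F x x"
  by (simp add: conj_over_def)

lemma conj_over_trans: "conj_over F x y \<Longrightarrow> conj_over F y z \<Longrightarrow> conj_over F x z"
  by (simp add: conj_over_def)

lemma conj_over_mono: "F \<subseteq> F' \<Longrightarrow> conj_over F' x y \<Longrightarrow> conj_over F x y"
  unfolding conj_over_def using polys_over_mono by blast

lemma conj_over_iff_root:
  assumes "is_subfield F" "minimal_poly F x m"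
  shows "conj_over F x y \<longleftrightarrow> poly m y = 0"
proof
  assume "conj_over F x y"
  then show "poly m y = 0" using minimal_polyD[OF assms(2)] by (auto simp: conj_over_def)
next
  assume *: "poly m y = 0"
  show "conj_over F x y"
    unfolding conj_over_def
  proof (intro ballI impI)
    fix p assume "p \<in> polys_over F" "poly p x = 0"
    then obtain s where "p = m * s" using minimal_poly_dvd[OF assms] by metis
    then show "poly p y = 0" using * by simp
  qed
qed

lemma conj_over_alg: "conj_over F x y \<Longrightarrow> alg_over F x \<Longrightarrow> alg_over F y"
  by (auto simp: conj_over_def alg_over_def)

text \<open>The minimal polynomial of y divides that of x. The cofactor has smaller degree than the
  latter and cannot vanish at x, so the first factor does.\<close>

lemma conj_over_sym:
  assumes F: "is_subfield F" and x: "alg_over F x" and c: "conj_over F x y"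
  shows "conj_over F y x"
proof -
  obtain m where m: "minimal_poly F x m" using minimal_poly_exists[OF F x] .
  obtain n where n: "minimal_poly F y n"
    using minimal_poly_exists[OF F conj_over_alg[OF c x]] .
  have "poly m y = 0" using c m by (simp add: conj_over_iff_root[OF F m])
  then obtain s where s: "s \<in> polys_over F" "m = n * s"
    using minimal_poly_dvd[OF F n] minimal_polyD[OF m] by metis
  then have s0: "s \<noteq> 0" "n \<noteq> 0" using minimal_polyD(3)[OF m] by auto
  then have "degree s < degree m"
    using s minimal_poly_degree_pos[OF n] by (simp add: degree_mult_eq)
  then have "poly s x \<noteq> 0" using minimal_polyD(5)[OF m] s s0 by blast
  then have "poly n x = 0" using minimal_polyD(4)[OF m] s by simp
  then show ?thesis by (simp add: conj_over_iff_root[OF F n])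
qed

lemma conj_over_poly:
  assumes F: "is_subfield F" and "conj_over F x y" "g \<in> polys_over F"
  shows "conj_over F (poly g x) (poly g y)"
  unfolding conj_over_def
proof (intro ballI impI)
  fix p assume "p \<in> polys_over F" "poly p (poly g x) = 0"
  then have "pcompose p g \<in> polys_over F" "poly (pcompose p g) x = 0"
    using assms by (auto simp: poly_pcompose intro: polys_over_pcompose subfield_subring)
  then show "poly p (poly g y) = 0"
    using assms(2) by (auto simp: conj_over_def poly_pcompose)
qed

lemma conj_over_scale:
  "is_subfield F \<Longrightarrow> conj_over F x y \<Longrightarrow> c \<in> F \<Longrightarrow> conj_over F (c * x) (c * y)"
  using conj_over_poly[of F x y "[:0, c:]"]
  by (simp add: polys_over_pCons polys_over_ring subfield_intros subfield_subring mult.commute)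

lemma conj_over_translate:
  "is_subfield F \<Longrightarrow> conj_over F x y \<Longrightarrow> c \<in> F \<Longrightarrow> conj_over F (x - c) (y - c)"
  using conj_over_poly[of F x y "[:-c, 1:]"]
  by (simp add: polys_over_linear subfield_subring)

lemma conj_over_power:
  "is_subfield F \<Longrightarrow> conj_over F x y \<Longrightarrow> conj_over F (x ^ n) (y ^ n)"
  using conj_over_poly[of F x y "monom 1 n"]
  by (simp add: polys_over_monom subfield_intros subfield_subring poly_monom)

lemma conj_over_self_eq: "is_subfield F \<Longrightarrow> conj_over F x y \<Longrightarrow> x \<in> F \<Longrightarrow> y = x"
  unfolding conj_over_def
  by (drule bspec[of _ _ "[:- x, 1:]"]) (auto intro: polys_over_linear subfield_subring)

text \<open>Reversing the coefficients turns a polynomial vanishing at 1/x into one vanishing at x.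
  Algebraicity excludes y = 0, since by symmetry x would be a conjugate of 0.\<close>

lemma conj_over_inverse:
  assumes F: "is_subfield F" and c: "conj_over F x y" and "x \<noteq> 0" "alg_over F x"
  shows "conj_over F (inverse x) (inverse y)"
proof -
  have y0: "y \<noteq> 0"
  proof
    assume "y = 0"
    then have "conj_over F 0 x" using conj_over_sym[OF F assms(4) c] by simp
    then have "x = 0" using conj_over_self_eq[OF F, of 0 x] subfield_intros(1)[OF F] by simp
    with assms show False by simp
  qed
  show ?thesis
    unfolding conj_over_def
  proof (intro ballI impI)
    fix p assume p: "p \<in> polys_over F" "poly p (inverse x) = 0"
    have "reflect_poly p \<in> polys_over F"
      using p(1) subfield_intros(1)[OF F] by (auto simp: polys_over_def coeff_reflect_poly)
    moreover have "poly (reflect_poly p) x = 0"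
      using p(2) assms by (simp add: poly_reflect_poly_nz)
    ultimately have "poly (reflect_poly p) y = 0" using c by (auto simp: conj_over_def)
    then show "poly p (inverse y) = 0" using y0 by (simp add: poly_reflect_poly_nz)
  qed
qed

lemma minimal_poly_splits:
  fixes x :: "'a::alg_closed_field"
  assumes F: "is_subfield F" and m: "minimal_poly F x m"
  obtains A where "size A = degree m" "m = (\<Prod>a\<in>#A. [:- a, 1:])" "\<And>a. a \<in># A \<Longrightarrow> conj_over F x a"
proof -
  obtain A where A: "size A = degree m" "m = (\<Prod>a\<in>#A. [:- a, 1:])"
    using alg_closed_imp_factorization[OF minimal_polyD(3)[OF m]] minimal_polyD(2)[OF m] by auto
  have "conj_over F x a" if "a \<in># A" for a
    using that unfolding conj_over_iff_root[OF F m] A(2) by (auto simp: poly_prod_mset)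
  then show ?thesis using that A by blast
qed

text \<open>Being a simple root of some polynomial over F is visibly stable under enlarging F;
  \<open>minimal_poly_simple_root\<close> recovers the criterion for the minimal polynomial.\<close>

definition sep_over :: "'a::field set \<Rightarrow> 'a \<Rightarrow> bool"
  where "sep_over F x \<longleftrightarrow> (\<exists>p\<in>polys_over F. poly p x = 0 \<and> poly (pderiv p) x \<noteq> 0)"

lemma sep_over_mono: "F \<subseteq> F' \<Longrightarrow> sep_over F x \<Longrightarrow> sep_over F' x"
  unfolding sep_over_def using polys_over_mono by blast

lemma sep_over_alg: "sep_over F x \<Longrightarrow> alg_over F x"
  unfolding sep_over_def alg_over_def by (metis pderiv_0 poly_0)

lemma minimal_poly_simple_root:
  assumes F: "is_subfield F" and m: "minimal_poly F x m" and s: "sep_over F x"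
  shows "poly (pderiv m) x \<noteq> 0"
proof -
  obtain p where p: "p \<in> polys_over F" "poly p x = 0" "poly (pderiv p) x \<noteq> 0"
    using s by (auto simp: sep_over_def)
  then obtain t where "p = m * t" using minimal_poly_dvd[OF F m] by metis
  with p show ?thesis using minimal_polyD(4)[OF m] by (auto simp: pderiv_mult)
qed

lemma sep_over_conj:
  assumes F: "is_subfield F" and s: "sep_over F x" and c: "conj_over F x y"
  shows "sep_over F y"
proof -
  obtain m where m: "minimal_poly F x m" using minimal_poly_exists[OF F sep_over_alg[OF s]] .
  have "poly (pderiv m) y \<noteq> 0"
    using minimal_poly_simple_root[OF F m s] conj_over_sym[OF F sep_over_alg[OF s] c]
      polys_over_pderiv[OF subfield_subring[OF F]] minimal_polyD(1)[OF m]
    by (auto simp: conj_over_def)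
  moreover have "poly m y = 0" using c by (simp add: conj_over_iff_root[OF F m])
  ultimately show ?thesis using minimal_polyD(1)[OF m] by (auto simp: sep_over_def)
qed

text \<open>If the minimal polynomial had degree above 1, its quotient by X - x would have a root.
  That root is a conjugate of x, hence equal to x, and x would be a double root.\<close>

lemma conj_fixed_in_subfield:
  fixes x :: "'a::alg_closed_field"
  assumes F: "is_subfield F" and s: "sep_over F x" and fixed: "\<And>y. conj_over F x y \<Longrightarrow> y = x"
  shows "x \<in> F"
proof -
  obtain m where m: "minimal_poly F x m" using minimal_poly_exists[OF F sep_over_alg[OF s]] .
  obtain q where q: "m = [:- x, 1:] * q"
    using minimal_polyD(4)[OF m] by (metis dvdE poly_eq_0_iff_dvd)
  have "degree q = 0"
  proof (rule ccontr)
    assume "degree q \<noteq> 0"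
    then obtain y where y: "poly q y = 0" using alg_closed_imp_poly_has_root[of q] by auto
    then have "poly m y = 0" using q by simp
    then have "y = x" using fixed conj_over_iff_root[OF F m] by simp
    then have "poly (pderiv m) x = 0" using y by (simp add: q pderiv_mult del: mult_pCons_left)
    then show False using minimal_poly_simple_root[OF F m s] by simp
  qed
  moreover have "degree m = Suc (degree q)"
    using q minimal_polyD(3)[OF m] by (auto simp: degree_mult_eq simp del: mult_pCons_left)
  ultimately show ?thesis using minimal_poly_degree_1[OF F m] by simp
qed

section \<open>Galois theory of simple extensions\<close>

definition adjoin :: "'a::comm_ring_1 set \<Rightarrow> 'a \<Rightarrow> 'a set"
  where "adjoin R x = {poly g x | g. g \<in> polys_over R}"

lemma adjoinI: "g \<in> polys_over R \<Longrightarrow> poly g x \<in> adjoin R x"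
  by (auto simp: adjoin_def)

lemma adjoinE:
  assumes "y \<in> adjoin R x"
  obtains g where "g \<in> polys_over R" "y = poly g x"
  using assms by (auto simp: adjoin_def)

lemma is_subring_adjoin:
  assumes "is_subring R"
  shows "is_subring (adjoin R x)"
  unfolding is_subring_iff adjoin_def
  using polys_over_ring[OF assms]
  by (auto intro: exI[of _ 1] exI[of _ "_ - _"] exI[of _ "_ * _"])

lemma adjoin_contains: "is_subring R \<Longrightarrow> R \<subseteq> adjoin R x"
  by (auto simp: adjoin_def intro!: exI[of _ "[:_:]"] polys_over_const)

lemma adjoin_generator: "is_subring R \<Longrightarrow> x \<in> adjoin R x"
  unfolding adjoin_def
  by (auto intro!: exI[of _ "[:0, 1:]"] polys_over_pCons polys_over_const subring_0 subring_1)

lemma adjoin_subset: "is_subring S \<Longrightarrow> R \<subseteq> S \<Longrightarrow> x \<in> S \<Longrightarrow> adjoin R x \<subseteq> S"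
  by (auto simp: adjoin_def intro: poly_in_subring')

lemma adjoin_mono: "R \<subseteq> S \<Longrightarrow> adjoin R x \<subseteq> adjoin S x"
  unfolding adjoin_def using polys_over_mono by blast

lemma adjoin_reduced:
  assumes R: "is_subring R" and m: "m \<in> polys_over R" "lead_coeff m = 1" "poly m x = 0"
    and y: "y \<in> adjoin R x"
  obtains g where "g \<in> polys_over R" "y = poly g x" "g = 0 \<or> degree g < degree m"
proof -
  obtain h where h: "h \<in> polys_over R" "y = poly h x" using y by (rule adjoinE)
  obtain s r where "s \<in> polys_over R" "r \<in> polys_over R" "h = m * s + r" "r = 0 \<or> degree r < degree m"
    using polys_over_division[OF R m(1,2) h(1)] by metis
  then show ?thesis using that[of r] h m by simp
qed

lemma is_subfield_adjoin:
  assumes F: "is_subfield F" and x: "alg_over F x"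
  shows "is_subfield (adjoin F x)"
  unfolding is_subfield_def
proof (intro conjI ballI)
  show R: "is_subring (adjoin F x)" by (intro is_subring_adjoin subfield_subring F)
  fix y assume y: "y \<in> adjoin F x"
  obtain mx where mx: "minimal_poly F x mx" using minimal_poly_exists[OF F x] .
  show "inverse y \<in> adjoin F x"
  proof (cases "y = 0")
    case False
    text \<open>A nonzero multiple \<open>h(x) y\<close> in \<open>F\<close> comes from a remainder of minimal degree.\<close>
    define P where "P n \<longleftrightarrow> (\<exists>r\<in>polys_over F. \<exists>h\<in>polys_over F.
        poly r x = poly h x * y \<and> poly r x \<noteq> 0 \<and> degree r = n \<and> degree r < degree mx)" for n
    obtain g where g: "g \<in> polys_over F" "y = poly g x" "g = 0 \<or> degree g < degree mx"
      using adjoin_reduced[OF subfield_subring[OF F] minimal_polyD(1,2,4)[OF mx] y] .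
    have "P (degree g)"
      unfolding P_def using g False
      by (intro bexI[of _ g] bexI[of _ 1] polys_over_ring subfield_subring F) auto
    then obtain n where n: "P n" and least: "\<And>k. P k \<Longrightarrow> n \<le> k"
      using exists_least_iff[of P] by (metis not_le_imp_less)
    then obtain r h where rh: "r \<in> polys_over F" "h \<in> polys_over F" "poly r x = poly h x * y"
        "poly r x \<noteq> 0" "degree r = n" "degree r < degree mx" by (auto simp: P_def)
    define c where "c = lead_coeff r"
    have c: "c \<in> F" "c \<noteq> 0" using rh by (auto simp: c_def intro: polys_overD)
    define u where "u = smult (inverse c) r"
    have u: "u \<in> polys_over F" "lead_coeff u = 1" "degree u = n"
      using c rh subfield_subring[OF F]
      by (auto simp: u_def c_def[symmetric] intro!: polys_over_smult subfield_inverse[OF F])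
    obtain s t where st: "s \<in> polys_over F" "t \<in> polys_over F" "mx = u * s + t"
        "t = 0 \<or> degree t < degree u"
      using polys_over_division[OF subfield_subring[OF F] u(1,2) minimal_polyD(1)[OF mx]] by metis
    have ux: "poly u x = inverse c * poly h x * y" using rh by (simp add: u_def)
    \<comment> \<open>For a nonzero remainder t of \<open>mx\<close> modulo u, the element t(x) is
      again a multiple of y, and it is nonzero because deg t < deg \<open>mx\<close>. This would
      undercut the minimal degree n.\<close>
    have "t = 0"
    proof (rule ccontr)
      assume "t \<noteq> 0"
      then have dt: "degree t < degree u" using st by simp
      then have tx: "poly t x \<noteq> 0"
        using minimal_polyD(5)[OF mx st(2)] \<open>t \<noteq> 0\<close> rh u by fastforce
      have eq: "poly t x = - (poly s x * inverse c * poly h x) * y"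
        using arg_cong[OF st(3), of "\<lambda>p. poly p x"] minimal_polyD(4)[OF mx] ux
        by (simp add: algebra_simps eq_neg_iff_add_eq_0)
      have "P (degree t)"
        unfolding P_def
        using st(2) tx eq dt rh u c st(1) subfield_subring[OF F]
        by (intro bexI[of _ t] bexI[of _ "- (s * smult (inverse c) h)"])
           (auto intro!: polys_over_ring polys_over_smult subfield_inverse[OF F])
      then show False using least dt u by fastforce
    qed
    then have "mx = u * s" using st by simp
    then have "poly s x = 0" using minimal_polyD(4)[OF mx] rh c by (auto simp: u_def)
    moreover have "s \<noteq> 0" using \<open>mx = u * s\<close> minimal_polyD(3)[OF mx] by auto
    \<comment> \<open>The cofactor s vanishes at x, so it uses up the whole degree of
      \<open>mx\<close> and the monic u is 1. The relation for u(x) then displays the inverse of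
      y.\<close>
    ultimately have "\<not> degree s < degree mx" using minimal_polyD(5)[OF mx st(1)] by blast
    then have "degree u = 0"
      using \<open>mx = u * s\<close> minimal_polyD(3)[OF mx] by (auto simp: degree_mult_eq)
    then have "u = 1" using u(2) by (metis degree_eq_zeroE lead_coeff_pCons(2) one_pCons)
    then have "inverse c * poly h x * y = 1" using ux by simp
    then have eq: "inverse y = poly (smult (inverse c) h) x" by (simp add: inverse_unique mult.commute)
    have "smult (inverse c) h \<in> polys_over F"
      using rh c by (intro polys_over_smult subfield_inverse[OF F] subfield_subring[OF F])
    then show ?thesis unfolding eq by (rule adjoinI)
  qed (simp add: subring_0[OF R])
qed

text \<open>With x = a + c b, the element b is a common root of its minimal polynomial g and of f(x
  - c X), where f is the minimal polynomial of a. A further common root b' would make c one of the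
  finitely many quotients in \<open>D\<close>. Hence b has no other conjugate over F(x), and
  separability of b alone puts it into F(x).\<close>

lemma primitive_element_2:
  fixes F :: "'a::alg_closed_field set"
  assumes F: "is_subfield F" "infinite F" and a: "alg_over F a" and b: "sep_over F b"
    and alg: "\<And>c. c \<in> F \<Longrightarrow> alg_over F (a + c * b)"
  obtains c where "c \<in> F" "a \<in> adjoin F (a + c * b)" "b \<in> adjoin F (a + c * b)"
proof -
  obtain f where f: "minimal_poly F a f" using minimal_poly_exists[OF F(1) a] .
  obtain g where g: "minimal_poly F b g" using minimal_poly_exists[OF F(1) sep_over_alg[OF b]] .
  define D where "D = (\<lambda>(a', b'). (a' - a) / (b - b')) ` ({z. poly f z = 0} \<times> {z. poly g z = 0})"
  have "finite D"
    unfolding D_def using minimal_polyD(3)[OF f] minimal_polyD(3)[OF g]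
    by (intro finite_imageI finite_cartesian_product poly_roots_finite)
  then obtain c where c: "c \<in> F" "c \<notin> D" using F(2) by (meson finite_subset subsetI)
  define x where "x = a + c * b"
  define E where "E = adjoin F x"
  have E: "is_subfield E" unfolding E_def x_def by (intro is_subfield_adjoin F alg c)
  have FE: "F \<subseteq> E" unfolding E_def by (intro adjoin_contains subfield_subring F)
  have xE: "x \<in> E" unfolding E_def by (intro adjoin_generator subfield_subring F)
  have "b \<in> E"
  proof (rule conj_fixed_in_subfield[OF E sep_over_mono[OF FE b]])
    fix b' assume conj: "conj_over E b b'"
    then have gb: "poly g b' = 0"
      using conj_over_mono[OF FE] conj_over_iff_root[OF F(1) g] by blast
    define h where "h = pcompose f [:x, - c:]"
    have "h \<in> polys_over E"
      unfolding h_def using minimal_polyD(1)[OF f] polys_over_mono[OF FE] xE FE c subfield_subring[OF E]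
      by (intro polys_over_pcompose polys_over_pCons subring_intros polys_over_ring) auto
    moreover have "poly h b = 0"
      using minimal_polyD(4)[OF f] by (simp add: h_def poly_pcompose x_def mult.commute)
    ultimately have "poly h b' = 0" using conj by (auto simp: conj_over_def)
    then have fa: "poly f (x - c * b') = 0" by (simp add: h_def poly_pcompose mult.commute)
    show "b' = b"
    proof (rule ccontr)
      assume "b' \<noteq> b"
      then have "c = (x - c * b' - a) / (b - b')" by (simp add: x_def field_simps)
      then have "c \<in> D" unfolding D_def using fa gb by force
      with c show False by simp
    qed
  qed
  moreover from this have "x - c * b \<in> E" using xE c FE by (auto intro!: subfield_intros E)
  then have "a \<in> E" by (simp add: x_def)
  ultimately show ?thesis using that c by (simp add: E_def x_def)
qed

text \<open>The generator is recorded as an F-linear combination of Y: this explicit form is what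
  allows its separability and its conjugates to be computed from those of Y.\<close>

lemma primitive_element:
  fixes F :: "'a::alg_closed_field set"
  assumes F: "is_subfield F" "infinite F" and E: "is_subfield E" "F \<subseteq> E" "\<And>x. x \<in> E \<Longrightarrow> alg_over F x"
  shows "finite Y \<Longrightarrow> Y \<subseteq> E \<Longrightarrow> (\<And>y. y \<in> Y \<Longrightarrow> sep_over F y) \<Longrightarrow>
    \<exists>c. (\<forall>y\<in>Y. c y \<in> F) \<and> Y \<subseteq> adjoin F (\<Sum>y\<in>Y. c y * y)"
proof (induction Y rule: finite_induct)
  case empty
  show ?case by simp
next
  case (insert b Y)
  then obtain c where c: "\<forall>y\<in>Y. c y \<in> F" "Y \<subseteq> adjoin F (\<Sum>y\<in>Y. c y * y)" by auto
  define a where "a = (\<Sum>y\<in>Y. c y * y)"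
  have aE: "a \<in> E" unfolding a_def using c(1) E insert.prems by (intro subfield_intros) auto
  obtain d where d: "d \<in> F" "a \<in> adjoin F (a + d * b)" "b \<in> adjoin F (a + d * b)"
  proof (rule primitive_element_2[OF F, of a b])
    show "alg_over F a" "sep_over F b" using E(3) aE insert.prems by auto
    show "alg_over F (a + c * b)" if "c \<in> F" for c
      using aE E that insert.prems by (intro E(3) subfield_intros) auto
  qed
  have "Y \<subseteq> adjoin F (a + d * b)"
    using c(2) d(2) adjoin_subset[of "adjoin F (a + d * b)" F a]
      is_subring_adjoin adjoin_contains subfield_subring[OF F(1)] unfolding a_def by blast
  moreover have "(\<Sum>y\<in>insert b Y. (c(b := d)) y * y) = a + d * b"
    using insert.hyps by (auto simp: a_def add.commute intro!: sum.cong)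
  ultimately show ?case
    using d c(1) insert.hyps by (intro exI[of _ "c(b := d)"]) (simp del: fun_upd_apply, simp)
qed

lemma pderiv_sum: "pderiv (sum f I) = (\<Sum>i\<in>I. pderiv (f i))"
  by (induction I rule: infinite_finite_induct) (auto simp: pderiv_add)

text \<open>Derivations vanish on separable elements: if \<open>\<theta>\<close> were inseparable, then differentiating
  \<open>f\<^sub>y(y) = 0\<close> and \<open>\<theta> = \<Sum> c\<^sub>y y\<close> along \<open>y = g\<^sub>y(\<theta>)\<close> would give \<open>1 = 0\<close>.\<close>

lemma sep_over_generator:
  assumes F: "is_subfield F" and alg: "alg_over F \<theta>"
    and Y: "\<And>y. y \<in> Y \<Longrightarrow> c y \<in> F \<and> y \<in> adjoin F \<theta> \<and> sep_over F y" and \<theta>: "\<theta> = (\<Sum>y\<in>Y. c y * y)"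
  shows "sep_over F \<theta>"
proof (rule ccontr)
  assume insep: "\<not> sep_over F \<theta>"
  note R = subfield_subring[OF F]
  have D: "poly (pderiv p) \<theta> = 0" if "p \<in> polys_over F" "poly p \<theta> = 0" for p
    using insep that by (auto simp: sep_over_def)
  obtain g where g: "\<And>y. y \<in> Y \<Longrightarrow> g y \<in> polys_over F \<and> y = poly (g y) \<theta>"
    using Y adjoinE by metis
  have g': "poly (pderiv (g y)) \<theta> = 0" if y: "y \<in> Y" for y
  proof -
    obtain f where f: "f \<in> polys_over F" "poly f y = 0" "poly (pderiv f) y \<noteq> 0"
      using Y[OF y] by (auto simp: sep_over_def)
    have "poly (pderiv (pcompose f (g y))) \<theta> = 0"
      using f g[OF y] by (intro D polys_over_pcompose R) (auto simp: poly_pcompose)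
    then have "poly (pderiv f) y * poly (pderiv (g y)) \<theta> = 0"
      using g[OF y] by (simp add: pderiv_pcompose poly_pcompose)
    then show ?thesis using f by simp
  qed
  define h where "h = [:0, 1:] - (\<Sum>y\<in>Y. smult (c y) (g y))"
  have "h \<in> polys_over F"
    unfolding h_def using Y g
    by (intro polys_over_ring polys_over_smult polys_over_pCons subring_0 subring_1 R) auto
  moreover have "poly h \<theta> = 0"
    using \<theta> g by (simp add: h_def poly_sum)
  ultimately have "poly (pderiv h) \<theta> = 0" by (rule D)
  moreover have "poly (pderiv h) \<theta> = 1"
    using g' by (simp add: h_def pderiv_diff pderiv_sum pderiv_smult pderiv_pCons poly_sum)
  ultimately show False by simp
qed

text \<open>A double root a would be a root of the derivative; as x is a conjugate of a, the
  derivative would vanish at x too.\<close>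

lemma sep_minimal_poly_eq_prod:
  fixes x :: "'a::alg_closed_field"
  assumes F: "is_subfield F" and m: "minimal_poly F x m" and s: "sep_over F x"
  shows "m = (\<Prod>a\<in>{a. poly m a = 0}. [:- a, 1:])"
proof -
  obtain A where A: "m = (\<Prod>a\<in>#A. [:- a, 1:])"
    using alg_closed_imp_factorization[OF minimal_polyD(3)[OF m]] minimal_polyD(2)[OF m] by auto
  have roots: "set_mset A = {a. poly m a = 0}"
    unfolding A by (auto simp: poly_prod_mset)
  have "count A a = 1" if "a \<in># A" for a
  proof (rule ccontr)
    assume "count A a \<noteq> 1"
    with that have "count A a \<ge> 2" by (metis One_nat_def Suc_1 Suc_leI count_greater_zero_iff le_neq_implies_less)
    then have "replicate_mset 2 a \<subseteq># A" by (simp add: count_le_replicate_mset_subset_eq)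
    then obtain B where "A = replicate_mset 2 a + B" using mset_subset_eq_exists_conv by blast
    then have "m = [:- a, 1:] * ([:- a, 1:] * (\<Prod>a\<in>#B. [:- a, 1:]))"
      unfolding A by (simp add: numeral_2_eq_2 del: mult_pCons_left)
    then have "poly (pderiv m) a = 0" by (simp add: pderiv_mult del: mult_pCons_left)
    moreover have "conj_over F a x"
      using that roots conj_over_iff_root[OF F m] conj_over_sym[OF F minimal_poly_alg[OF m]] by auto
    ultimately have "poly (pderiv m) x = 0"
      using polys_over_pderiv[OF subfield_subring[OF F] minimal_polyD(1)[OF m]] by (auto simp: conj_over_def)
    then show False using minimal_poly_simple_root[OF F m s] by simp
  qed
  then have "A = mset_set (set_mset A)"
    by (intro multiset_eqI) (metis count_eq_zero_iff count_mset_set(1) count_mset_set(3) finite_set_mset)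
  then have "m = (\<Prod>a\<in>set_mset A. [:- a, 1:])"
    using A by (metis prod_unfold_prod_mset)
  then show ?thesis by (simp add: roots)
qed

section \<open>Automorphisms of simple Galois extensions\<close>

definition hom_on :: "'a::comm_ring_1 set \<Rightarrow> ('a \<Rightarrow> 'a) \<Rightarrow> bool"
  where "hom_on E \<sigma> \<longleftrightarrow> \<sigma> 1 = 1 \<and>
    (\<forall>x\<in>E. \<forall>y\<in>E. \<sigma> (x + y) = \<sigma> x + \<sigma> y \<and> \<sigma> (x * y) = \<sigma> x * \<sigma> y)"

context
  fixes E :: "'a::comm_ring_1 set" and \<sigma>
  assumes E: "is_subring E" and hom: "hom_on E \<sigma>"
begin

lemma hom_on_add: "x \<in> E \<Longrightarrow> y \<in> E \<Longrightarrow> \<sigma> (x + y) = \<sigma> x + \<sigma> y"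
  and hom_on_mult: "x \<in> E \<Longrightarrow> y \<in> E \<Longrightarrow> \<sigma> (x * y) = \<sigma> x * \<sigma> y"
  and hom_on_1: "\<sigma> 1 = 1"
  using hom by (auto simp: hom_on_def)

lemma hom_on_0: "\<sigma> 0 = 0"
  using hom_on_add[of 0 0] subring_0[OF E] by simp

lemma hom_on_minus: "x \<in> E \<Longrightarrow> \<sigma> (- x) = - \<sigma> x"
  using hom_on_add[of x "- x"] subring_minus[OF E, of x] by (simp add: hom_on_0 eq_neg_iff_add_eq_0 add.commute)

lemma hom_on_diff: "x \<in> E \<Longrightarrow> y \<in> E \<Longrightarrow> \<sigma> (x - y) = \<sigma> x - \<sigma> y"
  using hom_on_add[of x "- y"] subring_minus[OF E, of y] by (simp add: hom_on_minus)

lemma hom_on_sum: "(\<And>i. i \<in> I \<Longrightarrow> f i \<in> E) \<Longrightarrow> \<sigma> (sum f I) = (\<Sum>i\<in>I. \<sigma> (f i))"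
  by (induction I rule: infinite_finite_induct) (auto simp: hom_on_0 hom_on_add subring_sum[OF E])

lemma hom_on_prod: "(\<And>i. i \<in> I \<Longrightarrow> f i \<in> E) \<Longrightarrow> \<sigma> (prod f I) = (\<Prod>i\<in>I. \<sigma> (f i))"
  by (induction I rule: infinite_finite_induct) (auto simp: hom_on_1 hom_on_mult subring_prod[OF E])

lemma coeff_map_hom: "coeff (map_poly \<sigma> p) i = \<sigma> (coeff p i)"
  by (simp add: coeff_map_poly hom_on_0)

lemma map_hom_mult:
  "p \<in> polys_over E \<Longrightarrow> q \<in> polys_over E \<Longrightarrow> map_poly \<sigma> (p * q) = map_poly \<sigma> p * map_poly \<sigma> q"
  by (intro poly_eqI)
    (auto simp: coeff_map_hom coeff_mult hom_on_sum hom_on_mult polys_overD subring_mult[OF E])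

lemma map_hom_1: "map_poly \<sigma> 1 = 1"
  by (simp add: hom_on_1 map_poly_1')

lemma map_hom_prod:
  "(\<And>i. i \<in> I \<Longrightarrow> f i \<in> polys_over E) \<Longrightarrow> map_poly \<sigma> (prod f I) = (\<Prod>i\<in>I. map_poly \<sigma> (f i))"
  by (induction I rule: infinite_finite_induct)
    (auto simp: map_hom_1 map_hom_mult polys_over_ring[OF E])

lemma poly_map_hom:
  "p \<in> polys_over E \<Longrightarrow> x \<in> E \<Longrightarrow> \<sigma> (poly p x) = poly (map_poly \<sigma> p) (\<sigma> x)"
proof (induction p)
  case (pCons a p)
  then have "a \<in> E" "p \<in> polys_over E"
    using polys_overD[OF pCons.prems(1), of 0] polys_overD[OF pCons.prems(1), of "Suc _"]
    by (auto intro: polys_overI)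
  with pCons show ?case
    by (simp add: map_poly_pCons hom_on_0 hom_on_add hom_on_mult poly_in_subring[OF E] subring_mult[OF E])
qed (simp add: hom_on_0)

lemma map_hom_linear: "a \<in> E \<Longrightarrow> map_poly \<sigma> [:- a, 1:] = [:- \<sigma> a, 1:]"
  by (simp add: map_poly_pCons hom_on_0 hom_on_1 hom_on_minus)

text \<open>The map permutes the linear factors, so it fixes all elementary symmetric functions of
  W.\<close>

lemma hom_fixes_root_product:
  assumes W: "finite W" "W \<subseteq> E" and perm: "bij_betw \<sigma> W W"
  shows "\<sigma> (coeff (\<Prod>w\<in>W. [:- w, 1:]) i) = coeff (\<Prod>w\<in>W. [:- w, 1:]) i"
proof -
  have "map_poly \<sigma> (\<Prod>w\<in>W. [:- w, 1:]) = (\<Prod>w\<in>W. [:- \<sigma> w, 1:])"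
    using W by (subst map_hom_prod) (auto simp: map_hom_linear intro!: prod.cong polys_over_linear E)
  also have "\<dots> = (\<Prod>w\<in>W. [:- w, 1:])"
    using prod.reindex_bij_betw[OF perm, of "\<lambda>w. [:- w, 1:]"] .
  finally show ?thesis by (metis coeff_map_hom)
qed

end

lemma hom_on_inj:
  fixes E :: "'a::field set"
  assumes "is_subfield E" "hom_on E \<sigma>"
  shows "inj_on \<sigma> E"
proof (rule inj_onI)
  fix x y assume *: "x \<in> E" "y \<in> E" "\<sigma> x = \<sigma> y"
  note E = subfield_subring[OF assms(1)]
  have d: "x - y \<in> E" using * by (intro subring_diff E)
  show "x = y"
  proof (rule ccontr)
    assume "x \<noteq> y"
    then have "\<sigma> ((x - y) * inverse (x - y)) = 1" using hom_on_1[OF E assms(2)] by simp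
    then show False
      using hom_on_mult[OF E assms(2) d subfield_inverse[OF assms(1) d]] *
        hom_on_diff[OF E assms(2), of x y] by simp
  qed
qed

text \<open>Automorphisms are extended by the identity outside \<open>E\<close>, so that composition is \<open>(\<circ>)\<close>.\<close>

definition gal :: "'a::field set \<Rightarrow> 'a set \<Rightarrow> ('a \<Rightarrow> 'a) set"
  where "gal F E = {\<sigma>. hom_on E \<sigma> \<and> \<sigma> ` E \<subseteq> E \<and> (\<forall>x\<in>F. \<sigma> x = x) \<and> (\<forall>x. x \<notin> E \<longrightarrow> \<sigma> x = x)}"

text \<open>Separability and normality are imposed on the generator only: an automorphism is
  determined by the image of \<theta>, and every conjugate of \<theta> in E is such an
  image.\<close>

locale simple_galois =
  fixes F E :: "'a::alg_closed_field set" and \<theta> :: 'a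
  assumes F: "is_subfield F" and E_eq: "E = adjoin F \<theta>" and sep_theta: "sep_over F \<theta>"
    and normal: "\<And>y. conj_over F \<theta> y \<Longrightarrow> y \<in> E"
begin

lemma alg_theta: "alg_over F \<theta>"
  by (rule sep_over_alg[OF sep_theta])

lemma E: "is_subfield E"
  unfolding E_eq by (intro is_subfield_adjoin F alg_theta)

lemmas E_ring = subfield_subring[OF E] and F_ring = subfield_subring[OF F]

lemma F_subset: "F \<subseteq> E"
  unfolding E_eq by (intro adjoin_contains F_ring)

lemma theta_in: "\<theta> \<in> E"
  unfolding E_eq by (intro adjoin_generator F_ring)

lemma gal_hom: "\<sigma> \<in> gal F E \<Longrightarrow> hom_on E \<sigma>"
  and gal_closed: "\<sigma> \<in> gal F E \<Longrightarrow> x \<in> E \<Longrightarrow> \<sigma> x \<in> E"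
  and gal_fix: "\<sigma> \<in> gal F E \<Longrightarrow> x \<in> F \<Longrightarrow> \<sigma> x = x"
  by (auto simp: gal_def)

lemma gal_inj: "\<sigma> \<in> gal F E \<Longrightarrow> inj \<sigma>"
  using hom_on_inj[OF E, of \<sigma>] unfolding gal_def inj_def inj_on_def by (smt (verit) imageI mem_Collect_eq subsetD)

lemma gal_id: "id \<in> gal F E"
  by (auto simp: gal_def hom_on_def)

lemma gal_comp: "\<sigma> \<in> gal F E \<Longrightarrow> \<tau> \<in> gal F E \<Longrightarrow> \<sigma> \<circ> \<tau> \<in> gal F E"
  using F_subset by (auto simp: gal_def hom_on_def image_subset_iff)

lemma gal_poly:
  assumes "\<sigma> \<in> gal F E" "p \<in> polys_over F" "x \<in> E"
  shows "\<sigma> (poly p x) = poly p (\<sigma> x)"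
proof -
  have "map_poly \<sigma> p = p"
    using coeff_map_hom[OF E_ring gal_hom[OF assms(1)]] gal_fix[OF assms(1) polys_overD[OF assms(2)]]
    by (intro poly_eqI) simp
  then show ?thesis
    using poly_map_hom[OF E_ring gal_hom[OF assms(1)], of p x] assms polys_over_mono[OF F_subset] by auto
qed

lemma gal_conj:
  assumes "\<sigma> \<in> gal F E" "x \<in> E"
  shows "conj_over F x (\<sigma> x)"
  using gal_poly[OF assms(1) _ assms(2)] hom_on_0[OF E_ring gal_hom[OF assms(1)]]
  by (auto simp: conj_over_def) (metis)

lemma gal_eqI:
  assumes "\<sigma> \<in> gal F E" "\<tau> \<in> gal F E" "\<sigma> \<theta> = \<tau> \<theta>"
  shows "\<sigma> = \<tau>"
proof
  fix x show "\<sigma> x = \<tau> x"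
  proof (cases "x \<in> E")
    case True
    then obtain g where "g \<in> polys_over F" "x = poly g \<theta>" unfolding E_eq by (rule adjoinE)
    then show ?thesis using assms by (simp add: gal_poly theta_in)
  qed (use assms in \<open>auto simp: gal_def\<close>)
qed

lemma finite_gal: "finite (gal F E)"
proof -
  obtain m where m: "minimal_poly F \<theta> m" using minimal_poly_exists[OF F alg_theta] .
  have "(\<lambda>\<sigma>. \<sigma> \<theta>) ` gal F E \<subseteq> {y. poly m y = 0}"
    using gal_conj[OF _ theta_in] conj_over_iff_root[OF F m] by auto
  then have "finite ((\<lambda>\<sigma>. \<sigma> \<theta>) ` gal F E)"
    using poly_roots_finite[OF minimal_polyD(3)[OF m]] finite_subset by blast
  then show ?thesis by (rule finite_imageD) (auto intro!: inj_onI gal_eqI)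
qed

text \<open>Substituting \<eta> for \<theta> in g(\<theta>) does not depend on the choice of g,
  since a difference that vanishes at \<theta> vanishes at \<eta>. So the representatives picked by
  choice add and multiply correctly.\<close>

lemma gal_exists:
  assumes c: "conj_over F \<theta> \<eta>"
  obtains \<sigma> where "\<sigma> \<in> gal F E" "\<sigma> \<theta> = \<eta>"
proof -
  define rep where "rep x = (SOME g. g \<in> polys_over F \<and> x = poly g \<theta>)" for x
  define \<sigma> where "\<sigma> x = (if x \<in> E then poly (rep x) \<eta> else x)" for x
  have rep: "rep x \<in> polys_over F \<and> x = poly (rep x) \<theta>" if "x \<in> E" for x
    unfolding rep_def by (rule someI_ex) (use that in \<open>auto simp: E_eq adjoin_def\<close>)
  have key: "\<sigma> (poly g \<theta>) = poly g \<eta>" if g: "g \<in> polys_over F" for g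
  proof -
    have x: "poly g \<theta> \<in> E" unfolding E_eq using g by (rule adjoinI)
    have "rep (poly g \<theta>) - g \<in> polys_over F" using rep[OF x] g by (intro polys_over_ring F_ring) auto
    moreover have "poly (rep (poly g \<theta>) - g) \<theta> = 0" using rep[OF x] by simp
    ultimately have "poly (rep (poly g \<theta>) - g) \<eta> = 0" using c by (auto simp: conj_over_def)
    then show ?thesis using x by (simp add: \<sigma>_def)
  qed
  note ring = polys_over_ring[OF F_ring]
  have const: "\<sigma> a = a" if "a \<in> F" for a
    using key[OF polys_over_const[OF F_ring that]] by simp
  have "\<sigma> \<in> gal F E"
    unfolding gal_def hom_on_def
  proof (intro CollectI conjI ballI allI impI image_subsetI)
    show "\<sigma> 1 = 1" by (intro const subring_1 F_ring)
    fix x assume x: "x \<in> E"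
    then show "\<sigma> x \<in> E"
      using rep[OF x] normal[OF c] poly_in_subring'[OF E_ring F_subset] by (simp add: \<sigma>_def)
    fix y assume y: "y \<in> E"
    show "\<sigma> (x + y) = \<sigma> x + \<sigma> y" "\<sigma> (x * y) = \<sigma> x * \<sigma> y"
      using key[of "rep x + rep y"] key[of "rep x * rep y"] key[of "rep x"] key[of "rep y"]
        rep[OF x] rep[OF y] ring(4,6)[of "rep x" "rep y"] by auto
  qed (auto simp: const, simp add: \<sigma>_def)
  moreover have "\<sigma> \<theta> = \<eta>"
    using key[of "[:0, 1:]"] by (simp add: polys_over_pCons F_ring ring subring_intros)
  ultimately show ?thesis by (rule that)
qed

text \<open>Write x = g(\<theta>) with deg g below the degree of \<theta>. If all automorphisms fix
  x, then g - x has every conjugate of \<theta> as a root; these are as many as the degree of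
  \<theta> by separability, so g is constant.\<close>

lemma gal_fixed:
  assumes x: "x \<in> E" and fixed: "\<And>\<sigma>. \<sigma> \<in> gal F E \<Longrightarrow> \<sigma> x = x"
  shows "x \<in> F"
proof -
  obtain m where m: "minimal_poly F \<theta> m" using minimal_poly_exists[OF F alg_theta] .
  obtain g where g: "g \<in> polys_over F" "x = poly g \<theta>" "g = 0 \<or> degree g < degree m"
    using adjoin_reduced[OF F_ring minimal_polyD(1,2,4)[OF m]] x unfolding E_eq by metis
  define S where "S = {a. poly m a = 0}"
  have "degree m = card S"
    using sep_minimal_poly_eq_prod[OF F m sep_theta] degree_prod_eq_sum_degree[of S "\<lambda>a. [:- a, 1:]"]
    by (simp add: S_def)
  have "S \<subseteq> {a. poly (g - [:x:]) a = 0}"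
  proof
    fix a assume "a \<in> S"
    then have "conj_over F \<theta> a" by (simp add: S_def conj_over_iff_root[OF F m])
    then obtain \<sigma> where "\<sigma> \<in> gal F E" "\<sigma> \<theta> = a" by (rule gal_exists)
    then have "poly g a = x" using fixed g gal_poly theta_in by metis
    then show "a \<in> {a. poly (g - [:x:]) a = 0}" by simp
  qed
  moreover have "degree (g - [:x:]) < degree m"
    using g(3) minimal_poly_degree_pos[OF m] by (auto intro: degree_diff_less)
  ultimately have "g - [:x:] = 0"
    using \<open>degree m = card S\<close> poly_roots_finite[of "g - [:x:]"] card_mono[of "{a. poly (g - [:x:]) a = 0}" S]
      card_poly_roots_bound[of "g - [:x:]"] by fastforce
  then have "x = coeff g 0" by simp
  then show ?thesis using g by (simp add: polys_overD)
qed

lemma gal_fixed_poly: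
  assumes "p \<in> polys_over E" "\<And>\<sigma>. \<sigma> \<in> gal F E \<Longrightarrow> map_poly \<sigma> p = p"
  shows "p \<in> polys_over F"
proof (rule polys_overI, rule gal_fixed)
  fix i show "coeff p i \<in> E" by (rule polys_overD[OF assms(1)])
  fix \<sigma> assume "\<sigma> \<in> gal F E"
  then show "\<sigma> (coeff p i) = coeff p i"
    using assms(2) coeff_map_hom[OF E_ring gal_hom] by metis
qed

text \<open>The norm of a polynomial over E, the product of its images under the Galois group, has
  coefficients in F and keeps the root x through the factor of the identity.\<close>

lemma alg_over_trans:
  assumes "alg_over E x"
  shows "alg_over F x"
proof -
  obtain p where p: "p \<in> polys_over E" "p \<noteq> 0" "poly p x = 0" using assms by (auto simp: alg_over_def)
  define q where "q = (\<Prod>\<sigma>\<in>gal F E. map_poly \<sigma> p)"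
  have map: "map_poly \<sigma> p \<in> polys_over E" if "\<sigma> \<in> gal F E" for \<sigma>
    using that p(1) gal_closed coeff_map_hom[OF E_ring gal_hom] by (simp add: polys_over_def)
  have nz: "map_poly \<sigma> p \<noteq> 0" if \<sigma>: "\<sigma> \<in> gal F E" for \<sigma>
  proof
    assume "map_poly \<sigma> p = 0"
    then have "\<sigma> (lead_coeff p) = \<sigma> 0"
      using coeff_map_hom[OF E_ring gal_hom[OF \<sigma>], of p] hom_on_0[OF E_ring gal_hom[OF \<sigma>]]
      by (metis coeff_0)
    then show False using gal_inj[OF \<sigma>] p(2) by (simp add: inj_eq)
  qed
  have "q \<in> polys_over F"
  proof (rule gal_fixed_poly)
    show "q \<in> polys_over E" unfolding q_def by (intro polys_over_ring E_ring map)
    fix \<tau> assume \<tau>: "\<tau> \<in> gal F E"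
    have "map_poly \<tau> q = (\<Prod>\<sigma>\<in>gal F E. map_poly \<tau> (map_poly \<sigma> p))"
      unfolding q_def by (rule map_hom_prod[OF E_ring gal_hom[OF \<tau>] map])
    also have "\<dots> = (\<Prod>\<sigma>\<in>gal F E. map_poly (\<tau> \<circ> \<sigma>) p)"
      using hom_on_0[OF E_ring gal_hom] \<tau> by (intro prod.cong refl map_poly_map_poly) auto
    also have "\<dots> = q"
      unfolding q_def
    proof (rule prod.reindex_bij_betw[of "\<lambda>\<sigma>. \<tau> \<circ> \<sigma>" "gal F E" "gal F E" "\<lambda>\<sigma>. map_poly \<sigma> p"])
      have "inj_on (\<lambda>\<sigma>. \<tau> \<circ> \<sigma>) (gal F E)"
        using gal_inj[OF \<tau>] by (auto intro!: inj_onI simp: fun_eq_iff inj_eq)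
      moreover from this have "(\<lambda>\<sigma>. \<tau> \<circ> \<sigma>) ` gal F E = gal F E"
        using gal_comp[OF \<tau>] by (intro endo_inj_surj finite_gal) auto
      ultimately show "bij_betw (\<lambda>\<sigma>. \<tau> \<circ> \<sigma>) (gal F E) (gal F E)" by (simp add: bij_betw_def)
    qed
    finally show "map_poly \<tau> q = q" .
  qed
  moreover have "q \<noteq> 0" unfolding q_def using nz finite_gal by simp
  moreover have "poly q x = 0"
    unfolding q_def poly_prod using p(3) gal_id finite_gal map_poly_id[of p]
    by (auto intro!: bexI[of _ id])
  ultimately show ?thesis by (auto simp: alg_over_def)
qed

end

section \<open>Valuation rings\<close>

text \<open>The maximal ideal of a valuation ring. Zero needs its own case because
  \<open>inverse 0 = 0\<close> lies in V.\<close>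

definition nonunits :: "'a::field set \<Rightarrow> 'a set"
  where "nonunits V = {x \<in> V. x = 0 \<or> inverse x \<notin> V}"

locale valued_field =
  fixes V :: "'a::field set"
  assumes valuation: "valuation_ring V"
begin

abbreviation \<mm> where "\<mm> \<equiv> nonunits V"

lemma V: "is_subring V"
  using valuation by (simp add: valuation_ring_def)

lemmas V_intros = subring_intros[OF V]

lemma nonunit_in: "x \<in> \<mm> \<Longrightarrow> x \<in> V"
  by (simp add: nonunits_def)

lemma inverse_nonunit: "x \<notin> V \<Longrightarrow> inverse x \<in> \<mm>"
  using valuation by (auto simp: nonunits_def valuation_ring_def)

lemma unit_iff: "x \<in> V - \<mm> \<longleftrightarrow> x \<in> V \<and> inverse x \<in> V \<and> x \<noteq> 0"
  by (auto simp: nonunits_def)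

lemma unit_inverse: "x \<in> V - \<mm> \<Longrightarrow> inverse x \<in> V - \<mm>"
  by (auto simp: nonunits_def)

lemma unit_mult: "x \<in> V - \<mm> \<Longrightarrow> y \<in> V - \<mm> \<Longrightarrow> x * y \<in> V - \<mm>"
  unfolding unit_iff by (auto intro: V_intros)

lemma unit_divide: "x \<in> V - \<mm> \<Longrightarrow> y \<in> V - \<mm> \<Longrightarrow> x / y \<in> V - \<mm>"
  unfolding divide_inverse by (intro unit_mult unit_inverse)

lemma one_unit: "1 \<in> V - \<mm>"
  unfolding unit_iff by (auto intro: V_intros)

lemma unit_power:
  assumes "x \<in> V - \<mm>"
  shows "x ^ n \<in> V - \<mm>"
proof (induction n)
  case (Suc n)
  show ?case using unit_mult[OF assms Suc] by simp
qed (use one_unit in simp)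

lemma unit_prod:
  assumes "\<And>i. i \<in> I \<Longrightarrow> f i \<in> V - \<mm>"
  shows "prod f I \<in> V - \<mm>"
  using assms
proof (induction I rule: infinite_finite_induct)
  case (insert i I)
  then show ?case using unit_mult[of "f i" "prod f I"] by simp
qed (use one_unit in simp_all)

lemma nonunit_mult:
  assumes "x \<in> \<mm>" "y \<in> V"
  shows "x * y \<in> \<mm>" "y * x \<in> \<mm>"
proof -
  have "inverse x \<in> V" if "inverse (x * y) \<in> V" "x \<noteq> 0" "y \<noteq> 0"
    using V_intros(4)[OF assms(2) that(1)] that(2,3) by (simp add: field_simps)
  then show "x * y \<in> \<mm>" using assms by (auto simp: nonunits_def intro: V_intros)
  then show "y * x \<in> \<mm>" by (simp add: mult.commute)
qed

lemma nonunit_0: "0 \<in> \<mm>"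
  by (simp add: nonunits_def V_intros)

lemma nonunit_add:
  assumes "x \<in> \<mm>" "y \<in> \<mm>"
  shows "x + y \<in> \<mm>"
proof (cases "x = 0 \<or> y = 0")
  case False
  have *: "a + b \<in> \<mm>" if "a \<in> \<mm>" "a \<noteq> 0" "b / a \<in> V" for a b
  proof -
    have "a * (1 + b / a) \<in> \<mm>" using that by (intro nonunit_mult V_intros)
    moreover have "a * (1 + b / a) = a + b" using that by (simp add: distrib_left)
    ultimately show ?thesis by (simp only:)
  qed
  have "y / x \<in> V \<or> inverse (y / x) \<in> V"
    using valuation unfolding valuation_ring_def by blast
  then have "y / x \<in> V \<or> x / y \<in> V" by simp
  then show ?thesis using *[of x y] *[of y x] assms False by (auto simp: add.commute)
qed (use assms in auto)

lemma nonunit_minus: "x \<in> \<mm> \<Longrightarrow> - x \<in> \<mm>"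
  using nonunit_mult(1)[of x "-1"] V_intros(5)[OF V_intros(2)] by simp

lemma nonunit_diff: "x \<in> \<mm> \<Longrightarrow> y \<in> \<mm> \<Longrightarrow> x - y \<in> \<mm>"
  using nonunit_add[of x "- y"] nonunit_minus[of y] by simp

lemma nonunit_sum: "(\<And>i. i \<in> I \<Longrightarrow> f i \<in> \<mm>) \<Longrightarrow> sum f I \<in> \<mm>"
  by (induction I rule: infinite_finite_induct) (auto intro: nonunit_0 nonunit_add)

lemma nonunit_prime: "x \<in> V \<Longrightarrow> y \<in> V \<Longrightarrow> x * y \<in> \<mm> \<Longrightarrow> x \<in> \<mm> \<or> y \<in> \<mm>"
  using unit_mult[of x y] by auto

lemma nonunit_power: "x \<in> V \<Longrightarrow> x ^ n \<in> \<mm> \<Longrightarrow> x \<in> \<mm>"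
  using unit_power[of x n] by auto

lemma one_not_nonunit: "1 \<notin> \<mm>"
  using one_unit by simp

lemma unit_add_nonunit: "x \<in> V - \<mm> \<Longrightarrow> y \<in> \<mm> \<Longrightarrow> x + y \<in> V - \<mm>"
  using nonunit_diff[of "x + y" y] nonunit_in[of y] by (auto intro: V_intros)

lemma unit_cong: "x \<in> V - \<mm> \<Longrightarrow> y - x \<in> \<mm> \<Longrightarrow> y \<in> V - \<mm>"
  using unit_add_nonunit[of x "y - x"] by simp

lemma nonunit_cong: "x \<in> \<mm> \<Longrightarrow> y - x \<in> \<mm> \<Longrightarrow> y \<in> \<mm>"
  using nonunit_add[of "y - x" x] by simp

lemma V_cong: "x \<in> V \<Longrightarrow> y - x \<in> \<mm> \<Longrightarrow> y \<in> V"
  using V_intros(6)[of "y - x" x] nonunit_in by simp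

lemma cong_trans: "x - y \<in> \<mm> \<Longrightarrow> y - z \<in> \<mm> \<Longrightarrow> x - z \<in> \<mm>"
  using nonunit_add[of "x - y" "y - z"] by simp

lemma cong_sym: "x - y \<in> \<mm> \<Longrightarrow> y - x \<in> \<mm>"
  using nonunit_minus[of "x - y"] by simp

lemma cong_mult:
  assumes "x - x' \<in> \<mm>" "y - y' \<in> \<mm>" "x \<in> V" "y' \<in> V"
  shows "x * y - x' * y' \<in> \<mm>"
proof -
  have "x * y - x' * y' = x * (y - y') + (x - x') * y'" by (simp add: algebra_simps)
  then show ?thesis using assms by (auto intro: nonunit_add nonunit_mult)
qed

lemma cong_power: "x - y \<in> \<mm> \<Longrightarrow> x \<in> V \<Longrightarrow> y \<in> V \<Longrightarrow> x ^ n - y ^ n \<in> \<mm>"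
  by (induction n) (auto intro: nonunit_0 cong_mult V_intros)

lemma poly_in_V: "p \<in> polys_over V \<Longrightarrow> x \<in> V \<Longrightarrow> poly p x \<in> V"
  by (rule poly_in_subring[OF V])

lemma cong_poly:
  assumes "x - y \<in> \<mm>" "x \<in> V" "y \<in> V" "p \<in> polys_over V"
  shows "poly p x - poly p y \<in> \<mm>"
  using assms(4)
proof (induction p)
  case (pCons a p)
  then have "a \<in> V" "p \<in> polys_over V"
    using polys_overD[OF pCons.prems(1), of 0] polys_overD[OF pCons.prems(1), of "Suc _"]
    by (auto intro: polys_overI)
  then show ?case
    using pCons.IH assms by (auto intro!: cong_mult poly_in_V)
qed (simp add: nonunit_0)

lemma divide_cases:
  obtains "x / y \<in> V" | "y / x \<in> \<mm>"
  using inverse_nonunit[of "x / y"] by (auto simp: inverse_eq_divide)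

text \<open>\<open>u i\<close> is an element of least value; values are never named as such,
  divisibility in \<open>V\<close> stands for their order.\<close>

lemma dominant_element:
  assumes "finite I" "I \<noteq> {}" "\<And>i. i \<in> I \<Longrightarrow> u i \<noteq> 0"
  obtains i where "i \<in> I" "\<And>j. j \<in> I \<Longrightarrow> u j / u i \<in> V"
proof -
  have "\<exists>i\<in>I. \<forall>j\<in>I. u j / u i \<in> V"
    using assms
  proof (induction I rule: finite_ne_induct)
    case (singleton x)
    then show ?case by (simp add: V_intros)
  next
    case (insert x I)
    then obtain i where i: "i \<in> I" "\<forall>j\<in>I. u j / u i \<in> V" by auto
    show ?case
    proof (cases "u x / u i \<in> V")
      case True
      then show ?thesis using i by auto
    next
      case False
      then have xi: "u i / u x \<in> V" using divide_cases[of "u x" "u i"] nonunit_in by blast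
      have "u j / u x \<in> V" if "j \<in> insert x I" for j
      proof (cases "j = x")
        case False
        then have "u j / u i * (u i / u x) \<in> V" using that i xi by (intro V_intros) auto
        then show ?thesis using insert.prems i by simp
      qed (use insert.prems in \<open>simp add: V_intros\<close>)
      then show ?thesis by blast
    qed
  qed
  then show ?thesis using that by blast
qed

text \<open>If x is outside \<open>V\<close>, then 1/x lies in \<mm> and is a root of the reversed
  polynomial, whose constant term is 1. Reducing modulo \<mm> gives 1 = 0.\<close>

lemma integral_in_V:
  assumes p: "p \<in> polys_over V" "lead_coeff p = 1" "poly p x = 0"
  shows "x \<in> V"
proof (rule ccontr)
  assume "x \<notin> V"
  then have y: "inverse x \<in> \<mm>" and x0: "x \<noteq> 0"
    using inverse_nonunit V_intros(1) by auto
  define n where "n = degree p"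
  have "poly (reflect_poly p) (inverse x) = 0"
    using p x0 by (simp add: poly_reflect_poly_nz)
  moreover have "poly (reflect_poly p) (inverse x) - poly (reflect_poly p) 0 \<in> \<mm>"
    using y p V_intros(1) by (intro cong_poly) (auto simp: nonunit_in polys_over_def coeff_reflect_poly)
  ultimately have "- 1 \<in> \<mm>" using p by (simp add: poly_reflect_poly_0)
  then show False using nonunit_minus[of "-1"] one_not_nonunit by simp
qed

lemma power_in_V_iff: "n > 0 \<Longrightarrow> x ^ n \<in> V \<longleftrightarrow> x \<in> V"
proof
  assume n: "n > 0" and x: "x ^ n \<in> V"
  show "x \<in> V"
  proof (rule integral_in_V)
    show "monom 1 n - [:x ^ n:] \<in> polys_over V"
      by (intro polys_over_ring polys_over_monom polys_over_const V V_intros x)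
    show "lead_coeff (monom 1 n - [:x ^ n:]) = 1" by (rule monic_power_minus_const(2)[OF n])
    show "poly (monom 1 n - [:x ^ n:]) x = 0" by (simp add: poly_monom)
  qed
qed (auto intro: V_intros)

lemma unit_power_iff: "n > 0 \<Longrightarrow> x ^ n \<in> V - \<mm> \<longleftrightarrow> x \<in> V - \<mm>"
  unfolding unit_iff by (auto simp: power_in_V_iff power_inverse[symmetric])

end

subsection \<open>Extension of valuation rings\<close>

text \<open>Chevalley's argument: a subring \<open>V\<close> maximal with \<open>V \<inter> K = A\<close> is a valuation ring.\<close>

lemma valuation_extension:
  fixes K A :: "'a::field set"
  assumes K: "is_subfield K" and A: "is_subring A" "A \<subseteq> K" and val: "\<And>x. x \<in> K \<Longrightarrow> x \<in> A \<or> inverse x \<in> A"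
  obtains V where "valuation_ring V" "V \<inter> K = A"
proof -
  define Q where "Q = {R. is_subring R \<and> R \<inter> K = A}"
  have "\<exists>R\<in>Q. \<forall>S\<in>Q. R \<subseteq> S \<longrightarrow> S = R"
  proof (rule subset_Zorn_nonempty)
    show "Q \<noteq> {}" using A by (auto simp: Q_def)
    fix C assume C: "C \<noteq> {}" "subset.chain Q C"
    have CQ: "\<And>R. R \<in> C \<Longrightarrow> is_subring R \<and> R \<inter> K = A" using C by (auto simp: subset.chain_def Q_def)
    have dir: "\<exists>R\<in>C. x \<in> R \<and> y \<in> R" if "x \<in> \<Union>C" "y \<in> \<Union>C" for x y
      using C(2) that unfolding subset_chain_def by blast
    have "is_subring (\<Union>C)"
      unfolding is_subring_iff
    proof (intro conjI ballI)
      show "1 \<in> \<Union>C" using C(1) CQ subring_1 by blast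
      fix x y assume "x \<in> \<Union>C" "y \<in> \<Union>C"
      then obtain R where "R \<in> C" "x \<in> R" "y \<in> R" using dir by blast
      then show "x - y \<in> \<Union>C" "x * y \<in> \<Union>C"
        using CQ[of R] subring_diff[of R x y] subring_mult[of R x y] by auto
    qed
    moreover have "\<Union>C \<inter> K = A" using C(1) CQ by auto
    ultimately show "\<Union>C \<in> Q" by (simp add: Q_def)
  qed
  then obtain R where R: "is_subring R" "R \<inter> K = A" and max: "\<And>S. is_subring S \<Longrightarrow> S \<inter> K = A \<Longrightarrow> R \<subseteq> S \<Longrightarrow> S = R"
    by (auto simp: Q_def)
  note Ri = subring_intros[OF R(1)]
  define M where "M = {m \<in> A. m \<noteq> 0 \<and> inverse m \<notin> A}"
  have AR: "A \<subseteq> R" using R by auto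
  \<comment> \<open>By maximality R[x] meets K in some k outside A. Then 1/k lies in M, and k = p(x)
    gives the relation.\<close>
  have ext: "\<exists>m\<in>M. \<exists>p\<in>polys_over R. m * poly p x = 1" if x: "x \<notin> R" for x
  proof -
    have "adjoin R x \<inter> K \<noteq> A"
      using max[OF is_subring_adjoin[OF R(1)] _ adjoin_contains[OF R(1)], of x] adjoin_generator[OF R(1), of x] x by auto
    then obtain k where k: "k \<in> adjoin R x" "k \<in> K" "k \<notin> A"
      using adjoin_contains[OF R(1), of x] AR A(2) by blast
    then obtain p where p: "p \<in> polys_over R" "k = poly p x" by (auto elim: adjoinE)
    have "k \<noteq> 0" using k subring_0[OF A(1)] by auto
    moreover have "inverse k \<in> M" using k val[of k] \<open>k \<noteq> 0\<close> by (auto simp: M_def)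
    ultimately show ?thesis using p by (intro bexI[of _ "inverse k"] bexI[of _ p]) auto
  qed
  have M_no: "m * r \<noteq> 1" if "m \<in> M" "r \<in> R" for m r
  proof
    assume "m * r = 1"
    then have r: "r = inverse m" using that by (simp add: inverse_unique)
    then have "r \<in> K" using that A by (auto simp: M_def intro: subfield_inverse K)
    then have "r \<in> A" using R that by auto
    then show False using r that by (simp add: M_def)
  qed
  \<comment> \<open>A compares its elements by divisibility, so a relation with two coefficients in
    M has a common factor in M. This replaces computing in the ideal generated by M.\<close>
  have comparable: "\<exists>m\<in>M. \<exists>e1\<in>R. \<exists>e2\<in>R. m1 = m * e1 \<and> m2 = m * e2" if m: "m1 \<in> M" "m2 \<in> M" for m1 m2
  proof -
    have "m1 / m2 \<in> K" using m A by (auto simp: M_def intro: subfield_divide K)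
    then have "m1 / m2 \<in> A \<or> m2 / m1 \<in> A" using val by (metis inverse_divide)
    then show ?thesis
    proof
      assume "m1 / m2 \<in> A"
      then show ?thesis using m AR Ri
        by (intro bexI[of _ m2] bexI[of _ "m1 / m2"] bexI[of _ 1]) (auto simp: M_def)
    next
      assume "m2 / m1 \<in> A"
      then show ?thesis using m AR Ri
        by (intro bexI[of _ m1] bexI[of _ "m2 / m1"] bexI[of _ 1]) (auto simp: M_def)
    qed
  qed
  \<comment> \<open>If the inverse of u = 1 - m b were missing from R, then \<open>ext\<close> would
    give m' p(1/u) = 1. Clearing denominators and using that powers of u are 1 modulo m turns this
    into a relation m' a + m b' = 1, which \<open>M_no\<close> excludes.\<close>
  have unit: "inverse (1 - m * b) \<in> R \<and> 1 - m * b \<noteq> 0" if m: "m \<in> M" "b \<in> R" for m b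
  proof
    define u where "u = 1 - m * b"
    show u0: "1 - m * b \<noteq> 0" using M_no[OF m] by auto
    have uR: "u \<in> R" unfolding u_def using m AR by (intro Ri) (auto simp: M_def)
    show "inverse (1 - m * b) \<in> R"
    proof (rule ccontr)
      assume "inverse (1 - m * b) \<notin> R"
      then obtain m' p where p: "m' \<in> M" "p \<in> polys_over R" "m' * poly p (inverse u) = 1"
        using ext unfolding u_def by blast
      have "u ^ degree p * poly p (inverse u) \<in> R"
      proof -
        have "u ^ degree p * poly p (inverse u) = (\<Sum>i\<le>degree p. coeff p i * u ^ (degree p - i))"
          using u0 unfolding poly_altdef sum_distrib_left
          by (intro sum.cong refl) (auto simp: u_def power_diff power_inverse field_simps)
        then show ?thesis using p(2) uR by (auto intro!: Ri polys_overD)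
      qed
      moreover have "\<exists>b'\<in>R. u ^ n = 1 - m * b'" for n
      proof (induction n)
        case 0
        show ?case using Ri(1) by (intro bexI[of _ 0]) auto
      next
        case (Suc n)
        then obtain b' where b': "b' \<in> R" "u ^ n = 1 - m * b'" by auto
        have "u ^ Suc n = u - m * (b' * u)" unfolding power_Suc b'(2) by (simp add: algebra_simps)
        also have "\<dots> = 1 - m * (b + b' * u)" by (simp add: u_def algebra_simps)
        finally show ?case using uR m b' by (intro bexI[of _ "b + b' * u"] Ri) auto
      qed
      then obtain b' where b': "b' \<in> R" "u ^ degree p = 1 - m * b'" by blast
      define a where "a = u ^ degree p * poly p (inverse u)"
      have "m' * a = u ^ degree p" using p(3) by (simp add: a_def mult.left_commute)
      then have "m' * a + m * b' = 1" using b' by simp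
      moreover obtain m0 e1 e2 where "m0 \<in> M" "e1 \<in> R" "e2 \<in> R" "m' = m0 * e1" "m = m0 * e2"
        using comparable[OF p(1) m(1)] by blast
      ultimately have "m0 * (e1 * a + e2 * b') = 1" by (simp add: algebra_simps)
      moreover have "e1 * a + e2 * b' \<in> R"
        using calculation \<open>e1 \<in> R\<close> \<open>e2 \<in> R\<close> b' \<open>u ^ degree p * poly p (inverse u) \<in> R\<close>
        by (intro Ri) (auto simp: a_def)
      ultimately show False using M_no \<open>m0 \<in> M\<close> by blast
    qed
  qed
  define P where "P x n \<longleftrightarrow> (\<exists>m\<in>M. \<exists>p\<in>polys_over R. degree p \<le> n \<and> m * poly p x = 1)" for x n
  have P0: "\<not> P x 0" for x
  proof
    assume "P x 0"
    then obtain m p where "m \<in> M" "p \<in> polys_over R" "degree p = 0" "m * poly p x = 1" by (auto simp: P_def)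
    then show False using M_no polys_overD[of p R 0] by (auto elim!: degree_eq_zeroE)
  qed
  \<comment> \<open>The relation for 1/x, multiplied by x^n and by the inverse w of the unit 1 - m
    q(0), expresses x^n through lower powers of x. Inserting this into the shortest relation for x
    shortens it.\<close>
  have descend: False if x: "x \<noteq> 0" and n: "P x n" "\<And>k. P x k \<Longrightarrow> n \<le> k" and l: "P (inverse x) l" and ln: "l \<le> n" for x n l
  proof -
    obtain m1 p1 where p1: "m1 \<in> M" "p1 \<in> polys_over R" "degree p1 \<le> n" "m1 * poly p1 x = 1"
      using n(1) by (auto simp: P_def)
    obtain m2 q1 where q1: "m2 \<in> M" "q1 \<in> polys_over R" "degree q1 \<le> l" "m2 * poly q1 (inverse x) = 1"
      using l by (auto simp: P_def)
    obtain m e1 e2 where m: "m \<in> M" "e1 \<in> R" "e2 \<in> R" "m1 = m * e1" "m2 = m * e2"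
      using comparable[OF p1(1) q1(1)] by blast
    define p where "p = smult e1 p1"
    define q where "q = smult e2 q1"
    have p: "p \<in> polys_over R" "degree p \<le> n" "m * poly p x = 1"
      using p1 m by (auto simp: p_def mult.assoc intro: polys_over_smult R)
    have q: "q \<in> polys_over R" "degree q \<le> n" "m * poly q (inverse x) = 1"
      using q1 m ln by (auto simp: q_def mult.assoc intro: polys_over_smult R)
    have n0: "n > 0" using P0 n(1) by (metis gr0I)
    have mR: "m \<in> R" using m AR by (auto simp: M_def)
    define w where "w = inverse (1 - m * coeff q 0)"
    have w: "w \<in> R" "1 - m * coeff q 0 \<noteq> 0" using unit[OF m(1), of "coeff q 0"] q by (auto simp: w_def polys_overD)
    define s where "s = (\<Sum>j\<in>{1..n}. monom (coeff q j) (n - j))"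
    have sR: "s \<in> polys_over R" unfolding s_def
      by (intro polys_over_ring polys_over_monom R polys_overD q)
    have sx: "poly s x = x ^ n * (poly q (inverse x) - coeff q 0)"
    proof -
      have "poly q (inverse x) = (\<Sum>j<Suc n. coeff q j * inverse x ^ j)"
        using q(2) by (intro poly_eq_sum_less) auto
      also have "\<dots> = coeff q 0 + (\<Sum>j\<in>{1..n}. coeff q j * inverse x ^ j)"
        unfolding lessThan_Suc_atMost atMost_atLeast0 by (subst sum.atLeast_Suc_atMost) auto
      finally have "x ^ n * (poly q (inverse x) - coeff q 0) = (\<Sum>j\<in>{1..n}. x ^ n * (coeff q j * inverse x ^ j))"
        by (simp add: sum_distrib_left)
      also have "\<dots> = poly s x"
        unfolding s_def poly_sum poly_monom using x
        by (intro sum.cong refl) (auto simp: power_diff power_inverse field_simps)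
      finally show ?thesis by simp
    qed
    have "m * (poly q (inverse x) - coeff q 0) = 1 - m * coeff q 0" using q(3) by (simp add: algebra_simps)
    then have xn: "x ^ n = m * w * poly s x" using w(2) by (simp add: sx w_def field_simps)
    define t where "t = p - monom (coeff p n) n + smult (coeff p n * m * w) s"
    have "poly t x = poly p x"
      by (simp add: t_def poly_monom) (simp add: xn mult_ac)
    moreover have "t \<in> polys_over R"
      unfolding t_def using p sR w mR
      by (intro polys_over_ring polys_over_smult polys_over_monom R Ri polys_overD) auto
    moreover have "degree t \<le> n - 1"
    proof -
      have "degree s \<le> n - 1"
        unfolding s_def using n0
        by (intro degree_sum_le) (auto intro!: order_trans[OF degree_monom_le])
      moreover have "degree (p - monom (coeff p n) n) \<le> n - 1"
      proof (rule degree_le, intro allI impI)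
        fix i assume "n - 1 < i"
        then show "coeff (p - monom (coeff p n) n) i = 0" using p(2) n0 by (cases "i = n") (auto simp: coeff_eq_0)
      qed
      ultimately show ?thesis
        unfolding t_def by (intro degree_add_le) (auto intro: order_trans[OF degree_smult_le])
    qed
    ultimately have "P x (n - 1)"
      unfolding P_def using p(3) m(1) by (intro bexI[of _ m] bexI[of _ t]) auto
    then show False using n(2) n0 by fastforce
  qed
  have "x \<in> R \<or> inverse x \<in> R" for x
  proof (rule ccontr)
    assume "\<not> (x \<in> R \<or> inverse x \<in> R)"
    then have nR: "x \<notin> R" "inverse x \<notin> R" by auto
    then have x0: "x \<noteq> 0" using Ri(1) by auto
    have "\<exists>n. P y n" if "y \<notin> R" for y using ext[OF that] unfolding P_def by blast
    then have "\<exists>n. P x n" "\<exists>n. P (inverse x) n" using nR by auto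
    then have least: "P x (LEAST n. P x n)" "P (inverse x) (LEAST n. P (inverse x) n)"
      by (auto intro: LeastI)
    show False
    proof (cases "(LEAST n. P (inverse x) n) \<le> (LEAST n. P x n)")
      case True
      then show False using descend[OF x0 least(1) Least_le least(2)] by simp
    next
      case False
      then show False using descend[of "inverse x", OF _ least(2) Least_le, of "LEAST n. P x n"] x0 least(1) by simp
    qed
  qed
  then have "valuation_ring R" using R by (simp add: valuation_ring_def)
  then show ?thesis using R that by blast
qed

section \<open>Henselian valuations\<close>

text \<open>\<open>V\<close> is an arbitrary extension of a Henselian valuation ring of K to the
  algebraic closure. That it is the only one, being the integral closure of \<open>V\<close>
  \<inter> K, is a consequence drawn below.\<close>

locale henselian_closure = valued_field V
  for V :: "'a::alg_closed_field set" +
  fixes K :: "'a set"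
  assumes K: "is_subfield K" and alg: "\<And>x. alg_over K x" and infinite_K: "infinite K"
    and hensel: "\<And>f a\<^sub>0. f \<in> polys_over (V \<inter> K) \<Longrightarrow> lead_coeff f = 1 \<Longrightarrow> a\<^sub>0 \<in> V \<inter> K \<Longrightarrow> poly f a\<^sub>0 \<in> \<mm> \<Longrightarrow>
      poly (pderiv f) a\<^sub>0 \<notin> \<mm> \<Longrightarrow> \<exists>a\<in>V \<inter> K. poly f a = 0 \<and> a - a\<^sub>0 \<in> \<mm>"
begin

text \<open>Let \<open>P\<close> be the set of conjugates of \<open>x\<close> outside \<open>V\<close> and \<open>z\<close> their product. Every other
  conjugate of \<open>z\<close> has strictly larger value, so after division by the trace the characteristic
  polynomial of \<open>z\<close> reduces to \<open>T\<^sup>N - T\<^sup>N\<^sup>-\<^sup>1\<close>. Its simple root \<open>1\<close> lifts, which puts \<open>z\<close> in \<open>K\<close> and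
  makes \<open>P\<close> stable under the Galois group.\<close>

lemma sep_conj_not_in_V:
  assumes s: "sep_over K x" and c: "conj_over K x y" and x: "x \<notin> V"
  shows "y \<notin> V"
proof -
  note R = subfield_subring[OF K]
  obtain m where m: "minimal_poly K x m" using minimal_poly_exists[OF K alg] .
  define Y where "Y = {y. poly m y = 0}"
  have finY: "finite Y" unfolding Y_def by (intro poly_roots_finite minimal_polyD(3)[OF m])
  have Y: "y \<in> Y \<longleftrightarrow> conj_over K x y" for y by (simp add: Y_def conj_over_iff_root[OF K m])
  have Ysep: "sep_over K y" if "y \<in> Y" for y using sep_over_conj[OF K s] Y that by blast
  have "is_subfield (UNIV :: 'a set)" by (auto simp: is_subfield_def is_subring_iff)
  then obtain c where c': "\<forall>y\<in>Y. c y \<in> K" "Y \<subseteq> adjoin K (\<Sum>y\<in>Y. c y * y)"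
    using primitive_element[OF K infinite_K, of UNIV Y] alg finY Ysep by auto
  define \<theta> where "\<theta> = (\<Sum>y\<in>Y. c y * y)"
  define E where "E = adjoin K \<theta>"
  have YE: "Y \<subseteq> E" using c' by (simp add: E_def \<theta>_def)
  have sep\<theta>: "sep_over K \<theta>"
    by (rule sep_over_generator[OF K alg, of Y c]) (use c' Ysep \<theta>_def in auto)
  \<comment> \<open>Each y in Y is a polynomial in \<theta>, so a conjugate of \<theta> is the same
    linear combination of elements conjugate to those of Y, and these lie in Y again.\<close>
  have normal: "\<eta> \<in> E" if \<eta>: "conj_over K \<theta> \<eta>" for \<eta>
  proof -
    have "\<exists>h. \<forall>y\<in>Y. h y \<in> polys_over K \<and> y = poly (h y) \<theta>"
      using YE adjoinE unfolding E_def by (metis subsetD)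
    then obtain h where h: "\<And>y. y \<in> Y \<Longrightarrow> h y \<in> polys_over K" "\<And>y. y \<in> Y \<Longrightarrow> poly (h y) \<theta> = y" by metis
    define q where "q = [:0, 1:] - (\<Sum>y\<in>Y. smult (c y) (h y))"
    have "q \<in> polys_over K"
      unfolding q_def using c' h
      by (intro polys_over_ring polys_over_smult polys_over_pCons subring_0 subring_1 R) auto
    moreover have "poly q \<theta> = 0" using h by (simp add: q_def poly_sum \<theta>_def)
    ultimately have "poly q \<eta> = 0" using \<eta> by (auto simp: conj_over_def)
    then have "\<eta> = (\<Sum>y\<in>Y. c y * poly (h y) \<eta>)" by (simp add: q_def poly_sum)
    moreover have "poly (h y) \<eta> \<in> Y" if "y \<in> Y" for y
      using conj_over_poly[OF K \<eta> h(1)[OF that]] h(2)[OF that] that Y conj_over_trans by metis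
    then have "c y * poly (h y) \<eta> \<in> E" if "y \<in> Y" for y
      using that c' YE adjoin_contains[OF R, of \<theta>]
      by (intro subring_mult is_subring_adjoin R) (auto simp: E_def intro: is_subring_adjoin R)
    then have "(\<Sum>y\<in>Y. c y * poly (h y) \<eta>) \<in> E"
      unfolding E_def by (intro subring_sum is_subring_adjoin R)
    ultimately show ?thesis by (simp only:)
  qed
  interpret G: simple_galois K E \<theta>
    by unfold_locales (use K E_def sep\<theta> normal in auto)
  let ?G = "gal K E"
  define P where "P = Y - V"
  define z where "z = \<Prod>P"
  have finP: "finite P" using finY by (simp add: P_def)
  have PE: "P \<subseteq> E" using YE by (auto simp: P_def)
  have P0: "0 \<notin> P" using V_intros(1) by (auto simp: P_def)
  have z0: "z \<noteq> 0" using P0 finP by (simp add: z_def)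
  have zE: "z \<in> E" unfolding z_def using PE by (intro subring_prod G.E_ring) auto
  \<comment> \<open>Passing from P to Q exchanges at least one element outside \<open>V\<close> for
    an element of \<open>V\<close>, which strictly raises the value of the product.\<close>
  have ratio: "\<Prod>Q / z \<in> \<mm>" if Q: "Q \<subseteq> Y" "card Q = card P" "Q \<noteq> P" for Q
  proof -
    have finQ: "finite Q" using Q finY finite_subset by blast
    obtain p where p: "p \<in> P - Q"
      using Q finP finQ card_subset_eq[of Q P] by (metis Diff_eq_empty_iff all_not_in_conv)
    have "\<Prod>Q = \<Prod>(Q \<inter> P) * \<Prod>(Q - P)" "z = \<Prod>(Q \<inter> P) * \<Prod>(P - Q)"
      unfolding z_def using prod.Int_Diff[OF finQ, of "\<lambda>x. x" P] prod.Int_Diff[OF finP, of "\<lambda>x. x" Q]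
      by (simp_all add: Int_commute)
    moreover have "\<Prod>(Q \<inter> P) \<noteq> 0" using finQ P0 by auto
    ultimately have "\<Prod>Q / z = \<Prod>(Q - P) / \<Prod>(P - Q)" by simp
    then have "\<Prod>Q / z = \<Prod>(Q - P) * (\<Prod>p\<in>P - Q. inverse p)"
      using prod_inversef[of "\<lambda>x. x" "P - Q"] by (simp add: divide_inverse comp_def)
    also have "(\<Prod>p\<in>P - Q. inverse p) = inverse p * (\<Prod>p\<in>P - Q - {p}. inverse p)"
      using finP p by (intro prod.remove) auto
    also have "\<Prod>(Q - P) * \<dots> \<in> \<mm>"
      using Q p inverse_nonunit
      by (intro nonunit_mult(2) nonunit_mult(1) V_intros(9)) (auto simp: P_def intro: nonunit_in)
    finally show ?thesis .
  qed
  have perm: "bij_betw \<sigma> Y Y" if \<sigma>: "\<sigma> \<in> ?G" for \<sigma>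
  proof -
    have "\<sigma> ` Y \<subseteq> Y" using G.gal_conj[OF \<sigma>] YE Y conj_over_trans by blast
    moreover have "inj_on \<sigma> Y" using G.gal_inj[OF \<sigma>] inj_on_subset by blast
    ultimately show ?thesis using endo_inj_surj[OF finY] by (simp add: bij_betw_def)
  qed
  have \<sigma>z: "\<sigma> z = \<Prod>(\<sigma> ` P)" if \<sigma>: "\<sigma> \<in> ?G" for \<sigma>
  proof -
    have "\<sigma> z = (\<Prod>p\<in>P. \<sigma> p)"
      unfolding z_def using PE by (intro hom_on_prod[OF G.E_ring G.gal_hom[OF \<sigma>]]) auto
    also have "\<dots> = \<Prod>(\<sigma> ` P)"
      using G.gal_inj[OF \<sigma>] by (subst prod.reindex) (auto intro: inj_on_subset)
    finally show ?thesis .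
  qed
  have \<sigma>P: "\<sigma> ` P = P \<or> \<sigma> z / z \<in> \<mm>" if \<sigma>: "\<sigma> \<in> ?G" for \<sigma>
  proof -
    have "\<sigma> ` P \<subseteq> Y" using perm[OF \<sigma>] by (auto simp: bij_betw_def P_def)
    moreover have "card (\<sigma> ` P) = card P"
      using G.gal_inj[OF \<sigma>] by (intro card_image) (auto intro: inj_on_subset)
    ultimately show ?thesis using ratio \<sigma>z[OF \<sigma>] by metis
  qed
  define W where "W = (\<lambda>\<sigma>. \<sigma> z) ` ?G"
  have finW: "finite W" unfolding W_def using G.finite_gal by simp
  have WE: "W \<subseteq> E" unfolding W_def using G.gal_closed zE by auto
  have zW: "z \<in> W" unfolding W_def using G.gal_id by (intro image_eqI[where x = id]) auto
  have Wz: "w / z \<in> \<mm>" if w: "w \<in> W - {z}" for w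
    using w \<sigma>P \<sigma>z unfolding W_def z_def by force
  have permW: "bij_betw \<sigma> W W" if \<sigma>: "\<sigma> \<in> ?G" for \<sigma>
  proof -
    have "\<sigma> ` W \<subseteq> W"
    proof
      fix w assume "w \<in> \<sigma> ` W"
      then obtain \<tau> where "\<tau> \<in> ?G" "w = (\<sigma> \<circ> \<tau>) z" by (auto simp: W_def)
      then show "w \<in> W" unfolding W_def using G.gal_comp[OF \<sigma>] by blast
    qed
    moreover have "inj_on \<sigma> W" using G.gal_inj[OF \<sigma>] inj_on_subset by blast
    ultimately show ?thesis using endo_inj_surj[OF finW] by (simp add: bij_betw_def)
  qed
  define t where "t = \<Sum>W"
  have tz: "t / z - 1 \<in> \<mm>"
  proof -
    have "t = z + \<Sum>(W - {z})" unfolding t_def using finW zW by (simp add: sum.remove)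
    then have "t / z - 1 = (\<Sum>w\<in>W - {z}. w / z)" using z0 by (simp add: add_divide_distrib sum_divide_distrib)
    then show ?thesis using Wz by (auto intro: nonunit_sum)
  qed
  have tzu: "t / z \<in> V - \<mm>" by (rule unit_cong[OF one_unit tz])
  then have t0: "t \<noteq> 0" using nonunit_0 by auto
  have ztu: "z / t \<in> V - \<mm>" using unit_inverse[OF tzu] by simp
  have tE: "t \<in> E" unfolding t_def using WE by (intro subring_sum G.E_ring) auto
  have tK: "t \<in> K"
  proof (rule G.gal_fixed[OF tE])
    fix \<sigma> assume \<sigma>: "\<sigma> \<in> ?G"
    have "\<sigma> t = (\<Sum>w\<in>W. \<sigma> w)"
      unfolding t_def using WE by (intro hom_on_sum[OF G.E_ring G.gal_hom[OF \<sigma>]]) auto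
    also have "\<dots> = t" unfolding t_def by (rule sum.reindex_bij_betw[OF permW[OF \<sigma>]])
    finally show "\<sigma> t = t" .
  qed
  define W' where "W' = (\<lambda>w. w / t) ` W"
  have finW': "finite W'" unfolding W'_def using finW by simp
  have itE: "inverse t \<in> E" using subfield_inverse[OF G.E tE] .
  have W'E: "W' \<subseteq> E" unfolding W'_def divide_inverse using WE itE by (auto intro: subring_mult G.E_ring)
  have permW': "bij_betw \<sigma> W' W'" if \<sigma>: "\<sigma> \<in> ?G" for \<sigma>
  proof -
    have "\<sigma> (w / t) = \<sigma> w / t" if "w \<in> W" for w
      using that WE itE hom_on_mult[OF G.E_ring G.gal_hom[OF \<sigma>], of w "inverse t"]
        G.gal_fix[OF \<sigma> subfield_inverse[OF K tK]] by (auto simp: divide_inverse)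
    then have "\<sigma> ` W' \<subseteq> W'" unfolding W'_def using permW[OF \<sigma>] by (auto simp: bij_betw_def)
    moreover have "inj_on \<sigma> W'" using G.gal_inj[OF \<sigma>] inj_on_subset by blast
    ultimately show ?thesis using endo_inj_surj[OF finW'] by (simp add: bij_betw_def)
  qed
  have root_product: "(\<Prod>w\<in>S. [:- w, 1:]) \<in> polys_over K"
    if S: "finite S" "S \<subseteq> E" "\<And>\<sigma>. \<sigma> \<in> ?G \<Longrightarrow> bij_betw \<sigma> S S" for S
  proof (rule polys_overI, rule G.gal_fixed)
    fix i
    show "coeff (\<Prod>w\<in>S. [:- w, 1:]) i \<in> E"
      using S by (intro polys_overD polys_over_ring polys_over_linear G.E_ring) auto
    show "\<sigma> (coeff (\<Prod>w\<in>S. [:- w, 1:]) i) = coeff (\<Prod>w\<in>S. [:- w, 1:]) i" if "\<sigma> \<in> ?G" for \<sigma>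
      using that S by (intro hom_fixes_root_product[OF G.E_ring G.gal_hom]) auto
  qed
  define u where "u = z / t"
  have uW: "u \<in> W'" using zW by (auto simp: u_def W'_def)
  have u1: "1 - u \<in> \<mm>"
  proof -
    have "1 - u = (t / z - 1) * (z / t)" using t0 z0 by (simp add: u_def field_simps)
    then show ?thesis using nonunit_mult(1)[OF tz, of "z / t"] ztu by simp
  qed
  have others: "w \<in> \<mm>" if w: "w \<in> W' - {u}" for w
  proof -
    obtain w' where "w' \<in> W - {z}" "w = w' / t" using w by (auto simp: W'_def u_def)
    moreover from this have "w = (w' / z) * (z / t)" using z0 by simp
    ultimately show ?thesis using nonunit_mult(1)[OF Wz, of w' "z / t"] ztu by auto
  qed
  have uV: "u \<in> V" using ztu by (simp add: u_def)
  have W'V: "W' \<subseteq> V" using others nonunit_in uV by blast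
  define \<Phi> where "\<Phi> = (\<Prod>w\<in>W'. [:- w, 1:])"
  define \<Psi> where "\<Psi> = (\<Prod>w\<in>W' - {u}. [:- w, 1:])"
  have \<Phi>\<Psi>: "\<Phi> = [:- u, 1:] * \<Psi>" unfolding \<Phi>_def \<Psi>_def using finW' uW by (rule prod.remove)
  have \<Psi>V: "\<Psi> \<in> polys_over V" unfolding \<Psi>_def using W'V by (intro polys_over_ring polys_over_linear V) auto
  have "\<exists>a\<in>V \<inter> K. poly \<Phi> a = 0 \<and> a - 1 \<in> \<mm>"
  proof (rule hensel)
    have "\<Phi> \<in> polys_over K" unfolding \<Phi>_def using root_product finW' W'E permW' by blast
    moreover have "\<Phi> \<in> polys_over V" unfolding \<Phi>_def using W'V by (intro polys_over_ring polys_over_linear V) auto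
    ultimately show "\<Phi> \<in> polys_over (V \<inter> K)" by (simp add: polys_over_Int)
    show "lead_coeff \<Phi> = 1" by (simp add: \<Phi>_def lead_coeff_prod)
    show "1 \<in> V \<inter> K" using V_intros(2) subring_1[OF R] by simp
    have "poly \<Phi> 1 = (1 - u) * poly \<Psi> 1" by (simp only: \<Phi>\<Psi> poly_mult) simp
    then show "poly \<Phi> 1 \<in> \<mm>"
      using nonunit_mult(1)[OF u1 poly_in_V[OF \<Psi>V V_intros(2)]] by simp
    have "poly \<Psi> 1 = (\<Prod>w\<in>W' - {u}. 1 - w)" by (simp add: \<Psi>_def poly_prod)
    also have "\<dots> \<in> V - \<mm>"
    proof (rule unit_prod)
      fix w assume "w \<in> W' - {u}"
      then show "1 - w \<in> V - \<mm>" using unit_cong[OF one_unit, of "1 - w"] nonunit_minus[OF others] by simp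
    qed
    finally have "poly \<Psi> 1 + (1 - u) * poly (pderiv \<Psi>) 1 \<in> V - \<mm>"
      using u1 poly_in_V[OF polys_over_pderiv[OF V \<Psi>V] V_intros(2)]
      by (intro unit_add_nonunit nonunit_mult) auto
    moreover have "poly (pderiv \<Phi>) 1 = poly \<Psi> 1 + (1 - u) * poly (pderiv \<Psi>) 1"
      unfolding \<Phi>\<Psi> pderiv_mult by (simp add: pderiv_pCons algebra_simps)
    ultimately show "poly (pderiv \<Phi>) 1 \<notin> \<mm>" by simp
  qed
  then obtain a where a: "a \<in> K" "a \<in> V" "poly \<Phi> a = 0" "a - 1 \<in> \<mm>" by auto
  have "a \<in> W'" using a(3) finW' by (auto simp: \<Phi>_def poly_prod)
  moreover have "a \<notin> \<mm>" using unit_cong[OF one_unit a(4)] by simp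
  ultimately have "a = u" using others by auto
  then have "z = a * t" using t0 by (simp add: u_def)
  then have zK: "z \<in> K" using a tK by (auto intro: subring_mult R)
  have stable: "\<sigma> ` P = P" if "\<sigma> \<in> ?G" for \<sigma>
    using \<sigma>P[OF that] G.gal_fix[OF that zK] z0 one_not_nonunit by auto
  \<comment> \<open>The polynomial with root set P is now defined over K and vanishes at x, hence at
    y, which forces y into P.\<close>
  have "(\<Prod>w\<in>P. [:- w, 1:]) \<in> polys_over K"
  proof (rule root_product[OF finP PE])
    fix \<sigma> assume \<sigma>: "\<sigma> \<in> ?G"
    show "bij_betw \<sigma> P P"
      using stable[OF \<sigma>] inj_on_subset[OF G.gal_inj[OF \<sigma>]] by (simp add: bij_betw_def)
  qed
  moreover have "poly (\<Prod>w\<in>P. [:- w, 1:]) x = 0"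
    using finP x Y conj_over_refl by (auto simp: poly_prod P_def)
  ultimately have "poly (\<Prod>w\<in>P. [:- w, 1:]) y = 0" using c by (auto simp: conj_over_def)
  then have "y \<in> P" using finP by (auto simp: poly_prod)
  then show ?thesis by (simp add: P_def)
qed

text \<open>An inseparable minimal polynomial is a polynomial in \<open>X\<^sup>p\<close>.\<close>

lemma sep_over_power:
  shows "\<exists>q>0. sep_over K (x ^ q)"
proof -
  have "minimal_poly K x m \<Longrightarrow> \<exists>q>0. sep_over K (x ^ q)" for m x
  proof (induction "degree m" arbitrary: m x rule: less_induct)
    case less
    note m = less.prems
    show ?case
    proof (cases "sep_over K x")
      case True
      then show ?thesis by (intro exI[of _ 1]) auto
    next
      case False
      define p where "p = CHAR('a)"
      note R = subfield_subring[OF K]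
      have "poly (pderiv m) x = 0" using False minimal_polyD(1,4)[OF m] by (auto simp: sep_over_def)
      then have D: "pderiv m = 0"
        using minimal_polyD(5)[OF m polys_over_pderiv[OF R minimal_polyD(1)[OF m]]]
          degree_pderiv_less[OF minimal_poly_degree_pos[OF m]] by blast
      have coeff: "p dvd i" if "coeff m i \<noteq> 0" for i
      proof (cases i)
        case (Suc j)
        have "of_nat (Suc j) * coeff m (Suc j) = 0" using arg_cong[OF D, of "\<lambda>q. coeff q j"] by (simp add: coeff_pderiv)
        then show ?thesis using that Suc by (simp only: p_def of_nat_eq_0_iff_char_dvd mult_eq_0_iff) auto
      qed simp
      have n: "p dvd degree m" using coeff[of "degree m"] minimal_polyD(2)[OF m] by simp
      \<comment> \<open>In characteristic zero p is 0, and 0 divides no positive degree; so this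
        line also settles that case.\<close>
      then have p0: "p > 0" using minimal_poly_degree_pos[OF m] by (intro Nat.gr0I) auto
      have p1: "p > 1" using p0 CHAR_not_1[where 'a='a] unfolding p_def by linarith
      define k where "k = degree m div p"
      have kp: "degree m = p * k" using n by (simp add: k_def)
      define g where "g = (\<Sum>i\<le>k. monom (coeff m (p * i)) i)"
      have gK: "g \<in> polys_over K"
        unfolding g_def by (intro polys_over_ring polys_over_monom R polys_overD minimal_polyD(1)[OF m])
      have "poly m x = (\<Sum>j\<le>p * k. coeff m j * x ^ j)" by (simp add: poly_altdef kp)
      also have "\<dots> = (\<Sum>j\<in>(\<lambda>i. p * i) ` {..k}. coeff m j * x ^ j)"
      proof (intro sum.mono_neutral_right ballI)
        fix j assume j: "j \<in> {..p * k} - (\<lambda>i. p * i) ` {..k}"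
        have "\<not> p dvd j"
        proof
          assume "p dvd j"
          then obtain i where "j = p * i" by (elim dvdE)
          with j p0 show False by auto
        qed
        then show "coeff m j * x ^ j = 0" using coeff by auto
      qed auto
      also have "\<dots> = (\<Sum>i\<le>k. coeff m (p * i) * x ^ (p * i))"
        using p0 by (subst sum.reindex) (auto simp: inj_on_def)
      finally have "poly g (x ^ p) = poly m x" by (simp add: g_def poly_sum poly_monom power_mult)
      then have gx: "poly g (x ^ p) = 0" using minimal_polyD(4)[OF m] by simp
      have "coeff g k = 1" using minimal_polyD(2)[OF m] by (simp add: g_def coeff_sum kp)
      then have g0: "g \<noteq> 0" by auto
      have gk: "degree g \<le> k" unfolding g_def by (intro degree_sum_le) (auto intro: order_trans[OF degree_monom_le])
      obtain m' where m': "minimal_poly K (x ^ p) m'" using minimal_poly_exists[OF K alg] .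
      then have "degree m' \<le> k" using gK gx g0 gk by (auto simp: minimal_poly_def)
      also have "k < degree m" using kp p1 minimal_poly_degree_pos[OF m] by simp
      finally obtain q where "q > 0" "sep_over K ((x ^ p) ^ q)" using less.hyps m' by blast
      then show ?thesis using p0 by (intro exI[of _ "p * q"]) (auto simp: power_mult)
    qed
  qed
  then show ?thesis using minimal_poly_exists[OF K alg] by metis
qed

text \<open>A power x^q is separable, and membership in \<open>V\<close> is unaffected by taking
  roots of order q. The separable case speaks of elements outside \<open>V\<close>, so it is applied
  to the conjugates in reverse order.\<close>

lemma conj_in_V_base:
  assumes c: "conj_over K x y" and x: "x \<in> V"
  shows "y \<in> V"
proof -
  obtain q where q: "q > 0" "sep_over K (x ^ q)" using sep_over_power by blast
  have "conj_over K (x ^ q) (y ^ q)" by (rule conj_over_power[OF K c])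
  then have "sep_over K (y ^ q)" "conj_over K (y ^ q) (x ^ q)"
    using sep_over_conj[OF K q(2)] conj_over_sym[OF K alg] by auto
  then have "y ^ q \<in> V" using sep_conj_not_in_V x power_in_V_iff[OF q(1)] by blast
  then show ?thesis using power_in_V_iff[OF q(1)] by blast
qed

lemma conj_in_V: "K \<subseteq> F \<Longrightarrow> conj_over F x y \<Longrightarrow> x \<in> V \<Longrightarrow> y \<in> V"
  using conj_in_V_base conj_over_mono by blast

lemma minimal_poly_in_V:
  assumes F: "is_subfield F" "K \<subseteq> F" and m: "minimal_poly F v m" and v: "v \<in> V"
  shows "m \<in> polys_over (V \<inter> F)"
proof -
  obtain A where A: "m = (\<Prod>a\<in>#A. [:- a, 1:])" "\<And>a. a \<in># A \<Longrightarrow> conj_over F v a"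
    using minimal_poly_splits[OF F(1) m] by metis
  have "a \<in> V" if "a \<in># A" for a using conj_in_V[OF F(2) A(2)[OF that] v] .
  then have "m \<in> polys_over V"
    unfolding A(1) by (intro polys_over_prod_mset polys_over_linear V)
  then show ?thesis using minimal_polyD(1)[OF m] by (simp add: polys_over_Int)
qed

text \<open>Together with \<open>integral_in_V\<close> this identifies \<open>V\<close> with the
  integral closure of \<open>V\<close> \<inter> K in the whole field.\<close>

lemma V_integral:
  assumes "x \<in> V"
  obtains p where "p \<in> polys_over (V \<inter> K)" "lead_coeff p = 1" "poly p x = 0"
proof -
  obtain m where m: "minimal_poly K x m" using minimal_poly_exists[OF K alg] .
  show ?thesis
    by (rule that[OF minimal_poly_in_V[OF K subset_refl m assms] minimal_polyD(2)[OF m] minimal_polyD(4)[OF m]])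
qed

end

section \<open>Elements with value in the value group of a subfield, and criteria for monogenic
  unions\<close>

definition (in valued_field) val_in :: "'a set \<Rightarrow> 'a \<Rightarrow> bool"
  where "val_in F x \<longleftrightarrow> (\<exists>c\<in>F. c \<noteq> 0 \<and> x / c \<in> V - \<mm>)"

context valued_field
begin

lemma val_inI: "c \<in> F \<Longrightarrow> c \<noteq> 0 \<Longrightarrow> x / c \<in> V - \<mm> \<Longrightarrow> val_in F x"
  by (auto simp: val_in_def)

lemma val_in_self: "x \<in> F \<Longrightarrow> x \<noteq> 0 \<Longrightarrow> val_in F x"
  using one_unit by (intro val_inI[of x]) auto

lemma val_in_mult:
  assumes F: "is_subfield F" and "val_in F x" "val_in F y"
  shows "val_in F (x * y)"
proof -
  obtain c d where "c \<in> F" "c \<noteq> 0" "x / c \<in> V - \<mm>" "d \<in> F" "d \<noteq> 0" "y / d \<in> V - \<mm>"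
    using assms unfolding val_in_def by blast
  then show ?thesis
    using unit_mult[of "x / c" "y / d"] by (intro val_inI[of "c * d"]) (auto intro: subfield_intros F)
qed

lemma val_in_inverse:
  assumes F: "is_subfield F" and "val_in F x"
  shows "val_in F (inverse x)"
proof -
  obtain c where "c \<in> F" "c \<noteq> 0" "x / c \<in> V - \<mm>" using assms unfolding val_in_def by blast
  then show ?thesis
    using unit_inverse[of "x / c"] by (intro val_inI[of "inverse c"]) (auto intro: subfield_intros F simp: field_simps)
qed

lemma val_in_power: "is_subfield F \<Longrightarrow> val_in F x \<Longrightarrow> val_in F (x ^ n)"
  by (induction n) (auto intro: val_in_mult val_in_self subfield_intros)

lemma val_in_nonzero: "val_in F x \<Longrightarrow> x \<noteq> 0"
  using nonunit_0 by (auto simp: val_in_def)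

lemma val_in_cong:
  assumes "val_in F x" "y / x \<in> V - \<mm>"
  shows "val_in F y"
proof -
  obtain c where "c \<in> F" "c \<noteq> 0" "x / c \<in> V - \<mm>" using assms unfolding val_in_def by blast
  then show ?thesis
    using unit_mult[OF assms(2), of "x / c"] val_in_nonzero[OF assms(1)] by (intro val_inI[of c]) auto
qed

text \<open>The order of the value of x modulo the value group of F divides both i and j. Bezout is
  used with natural exponents, i a = j b + 1, so that x is (x^i)^a divided by (x^j)^b.\<close>

lemma val_in_coprime_powers:
  assumes F: "is_subfield F" and x: "val_in F (x ^ i)" "val_in F (x ^ j)" and ij: "coprime i j" "i > 0"
  shows "val_in F x"
proof -
  have x0: "x \<noteq> 0" using val_in_nonzero[OF x(1)] ij by auto
  obtain a b where ab: "i * a = j * b + 1" using coprime_bezout_strong[of i j] ij bezout_nat[of i j] by (metis coprime_imp_gcd_eq_1 less_not_refl)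
  have "x = (x ^ i) ^ a * inverse ((x ^ j) ^ b)"
    using x0 ab by (simp add: power_mult[symmetric] field_simps)
  then show ?thesis using x F by (metis val_in_mult val_in_inverse val_in_power)
qed

text \<open>When the summands have pairwise distinct values, the sum has the least of these values,
  so a sum in \<open>V\<close> forces every summand into \<open>V\<close>.\<close>

lemma distinct_values_sum:
  assumes I: "finite I" and nz: "\<And>i. i \<in> I \<Longrightarrow> u i \<noteq> 0"
    and distinct: "\<And>i j. i \<in> I \<Longrightarrow> j \<in> I \<Longrightarrow> i \<noteq> j \<Longrightarrow> u i / u j \<notin> V - \<mm>"
    and sum: "sum u I \<in> V" and k: "k \<in> I"
  shows "u k \<in> V"
proof -
  obtain i where i: "i \<in> I" "\<And>j. j \<in> I \<Longrightarrow> u j / u i \<in> V"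
    using dominant_element[of I u] I nz k by blast
  have "sum u I = u i + sum u (I - {i})" using I i(1) by (rule sum.remove)
  then have "sum u I / u i = 1 + (\<Sum>j\<in>I - {i}. u j / u i)"
    using nz[OF i(1)] by (simp add: add_divide_distrib sum_divide_distrib)
  also have "\<dots> \<in> V - \<mm>"
  proof (intro unit_add_nonunit one_unit nonunit_sum)
    fix j assume "j \<in> I - {i}"
    then show "u j / u i \<in> \<mm>" using distinct[of j i] i by blast
  qed
  finally have unit: "sum u I / u i \<in> V - \<mm>" .
  then have "u i / sum u I \<in> V - \<mm>" using unit_inverse[OF unit] by simp
  moreover have "sum u I \<noteq> 0"
    using unit nonunit_0 by auto
  ultimately have "u i \<in> V" using V_intros(4)[OF _ sum, of "u i / sum u I"] by simp
  then have "u k / u i * u i \<in> V" using i(2)[OF k] by (intro V_intros)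
  then show ?thesis using nz[OF i(1)] by simp
qed

text \<open>\<open>V\<close> \<inter> F' is a directed union of subalgebras generated by one element
  over \<open>V\<close> \<inter> F; the generator w may depend on S.\<close>

definition monogenic_union :: "'a set \<Rightarrow> 'a set \<Rightarrow> bool"
  where "monogenic_union F F' \<longleftrightarrow>
    (\<forall>S. finite S \<longrightarrow> S \<subseteq> V \<inter> F' \<longrightarrow> (\<exists>w\<in>V \<inter> F'. S \<subseteq> adjoin (V \<inter> F) w))"

text \<open>The residues of 1, w, ..., w^(n-1) are linearly independent over the residue field of
  F.\<close>

definition residually_independent :: "'a set \<Rightarrow> 'a \<Rightarrow> nat \<Rightarrow> bool"
  where "residually_independent F w n \<longleftrightarrow>
    (\<forall>g\<in>polys_over (V \<inter> F). (g = 0 \<or> degree g < n) \<longrightarrow> poly g w \<in> \<mm> \<longrightarrow> (\<forall>i. coeff g i \<in> \<mm>))"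

lemma primitive_part:
  assumes F: "is_subfield F" and g: "g \<in> polys_over F" "g \<noteq> 0"
  obtains c g' i where "c \<in> F" "c \<noteq> 0" "g' \<in> polys_over (V \<inter> F)" "g = smult c g'" "coeff g' i = 1"
proof -
  define I where "I = {i. i \<le> degree g \<and> coeff g i \<noteq> 0}"
  have "finite I" "degree g \<in> I" using g by (auto simp: I_def)
  moreover have "coeff g i \<noteq> 0" if "i \<in> I" for i using that by (simp add: I_def)
  ultimately obtain i where i: "i \<in> I" "\<And>j. j \<in> I \<Longrightarrow> coeff g j / coeff g i \<in> V"
    using dominant_element[of I "coeff g"] by blast
  define c where "c = coeff g i"
  have c: "c \<in> F" "c \<noteq> 0" using i g by (auto simp: c_def I_def polys_overD)
  have "coeff g j / c \<in> V \<inter> F" for j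
  proof (cases "j \<in> I")
    case True
    then show ?thesis using i g c by (auto simp: c_def polys_overD intro: subfield_divide F)
  next
    case False
    then have "coeff g j = 0" by (auto simp: I_def coeff_eq_0)
    then show ?thesis using V_intros(1) subfield_intros(1)[OF F] by simp
  qed
  then have "smult (inverse c) g \<in> polys_over (V \<inter> F)"
    by (intro polys_overI) (simp add: divide_inverse mult.commute)
  then show ?thesis using that[of c "smult (inverse c) g" i] c by (simp add: c_def)
qed

text \<open>Write y = c g'(w) with a primitive g'. Independence of the residues makes g'(w) a unit,
  so y in \<open>V\<close> forces c in \<open>V\<close>. Here w itself generates all of
  \<open>V\<close> \<inter> F(w).\<close>

lemma residual_step:
  assumes F: "is_subfield F" and h: "h \<in> polys_over F" "lead_coeff h = 1" "poly h w = 0"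
    and ind: "residually_independent F w (degree h)" and w: "w \<in> V"
  shows "monogenic_union F (adjoin F w)"
proof -
  have "y \<in> adjoin (V \<inter> F) w" if y: "y \<in> V \<inter> adjoin F w" for y
  proof -
    note VF = is_subring_Int[OF V subfield_subring[OF F]]
    obtain g where g: "g \<in> polys_over F" "y = poly g w" "g = 0 \<or> degree g < degree h"
      using adjoin_reduced[OF subfield_subring[OF F] h] y by blast
    show ?thesis
    proof (cases "g = 0")
      case True
      then show ?thesis using g by (auto intro: subring_0 is_subring_adjoin VF)
    next
      case False
      then obtain c g' i where c: "c \<in> F" "c \<noteq> 0" "g' \<in> polys_over (V \<inter> F)" "g = smult c g'" "coeff g' i = 1"
        using primitive_part[OF F g(1)] by blast
      have "g' = 0 \<or> degree g' < degree h" using g(3) False c by auto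
      then have "poly g' w \<notin> \<mm>"
        using ind c one_not_nonunit unfolding residually_independent_def by metis
      moreover have "poly g' w \<in> V" using c(3) w by (auto simp: polys_over_Int intro: poly_in_V)
      ultimately have u: "inverse (poly g' w) \<in> V" "poly g' w \<noteq> 0" using unit_iff by auto
      have "y * inverse (poly g' w) \<in> V" using y u by (intro V_intros) auto
      then have "c \<in> V" using g c u by (simp add: mult.assoc)
      then have "smult c g' \<in> polys_over (V \<inter> F)" using c by (intro polys_over_smult VF) auto
      from adjoinI[OF this, of w] show ?thesis using g(2) c(4) by simp
    qed
  qed
  then show ?thesis
    using w adjoin_generator[OF subfield_subring[OF F], of w] unfolding monogenic_union_def by blast
qed

text \<open>The value of z has prime order n modulo the value group of F, so each power z^j with n
  not dividing j generates the same quotient and may take the place of z; \<open>roots\<close>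
  provides its equation of degree n. The power is selected so that scalings of it suffice to divide
  all elements with value outside the group of F.\<close>

lemma ramified_step:
  assumes F: "is_subfield F" and n: "prime (n::nat)" and zn: "val_in F (z ^ n)" and z: "\<not> val_in F z"
    and roots: "\<And>j. \<not> n dvd j \<Longrightarrow> \<exists>h\<in>polys_over F. lead_coeff h = 1 \<and> degree h = n \<and> poly h (z ^ j) = 0"
  obtains j where "z ^ j \<notin> F" "monogenic_union F (adjoin F (z ^ j))"
proof -
  note R = subfield_subring[OF F]
  have n0: "n > 0" using n by (rule prime_gt_0_nat)
  have z0: "z \<noteq> 0" using val_in_nonzero[OF zn] n0 by auto
  have nv: "\<not> val_in F (z ^ j)" if "\<not> n dvd j" for j
    using val_in_coprime_powers[OF F zn, of j] z that prime_imp_coprime[OF n] n0 by blast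
  define U where "U j = {c * z ^ j | c. c \<in> F \<and> c \<noteq> 0 \<and> c * z ^ j \<in> V}" for j
  have U0: "u \<noteq> 0" if "u \<in> U j" for u j using that z0 by (auto simp: U_def)
  \<comment> \<open>Otherwise each i has some u i, in a nontrivial coset, of smaller value than all
    of U i. The least of these finitely many elements lies up to a unit in some U j0, against the
    choice of u j0.\<close>
  have "\<exists>j0. \<not> n dvd j0 \<and> (\<forall>j. \<not> n dvd j \<longrightarrow> (\<forall>s\<in>U j. \<exists>t\<in>U j0. s / t \<in> V))"
  proof (rule ccontr)
    assume contra: "\<not> ?thesis"
    have "\<exists>j s. \<not> n dvd j \<and> s \<in> U j \<and> (\<forall>t\<in>U i. s / t \<notin> V)" if "i \<in> {1..<n}" for i
    proof -
      have "\<not> n dvd i" using that nat_dvd_not_less[of i n] by auto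
      then show ?thesis using contra by blast
    qed
    then obtain J u where u: "\<And>i. i \<in> {1..<n} \<Longrightarrow> \<not> n dvd J i" "\<And>i. i \<in> {1..<n} \<Longrightarrow> u i \<in> U (J i)"
        "\<And>i t. i \<in> {1..<n} \<Longrightarrow> t \<in> U i \<Longrightarrow> u i / t \<notin> V" by metis
    have "{1..<n} \<noteq> {}" using prime_gt_1_nat[OF n] by auto
    then obtain i where i: "i \<in> {1..<n}" "\<And>j. j \<in> {1..<n} \<Longrightarrow> u j / u i \<in> V"
      using dominant_element[of "{1..<n}" u] U0 u(2) by blast
    obtain c where c: "u i = c * z ^ J i" "c \<in> F" "c \<noteq> 0" "c * z ^ J i \<in> V" using u(2)[OF i(1)] by (auto simp: U_def)
    obtain d where d: "d \<in> F" "d \<noteq> 0" "z ^ n / d \<in> V - \<mm>" using zn unfolding val_in_def by blast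
    define j0 where "j0 = J i mod n"
    \<comment> \<open>The exponent is reduced modulo n by trading z^n for the element d of F with
      the same value.\<close>
    define t where "t = c * d ^ (J i div n) * z ^ j0"
    have j0: "j0 \<in> {1..<n}" using u(1)[OF i(1)] n0 by (auto simp: j0_def dvd_eq_mod_eq_0 Suc_leI)
    have "z ^ J i = (z ^ n) ^ (J i div n) * z ^ j0"
      by (simp add: j0_def power_mult[symmetric] power_add[symmetric])
    then have eq: "u i / t = (z ^ n / d) ^ (J i div n)"
      using c d z0 by (simp add: t_def power_divide)
    have unit: "u i / t \<in> V - \<mm>" unfolding eq by (intro unit_power d)
    have t0: "t \<noteq> 0" using c d z0 by (simp add: t_def)
    have "t = u i * inverse (u i / t)" using t0 U0[OF u(2)[OF i(1)]] by simp
    also have "\<dots> \<in> V" using c unit_inverse[OF unit] by (intro V_intros) auto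
    finally have "t \<in> U j0"
      unfolding U_def t_def using c d by (auto intro!: exI[of _ "c * d ^ (J i div n)"] subfield_intros F)
    moreover have "u j0 / u i * (u i / t) \<in> V" using i(2)[OF j0] unit by (intro V_intros) auto
    then have "u j0 / t \<in> V" using U0[OF u(2)[OF i(1)]] by simp
    ultimately show False using u(3)[OF j0] by blast
  qed
  then obtain j0 where j0: "\<not> n dvd j0" and coinitial: "\<And>j s. \<not> n dvd j \<Longrightarrow> s \<in> U j \<Longrightarrow> \<exists>t\<in>U j0. s / t \<in> V"
    by blast
  define w where "w = z ^ j0"
  have w0: "w \<noteq> 0" using z0 by (simp add: w_def)
  \<comment> \<open>By coinitiality one factor c1 w splits off from c w^(i+1), and induction gives
    c2 w for the rest. Whichever of c1 w and c2 w has the smaller value works for all i + 1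
    factors.\<close>
  have small: "\<exists>c'\<in>F. c' \<noteq> 0 \<and> c' * w \<in> V \<and> c * w ^ i / (c' * w) ^ i \<in> V"
    if "0 < i" "i < n" "c \<in> F" "c \<noteq> 0" "c * w ^ i \<in> V" for i c
    using that
  proof (induction i arbitrary: c)
    case (Suc i)
    show ?case
    proof (cases "i = 0")
      case True
      then show ?thesis using Suc.prems w0 V_intros(2) by (intro bexI[of _ c]) auto
    next
      case False
      have "\<not> n dvd j0 * Suc i"
        using j0 Suc.prems prime_dvd_mult_iff[OF n, of j0 "Suc i"] dvd_imp_le[of n "Suc i"] by auto
      moreover have wz: "w ^ Suc i = z ^ (j0 * Suc i)" by (simp only: w_def power_mult)
      have "c * w ^ Suc i \<in> U (j0 * Suc i)"
        unfolding U_def using Suc.prems unfolding wz by blast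
      ultimately obtain c1 where c1: "c1 \<in> F" "c1 \<noteq> 0" "c1 * w \<in> V" "c * w ^ Suc i / (c1 * w) \<in> V"
        using coinitial[of "j0 * Suc i" "c * w ^ Suc i"] unfolding U_def w_def by blast
      have "c / c1 * w ^ i \<in> V" using c1 w0 by (simp add: field_simps)
      then obtain c2 where c2: "c2 \<in> F" "c2 \<noteq> 0" "c2 * w \<in> V" "c / c1 * w ^ i / (c2 * w) ^ i \<in> V"
        using Suc.IH[of "c / c1"] Suc.prems c1 False by (auto intro: subfield_divide F)
      show ?thesis
      proof (cases "c1 / c2 \<in> V")
        case True
        have "c * w ^ Suc i / (c2 * w) ^ Suc i = (c / c1 * w ^ i / (c2 * w) ^ i) * (c1 / c2)"
          using c1 c2 w0 by (simp add: field_simps)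
        also have "\<dots> \<in> V" using c2 True by (intro V_intros)
        finally show ?thesis using c2 by blast
      next
        case False
        then have "c2 / c1 \<in> V" using divide_cases[of c1 c2] nonunit_in by blast
        moreover have "c * w ^ Suc i / (c1 * w) ^ Suc i = (c / c1 * w ^ i / (c2 * w) ^ i) * (c2 / c1) ^ i"
          using c1 c2 w0 by (simp add: field_simps)
        ultimately have "c * w ^ Suc i / (c1 * w) ^ Suc i \<in> V" using c2 by (metis V_intros(4,7))
        then show ?thesis using c1 by blast
      qed
    qed
  qed simp
  have wF: "w \<notin> F" using nv[OF j0] val_in_self[of w F] w0 by (auto simp: w_def)
  have "monogenic_union F (adjoin F w)"
    unfolding monogenic_union_def
  proof (intro allI impI)
    fix S assume S: "finite S" "S \<subseteq> V \<inter> adjoin F w"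
    obtain h where h: "h \<in> polys_over F" "lead_coeff h = 1" "degree h = n" "poly h w = 0"
      using roots[OF j0] by (auto simp: w_def)
    have "\<exists>g. g \<in> polys_over F \<and> y = poly g w \<and> (g = 0 \<or> degree g < n)" if y: "y \<in> S" for y
    proof -
      obtain g where "g \<in> polys_over F" "y = poly g w" "g = 0 \<or> degree g < degree h"
        using adjoin_reduced[OF R h(1,2,4), of y] y S by blast
      then show ?thesis using h by blast
    qed
    then obtain g where g: "\<And>y. y \<in> S \<Longrightarrow> g y \<in> polys_over F" "\<And>y. y \<in> S \<Longrightarrow> y = poly (g y) w"
        "\<And>y. y \<in> S \<Longrightarrow> g y = 0 \<or> degree (g y) < n" by metis
    have term_V: "coeff (g y) i * w ^ i \<in> V" if y: "y \<in> S" and i: "i < n" for y i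
    proof (cases "coeff (g y) i = 0")
      case False
      define I where "I = {i. i < n \<and> coeff (g y) i \<noteq> 0}"
      have "y = (\<Sum>i<n. coeff (g y) i * w ^ i)" using poly_eq_sum_less[OF g(3)[OF y]] g(2)[OF y] by simp
      also have "\<dots> = (\<Sum>i\<in>I. coeff (g y) i * w ^ i)"
        unfolding I_def by (intro sum.mono_neutral_right) auto
      finally have ysum: "(\<Sum>i\<in>I. coeff (g y) i * w ^ i) \<in> V" using y S by auto
      \<comment> \<open>Two terms of equal value would put the value of w^(i-j) into the value group
        of F, although n does not divide j0 (i - j).\<close>
      have aux: "coeff (g y) i * w ^ i / (coeff (g y) j * w ^ j) \<notin> V - \<mm>"
        if ij: "i \<in> I" "j \<in> I" "j < i" for i j
      proof
        assume unit: "coeff (g y) i * w ^ i / (coeff (g y) j * w ^ j) \<in> V - \<mm>"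
        have "w ^ i = w ^ (i - j) * w ^ j" using ij by (simp add: power_add[symmetric])
        then have "coeff (g y) i * w ^ i / (coeff (g y) j * w ^ j) = w ^ (i - j) / (coeff (g y) j / coeff (g y) i)"
          using w0 by simp
        then have "val_in F (w ^ (i - j))"
          using unit ij g(1)[OF y] by (intro val_inI[of "coeff (g y) j / coeff (g y) i"])
            (auto simp: I_def intro!: subfield_divide F polys_overD)
        moreover have "\<not> n dvd j0 * (i - j)"
          using j0 ij prime_dvd_mult_iff[OF n, of j0 "i - j"] dvd_imp_le[of n "i - j"] by (auto simp: I_def)
        ultimately show False using nv by (simp add: w_def power_mult[symmetric])
      qed
      show ?thesis
      proof (rule distinct_values_sum[of I "\<lambda>i. coeff (g y) i * w ^ i"])
        show "finite I" by (simp add: I_def)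
        show "i \<in> I" using i False by (simp add: I_def)
        show "(\<Sum>i\<in>I. coeff (g y) i * w ^ i) \<in> V" by (rule ysum)
        show "coeff (g y) k * w ^ k \<noteq> 0" if "k \<in> I" for k using that w0 by (simp add: I_def)
        show "coeff (g y) k * w ^ k / (coeff (g y) j * w ^ j) \<notin> V - \<mm>" if "k \<in> I" "j \<in> I" "k \<noteq> j" for k j
        proof (cases "j < k")
          case True
          then show ?thesis using aux that by blast
        next
          case False
          then have "coeff (g y) j * w ^ j / (coeff (g y) k * w ^ k) \<notin> V - \<mm>" using aux[of j k] that by simp
          then show ?thesis using unit_inverse by fastforce
        qed
      qed
    qed (use V_intros(1) in simp)
    define T where "T = {(y, i). y \<in> S \<and> i \<in> {1..<n} \<and> coeff (g y) i \<noteq> 0}"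
    have "T \<subseteq> S \<times> {1..<n}" by (auto simp: T_def)
    then have finT: "finite T" using S finite_subset by blast
    have "\<exists>c\<in>F. c \<noteq> 0 \<and> c * w \<in> V \<and> coeff (g y) i * w ^ i / (c * w) ^ i \<in> V" if "(y, i) \<in> T" for y i
      using small[of i "coeff (g y) i"] that term_V g(1) by (auto simp: T_def polys_overD)
    then obtain C where C: "\<And>y i. (y, i) \<in> T \<Longrightarrow> C y i \<in> F \<and> C y i \<noteq> 0 \<and> C y i * w \<in> V \<and>
        coeff (g y) i * w ^ i / (C y i * w) ^ i \<in> V" by metis
    \<comment> \<open>Of the finitely many scalings found for single terms, the one of least value
      serves them all.\<close>
    obtain c where c: "c \<in> F" "c \<noteq> 0" "T \<noteq> {} \<longrightarrow> c * w \<in> V" "\<And>y i. (y, i) \<in> T \<Longrightarrow> C y i / c \<in> V"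
    proof (cases "T = {}")
      case True
      then show ?thesis using that[of 1] subfield_intros(2)[OF F] by auto
    next
      case False
      have C': "C (fst q) (snd q) \<in> F \<and> C (fst q) (snd q) \<noteq> 0 \<and> C (fst q) (snd q) * w \<in> V" if "q \<in> T" for q
        using C[of "fst q" "snd q"] that by simp
      then obtain p where p: "p \<in> T" "\<And>q. q \<in> T \<Longrightarrow> C (fst q) (snd q) / C (fst p) (snd p) \<in> V"
        using dominant_element[of T "\<lambda>q. C (fst q) (snd q)"] finT False by blast
      have "C y i / C (fst p) (snd p) \<in> V" if "(y, i) \<in> T" for y i using p(2)[OF that] by simp
      then show ?thesis using that[of "C (fst p) (snd p)"] C'[OF p(1)] by blast
    qed
    \<comment> \<open>When T is empty, the elements of S consist of constant terms only and lie in
      F, so 0 is a suitable generator.\<close>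
    define v where "v = (if T = {} then 0 else c * w)"
    have "v \<in> V" using c V_intros(1) by (simp add: v_def)
    moreover have "c * w \<in> adjoin F w"
      using c(1) adjoin_contains[OF R, of w] adjoin_generator[OF R, of w]
      by (intro subring_mult[OF is_subring_adjoin[OF R]]) auto
    then have "v \<in> adjoin F w" by (simp add: v_def subring_0[OF is_subring_adjoin[OF R]])
    moreover have "S \<subseteq> adjoin (V \<inter> F) v"
    proof
      fix y assume y: "y \<in> S"
      have coeffs: "coeff (g y) i / c ^ i \<in> V \<and> coeff (g y) i / c ^ i \<in> F \<and>
          coeff (g y) i * w ^ i = coeff (g y) i / c ^ i * v ^ i" if i: "i < n" for i
      proof (cases "(y, i) \<in> T")
        case True
        have "coeff (g y) i / c ^ i = (coeff (g y) i * w ^ i / (C y i * w) ^ i) * (C y i / c) ^ i"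
          using w0 c(2) C[OF True] by (simp add: field_simps)
        also have "\<dots> \<in> V" using C[OF True] c(4)[OF True] by (intro V_intros) auto
        finally show ?thesis using True c(1,2) g(1)[OF y]
          by (auto simp: v_def power_mult_distrib intro!: subfield_divide subfield_intros F polys_overD)
      next
        case False
        then have "i = 0 \<or> coeff (g y) i = 0" using y i by (auto simp: T_def)
        then show ?thesis
          using term_V[OF y i] g(1)[OF y] V_intros(1) subfield_intros(1)[OF F] by (auto simp: polys_overD)
      qed
      define q where "q = (\<Sum>i<n. monom (coeff (g y) i / c ^ i) i)"
      have "q \<in> polys_over (V \<inter> F)"
        unfolding q_def using coeffs by (intro polys_over_ring polys_over_monom is_subring_Int V R) auto
      moreover have "poly q v = y"
        using g(2)[OF y] poly_eq_sum_less[OF g(3)[OF y]] coeffs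
        by (simp add: q_def poly_sum poly_monom)
      ultimately show "y \<in> adjoin (V \<inter> F) v" using adjoinI by blast
    qed
    ultimately show "\<exists>v\<in>V \<inter> adjoin F w. S \<subseteq> adjoin (V \<inter> F) v" by blast
  qed
  then show ?thesis using that wF by (simp add: w_def)
qed

end

section \<open>Hensel lifting and values of conjugates over intermediate fields\<close>

context henselian_closure
begin

lemma conj_nonunit:
  assumes F: "is_subfield F" "K \<subseteq> F" and c: "conj_over F x y" and x: "x \<in> \<mm>"
  shows "y \<in> \<mm>"
proof (rule ccontr)
  assume "y \<notin> \<mm>"
  moreover have "y \<in> V" using conj_in_V[OF F(2) c nonunit_in[OF x]] .
  ultimately have y: "inverse y \<in> V" "y \<noteq> 0" using unit_iff by auto
  have alg: "alg_over F t" for t using alg alg_over_mono[OF F(2)] by blast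
  have sym: "conj_over F y x" by (rule conj_over_sym[OF F(1) alg c])
  then have "conj_over F (inverse y) (inverse x)" using conj_over_inverse[OF F(1) _ y(2) alg] by blast
  then have "inverse x \<in> V" using conj_in_V[OF F(2)] y by blast
  moreover have "x \<noteq> 0"
    using conj_over_self_eq[OF F(1) c] y subfield_intros(1)[OF F(1)] by auto
  ultimately show False using x by (simp add: nonunits_def)
qed

lemma conj_unit:
  assumes F: "is_subfield F" "K \<subseteq> F" and c: "conj_over F x y" and x: "x \<in> V - \<mm>"
  shows "y \<in> V - \<mm>"
proof
  show "y \<in> V" using conj_in_V[OF F(2) c] x by simp
  show "y \<notin> \<mm>"
    using conj_nonunit[OF F conj_over_sym[OF F(1) alg_over_mono[OF F(2) alg] c]] x by auto
qed

text \<open>Over the algebraic closure some root w of h is congruent to b, because the product of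
  the differences is h(b). Conjugates of w over F are also roots congruent to b, and two such roots
  would make the derivative a nonunit there. So w is separable and equal to all its
  conjugates.\<close>

lemma hensel_lift:
  assumes F: "is_subfield F" "K \<subseteq> F" and h: "h \<in> polys_over (V \<inter> F)" "lead_coeff h = 1"
    and b: "b \<in> V \<inter> F" "poly h b \<in> \<mm>" "poly (pderiv h) b \<notin> \<mm>"
  obtains w where "w \<in> V \<inter> F" "poly h w = 0" "w - b \<in> \<mm>"
proof -
  have hV: "h \<in> polys_over V" and hF: "h \<in> polys_over F" using h by (auto simp: polys_over_Int)
  have dV: "pderiv h \<in> polys_over V" by (rule polys_over_pderiv[OF V hV])
  have "h \<noteq> 0" using h by auto
  then obtain A where A: "h = (\<Prod>a\<in>#A. [:- a, 1:])"
    using alg_closed_imp_factorization[of h] h(2) by auto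
  have root: "poly h a = 0" if "a \<in># A" for a using that unfolding A by (auto simp: poly_prod_mset)
  have rootV: "a \<in> V" if "poly h a = 0" for a using integral_in_V[OF hV h(2) that] .
  have "\<exists>a\<in>#B. b - a \<in> \<mm>" if "(\<Prod>a\<in>#B. b - a) \<in> \<mm>" "set_mset B \<subseteq> V" for B
    using that
  proof (induction B)
    case (add a B)
    have "(\<Prod>a\<in>#B. b - a) \<in> V" using add.prems(2)
    proof (induction B)
      case (add a B)
      then show ?case using b by (auto intro: V_intros)
    qed (simp add: V_intros)
    then have "b - a \<in> \<mm> \<or> (\<Prod>a\<in>#B. b - a) \<in> \<mm>"
      using nonunit_prime[of "b - a"] add.prems b V_intros(3) by auto
    then show ?case using add by auto
  qed (simp add: one_not_nonunit)
  moreover have "(\<Prod>a\<in>#A. b - a) \<in> \<mm>" using b(2) unfolding A by (simp add: poly_prod_mset)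
  ultimately obtain w where w: "w \<in># A" "b - w \<in> \<mm>" using root rootV by blast
  have wb: "w - b \<in> \<mm>" using cong_sym[OF w(2)] .
  have wV: "w \<in> V" using root rootV w by blast
  have near: "poly (pderiv h) a \<notin> \<mm>" if "a \<in> V" "a - b \<in> \<mm>" for a
    using cong_poly[OF that(2,1) _ dV] b nonunit_cong[of "poly (pderiv h) a" "poly (pderiv h) b"] cong_sym by blast
  have "w \<in> F"
  proof (rule conj_fixed_in_subfield[OF F(1)])
    show "sep_over F w"
      using hF root[OF w(1)] near[OF wV wb] nonunit_0 unfolding sep_over_def by metis
    fix w' assume c: "conj_over F w w'"
    have w': "poly h w' = 0" using c hF root[OF w(1)] by (auto simp: conj_over_def)
    have w'V: "w' \<in> V" by (rule rootV[OF w'])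
    have w'b: "w' - b \<in> \<mm>"
      using conj_nonunit[OF F conj_over_translate[OF F(1) c] wb] b by blast
    show "w' = w"
    proof (rule ccontr)
      assume ne: "w' \<noteq> w"
      obtain s r where s: "s \<in> polys_over V" "h = [:- w, 1:] * s + r" "r = 0 \<or> degree r < degree [:- w, 1:]"
        using polys_over_division[OF V polys_over_linear[OF V wV] _ hV] by auto
      have "r = 0"
      proof -
        have "degree r = 0" using s(3) by auto
        then obtain r0 where "r = [:r0:]" by (metis degree_eq_zeroE)
        moreover have "poly r w = 0" using arg_cong[OF s(2), of "\<lambda>p. poly p w"] root[OF w(1)] by simp
        ultimately show ?thesis by simp
      qed
      then have hs: "h = [:- w, 1:] * s" using s by simp
      have "(w' - w) * poly s w' = 0" using w' unfolding hs poly_mult by simp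
      then have "poly s w' = 0" using ne by simp
      then have "poly (pderiv h) w' = (w' - w) * poly (pderiv s) w'"
        unfolding hs pderiv_mult by (simp add: pderiv_pCons algebra_simps)
      also have "\<dots> \<in> \<mm>"
        using cong_trans[OF w'b cong_sym[OF wb]] poly_in_V[OF polys_over_pderiv[OF V s(1)] w'V] by (rule nonunit_mult)
      finally show False using near[OF w'V w'b] by simp
    qed
  qed
  then show ?thesis using that wV root w(1) wb by blast
qed

text \<open>In the equation of e over F the terms cancel, so two of them share the least value; the
  quotient of these two expresses a power of e up to a unit by an element of F.\<close>

lemma value_torsion:
  assumes F: "is_subfield F" "K \<subseteq> F" and e: "e \<noteq> 0"
  obtains N where "N > 0" "val_in F (e ^ N)"
proof -
  obtain m where m: "minimal_poly F e m" using minimal_poly_exists[OF F(1) alg_over_mono[OF F(2) alg]] .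
  define I where "I = {i. i \<le> degree m \<and> coeff m i \<noteq> 0}"
  define u where "u i = coeff m i * e ^ i" for i
  have I: "finite I" "I \<noteq> {}" using minimal_polyD(2)[OF m] by (auto simp: I_def)
  have u0: "u i \<noteq> 0" if "i \<in> I" for i using that e by (simp add: u_def I_def)
  obtain i where i: "i \<in> I" "\<And>j. j \<in> I \<Longrightarrow> u j / u i \<in> V"
    using dominant_element[OF I, of u] u0 by blast
  have "0 = sum u {..degree m}" using minimal_polyD(4)[OF m] by (simp add: u_def poly_altdef)
  also have "\<dots> = sum u I" by (intro sum.mono_neutral_right) (auto simp: I_def u_def)
  also have "\<dots> = u i + sum u (I - {i})" using I i(1) by (intro sum.remove)
  finally have "0 = (u i + sum u (I - {i})) / u i" by simp
  also have "\<dots> = 1 + (\<Sum>j\<in>I - {i}. u j / u i)"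
    using u0[OF i(1)] by (simp add: add_divide_distrib sum_divide_distrib)
  finally have "(\<Sum>j\<in>I - {i}. u j / u i) = -1" by (simp add: eq_neg_iff_add_eq_0 add.commute)
  then have "(\<Sum>j\<in>I - {i}. u j / u i) \<notin> \<mm>" using nonunit_minus[of "-1"] one_not_nonunit by auto
  then obtain j where j: "j \<in> I" "j \<noteq> i" "u j / u i \<notin> \<mm>"
    using nonunit_sum[of "I - {i}" "\<lambda>j. u j / u i"] by (metis DiffE singletonI)
  then have unit: "u j / u i \<in> V - \<mm>" using i by blast
  have step: "\<exists>N>0. val_in F (e ^ N)" if ab: "a \<in> I" "b \<in> I" "a < b" "u b / u a \<in> V - \<mm>" for a b
  proof (intro exI[of _ "b - a"] conjI)
    have "e ^ b = e ^ (b - a) * e ^ a" using ab(3) by (metis le_add_diff_inverse2 less_imp_le power_add)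
    then have "u b / u a = e ^ (b - a) / (coeff m a / coeff m b)" using e by (simp add: u_def)
    then show "val_in F (e ^ (b - a))"
      using ab minimal_polyD(1)[OF m]
      by (intro val_inI[of "coeff m a / coeff m b"]) (auto simp: I_def intro!: subfield_divide F polys_overD)
  qed (use ab in simp)
  have "\<exists>N>0. val_in F (e ^ N)"
  proof (cases "i < j")
    case True
    then show ?thesis using step i j unit by blast
  next
    case False
    then show ?thesis using step[of j i] i j unit_inverse[OF unit] by simp
  qed
  then show ?thesis using that by blast
qed

text \<open>Some power of x is a unit times an element of F, and conjugation preserves units; the
  root of that power is extracted by \<open>unit_power_iff\<close>.\<close>

lemma conj_value:
  assumes F: "is_subfield F" "K \<subseteq> F" and c: "conj_over F x y" and x: "x \<noteq> 0"
  shows "y / x \<in> V - \<mm>"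
proof -
  obtain N where N: "N > 0" "val_in F (x ^ N)" using value_torsion[OF F x] .
  then obtain d where d: "d \<in> F" "d \<noteq> 0" "x ^ N / d \<in> V - \<mm>" unfolding val_in_def by blast
  have "conj_over F (inverse d * x ^ N) (inverse d * y ^ N)"
    using d by (intro conj_over_scale conj_over_power F c subfield_inverse)
  then have "y ^ N / d \<in> V - \<mm>"
    using conj_unit[OF F, of "x ^ N / d" "y ^ N / d"] d by (simp add: divide_inverse mult.commute)
  then have "(y ^ N / d) / (x ^ N / d) \<in> V - \<mm>" by (rule unit_divide[OF _ d(3)])
  moreover have "(y ^ N / d) / (x ^ N / d) = (y / x) ^ N" using d by (simp add: power_divide)
  ultimately show ?thesis using unit_power_iff[OF N(1)] by simp
qed

end

section \<open>One step in a Galois extension\<close>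

context valued_field
begin

text \<open>Taking p = 1 in residue characteristic zero lets statements about exponents p^k cover
  both cases.\<close>

definition residue_char_exponent :: "nat \<Rightarrow> bool"
  where "residue_char_exponent p \<longleftrightarrow> (p = 1 \<and> (\<forall>n>0. of_nat n \<notin> \<mm>)) \<or> (prime p \<and> of_nat p \<in> \<mm>)"

lemma residue_char_exponent_exists: "\<exists>p. residue_char_exponent p"
proof (cases "\<exists>n>0. of_nat n \<in> \<mm>")
  case True
  have "n > 0 \<Longrightarrow> of_nat n \<in> \<mm> \<Longrightarrow> \<exists>p. prime p \<and> of_nat p \<in> \<mm>" for n :: nat
  proof (induction n rule: less_induct)
    case (less n)
    have "n \<noteq> 1" using less.prems one_not_nonunit by auto
    then obtain p where p: "prime p" "p dvd n" using prime_factor_nat by blast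
    then obtain k where k: "n = p * k" by blast
    have "of_nat p \<in> \<mm> \<or> of_nat k \<in> \<mm>"
      using less.prems k by (intro nonunit_prime V_intros) simp
    then show ?case
    proof
      assume "of_nat k \<in> \<mm>"
      moreover have "k < n" "k > 0" using k less.prems prime_gt_1_nat[OF p(1)] by auto
      ultimately show ?case using less.IH by blast
    qed (use p in blast)
  qed
  then show ?thesis using True by (auto simp: residue_char_exponent_def)
next
  case False
  then have "residue_char_exponent 1" unfolding residue_char_exponent_def by blast
  then show ?thesis ..
qed

lemma coprime_unit:
  assumes "residue_char_exponent p" "coprime n p" "n > 0"
  shows "of_nat n \<notin> \<mm>"
proof
  assume n: "of_nat n \<in> \<mm>"
  then have p: "of_nat p \<in> \<mm>" using assms by (auto simp: residue_char_exponent_def)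
  obtain a b where "n * a = p * b + 1"
    using bezout_nat[of n p] assms by (metis coprime_imp_gcd_eq_1 less_not_refl)
  then have "(of_nat (n * a) :: 'a) = of_nat (p * b + 1)" by simp
  then have "1 = of_nat n * of_nat a - (of_nat p * of_nat b :: 'a)" by simp
  also have "\<dots> \<in> \<mm>" by (intro nonunit_diff nonunit_mult n p V_intros)
  finally show False using one_not_nonunit by simp
qed

text \<open>Frobenius is additive on the residue field, the middle binomial coefficients being
  divisible by p, and hence injective.\<close>

lemma residue_root_unique:
  assumes p: "residue_char_exponent p" and ab: "a \<in> V" "b \<in> V"
  shows "a ^ (p ^ k) - b ^ (p ^ k) \<in> \<mm> \<Longrightarrow> a - b \<in> \<mm>"
proof (induction k)
  case (Suc k)
  define a' b' d where "a' = a ^ (p ^ k)" and "b' = b ^ (p ^ k)" and "d = a' - b'"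
  have V': "a' \<in> V" "b' \<in> V" "d \<in> V" unfolding a'_def b'_def d_def by (intro V_intros ab)+
  have *: "a' ^ p - b' ^ p \<in> \<mm>" using Suc.prems by (simp add: a'_def b'_def power_mult[symmetric] mult.commute)
  have "d \<in> \<mm>"
  proof (cases "p = 1")
    case True
    then show ?thesis using * by (simp add: d_def)
  next
    case False
    then have pp: "prime p" "of_nat p \<in> \<mm>" using p by (auto simp: residue_char_exponent_def)
    have "a' ^ p = (b' + d) ^ p" by (simp add: d_def)
    also have "\<dots> = (\<Sum>i\<le>p. of_nat (p choose i) * b' ^ i * d ^ (p - i))" by (rule binomial_ring)
    also have "\<dots> = (\<Sum>i\<in>{0<..<p}. of_nat (p choose i) * b' ^ i * d ^ (p - i)) + b' ^ p + d ^ p"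
    proof -
      have "{..p} = insert 0 (insert p {0<..<p})" using prime_gt_0_nat[OF pp(1)] by auto
      then show ?thesis using prime_gt_0_nat[OF pp(1)] by simp
    qed
    finally have "d ^ p = (a' ^ p - b' ^ p) - (\<Sum>i\<in>{0<..<p}. of_nat (p choose i) * b' ^ i * d ^ (p - i))"
      by simp
    also have "\<dots> \<in> \<mm>"
    proof (intro nonunit_diff[OF *] nonunit_sum)
      fix i assume "i \<in> {0<..<p}"
      then have "p dvd (p choose i)" using dvd_choose_prime[of i p] pp(1) by auto
      then obtain c where "p choose i = p * c" by blast
      then show "of_nat (p choose i) * b' ^ i * d ^ (p - i) \<in> \<mm>"
        using pp(2) V' by (auto intro!: nonunit_mult(1) V_intros)
    qed
    finally show ?thesis using nonunit_power V' by blast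
  qed
  then show ?case using Suc.IH by (simp add: d_def a'_def b'_def)
qed simp

end

section \<open>Steps from the separable part of the residue extension\<close>

locale galois_step = henselian_closure V K + simple_galois F L \<theta>
  for V K F L :: "'a::alg_closed_field set" and \<theta> +
  fixes p :: nat
  assumes K_subset: "K \<subseteq> F" and p: "residue_char_exponent p"
begin

lemmas L = E and L_ring = E_ring

lemma VF_ring: "is_subring (V \<inter> F)" by (intro is_subring_Int V F_ring)

lemma K_subset_L: "K \<subseteq> L" using K_subset F_subset by auto

lemma alg_F: "alg_over F x" using alg alg_over_mono[OF K_subset] by blast

definition has_step :: bool
  where "has_step \<longleftrightarrow> (\<exists>w\<in>L. w \<notin> F \<and> monogenic_union F (adjoin F w))"

text \<open>A monic lift of the minimal polynomial of the residue of b over the residue field of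
  F.\<close>

definition residue_minimal :: "'a \<Rightarrow> 'a poly \<Rightarrow> bool"
  where "residue_minimal b h \<longleftrightarrow> h \<in> polys_over (V \<inter> F) \<and> lead_coeff h = 1 \<and> poly h b \<in> \<mm> \<and>
    residually_independent F b (degree h)"

lemma residue_minimal_exists:
  assumes b: "b \<in> V"
  obtains h where "residue_minimal b h"
proof -
  define P where "P n \<longleftrightarrow> (\<exists>h\<in>polys_over (V \<inter> F). lead_coeff h = 1 \<and> poly h b \<in> \<mm> \<and> degree h = n)" for n
  obtain h where "h \<in> polys_over (V \<inter> K)" "lead_coeff h = 1" "poly h b = 0" using V_integral[OF b] .
  moreover have "polys_over (V \<inter> K) \<subseteq> polys_over (V \<inter> F)" using K_subset by (intro polys_over_mono) auto
  ultimately have "P (degree h)" using nonunit_0 unfolding P_def by auto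
  then obtain n where n: "P n" "\<And>k. P k \<Longrightarrow> n \<le> k" using exists_least_iff[of P] by (metis not_le_imp_less)
  then obtain h where h: "h \<in> polys_over (V \<inter> F)" "lead_coeff h = 1" "poly h b \<in> \<mm>" "degree h = n"
    by (auto simp: P_def)
  have "residually_independent F b n"
    unfolding residually_independent_def
  proof (intro ballI impI allI)
    fix g i assume g: "g \<in> polys_over (V \<inter> F)" "g = 0 \<or> degree g < n" "poly g b \<in> \<mm>"
    show "coeff g i \<in> \<mm>"
    proof (rule ccontr)
      assume i: "coeff g i \<notin> \<mm>"
      \<comment> \<open>Cutting g after its last coefficient outside \<mm> and dividing by that
        coefficient gives a monic polynomial of degree below n that still vanishes at the residue of
        b.\<close>
      define J where "J = {j. j \<le> degree g \<and> coeff g j \<notin> \<mm>}"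
      have "finite J" by (simp add: J_def)
      moreover have "i \<in> J" using i nonunit_0 by (auto simp: J_def intro: le_degree)
      ultimately have J: "Max J \<in> J" "\<And>j. j \<in> J \<Longrightarrow> j \<le> Max J" using Max_in by auto
      define j where "j = Max J"
      define c where "c = coeff g j"
      have cu: "c \<in> V - \<mm>" using J(1) polys_overD[OF g(1), of j] by (auto simp: J_def c_def j_def)
      then have c: "c \<in> F" "inverse c \<in> V" "c \<noteq> 0"
        using polys_overD[OF g(1), of j] unit_iff[of c] by (auto simp: c_def)
      define g' where "g' = (\<Sum>k\<le>j. monom (inverse c * coeff g k) k)"
      have icF: "inverse c \<in> V \<inter> F" using c F by (auto intro: subfield_inverse)
      have g': "g' \<in> polys_over (V \<inter> F)"
        unfolding g'_def by (intro polys_over_ring polys_over_monom VF_ring subring_mult icF polys_overD g)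
      have gj: "coeff g' j = 1" using c by (simp add: g'_def coeff_sum c_def)
      moreover have "degree g' \<le> j"
        unfolding g'_def by (intro degree_sum_le) (auto intro: order_trans[OF degree_monom_le])
      ultimately have deg: "degree g' = j" using le_degree[of g' j] by simp
      have "poly g b = (\<Sum>k\<le>degree g. coeff g k * b ^ k)" by (rule poly_altdef)
      also have "{..degree g} = {..j} \<union> {j<..degree g}" using J(1) by (auto simp: J_def j_def)
      also have "(\<Sum>k\<in>{..j} \<union> {j<..degree g}. coeff g k * b ^ k)
          = (\<Sum>k\<le>j. coeff g k * b ^ k) + (\<Sum>k\<in>{j<..degree g}. coeff g k * b ^ k)"
        by (intro sum.union_disjoint) auto
      finally have "(\<Sum>k\<le>j. coeff g k * b ^ k) = poly g b - (\<Sum>k\<in>{j<..degree g}. coeff g k * b ^ k)" by simp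
      also have "\<dots> \<in> \<mm>"
      proof (intro nonunit_diff g(3) nonunit_sum nonunit_mult(1) V_intros b)
        fix k assume "k \<in> {j<..degree g}"
        then have "k \<notin> J" "k \<le> degree g" using J(2)[of k] by (auto simp: j_def)
        then show "coeff g k \<in> \<mm>" by (simp add: J_def)
      qed
      finally have "inverse c * (\<Sum>k\<le>j. coeff g k * b ^ k) \<in> \<mm>" using c by (intro nonunit_mult(2))
      then have "poly g' b \<in> \<mm>" by (simp add: g'_def poly_sum poly_monom sum_distrib_left mult.assoc)
      then have "P j" unfolding P_def using g' gj deg by (intro bexI[of _ g']) auto
      moreover have "j < n"
      proof -
        have "g \<noteq> 0" using i nonunit_0 by auto
        then show ?thesis using g(2) J(1) by (auto simp: J_def j_def)
      qed
      ultimately show False using n(2) by fastforce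
    qed
  qed
  then show ?thesis using that[of h] h by (simp add: residue_minimal_def)
qed

lemma residually_independent_cong:
  assumes "residually_independent F b n" "b \<in> V" "w \<in> V" "w - b \<in> \<mm>"
  shows "residually_independent F w n"
  unfolding residually_independent_def
proof (intro ballI impI)
  fix g assume g: "g \<in> polys_over (V \<inter> F)" "g = 0 \<or> degree g < n" "poly g w \<in> \<mm>"
  have "poly g b - poly g w \<in> \<mm>"
    using cong_poly[OF cong_sym[OF assms(4)]] g(1) assms by (auto simp: polys_over_Int)
  then have "poly g b \<in> \<mm>" using nonunit_cong[OF g(3)] by simp
  then show "\<forall>i. coeff g i \<in> \<mm>" using assms(1) g unfolding residually_independent_def by blast
qed

text \<open>The hypothesis says that the residue of b is not purely inseparable over F. If it is
  separable, a root of h lifts to L. Otherwise its minimal polynomial is one in X^p; b^p then has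
  smaller residue degree and inherits the hypothesis.\<close>

lemma residue_separable_step:
  assumes b: "b \<in> V \<inter> L" and nb: "\<And>k a. a \<in> V \<inter> F \<Longrightarrow> b ^ (p ^ k) - a \<notin> \<mm>"
  shows has_step
proof -
  have main: "residue_minimal b h \<Longrightarrow> b \<in> V \<inter> L \<Longrightarrow> (\<And>k a. a \<in> V \<inter> F \<Longrightarrow> b ^ (p ^ k) - a \<notin> \<mm>) \<Longrightarrow> has_step" for h b
  proof (induction "degree h" arbitrary: b h rule: less_induct)
    case less
    note b = less.prems(2) and nb = less.prems(3)
    have h: "h \<in> polys_over (V \<inter> F)" "lead_coeff h = 1" "poly h b \<in> \<mm>"
      and ind: "residually_independent F b (degree h)"
      using less.prems(1) by (auto simp: residue_minimal_def)
    define n where "n = degree h"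
    have hV: "h \<in> polys_over V" and hF: "h \<in> polys_over F" using h by (auto simp: polys_over_Int)
    have n0: "n > 0"
    proof (rule Nat.gr0I)
      assume "n = 0"
      then have "h = 1" using h(2) by (metis degree_eq_zeroE lead_coeff_pCons(2) n_def one_pCons)
      then show False using h(3) one_not_nonunit by simp
    qed
    show ?case
    proof (cases "poly (pderiv h) b \<in> \<mm>")
      case False
      have "h \<in> polys_over (V \<inter> L)" using h(1) F_subset polys_over_mono[of "V \<inter> F" "V \<inter> L"] by auto
      then obtain w where w: "w \<in> V \<inter> L" "poly h w = 0" "w - b \<in> \<mm>"
        using hensel_lift[OF L K_subset_L _ h(2) b h(3) False] by blast
      have "residually_independent F w (degree h)"
        using residually_independent_cong[OF ind _ _ w(3)] b w by auto
      then have "monogenic_union F (adjoin F w)"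
        using residual_step[OF F hF h(2) w(2)] w by auto
      moreover have "w \<notin> F" using nb[of w 0] w cong_sym[OF w(3)] by auto
      ultimately show ?thesis using w by (auto simp: has_step_def)
    next
      case True
      have "pderiv h = 0 \<or> degree (pderiv h) < degree h"
        using degree_pderiv_less[of h] n0 by (simp add: n_def)
      \<comment> \<open>The derivative has degree below deg h, so independence of the powers of the
        residue makes all its coefficients vanish residually. In particular deg h vanishes in the
        residue field, which excludes p = 1.\<close>
      then have dm: "coeff (pderiv h) i \<in> \<mm>" for i
        using ind True polys_over_pderiv[OF VF_ring h(1)] unfolding residually_independent_def by blast
      have dm': "of_nat i * coeff h i \<in> \<mm>" for i
        using dm[of "i - 1"] nonunit_0 by (cases i) (auto simp: coeff_pderiv)
      have "of_nat n \<in> \<mm>" using dm'[of n] h(2) by (simp add: n_def)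
      then have pp: "prime p" "of_nat p \<in> \<mm>" and pn: "p dvd n"
        using p n0 coprime_unit[OF p, of n] prime_imp_coprime[of p n]
        by (auto simp: residue_char_exponent_def coprime_commute)
      have hm: "coeff h i \<in> \<mm>" if "\<not> p dvd i" for i
      proof -
        have "i > 0" using that by (intro Nat.gr0I) auto
        then have "of_nat i \<notin> \<mm>"
          using coprime_unit[OF p, of i] prime_imp_coprime[OF pp(1) that] by (simp add: coprime_commute)
        then show ?thesis using nonunit_prime[OF _ _ dm'[of i]] polys_overD[OF hV] V_intros(10) by blast
      qed
      define k where "k = n div p"
      have kp: "n = p * k" using pn by (simp add: k_def)
      have p0: "p > 0" using prime_gt_0_nat[OF pp(1)] .
      define g where "g = (\<Sum>i\<le>k. monom (coeff h (p * i)) i)"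
      have g: "g \<in> polys_over (V \<inter> F)"
        unfolding g_def by (intro polys_over_ring polys_over_monom VF_ring polys_overD h)
      have gk: "coeff g k = 1" using h(2) by (simp add: g_def coeff_sum kp[symmetric] n_def)
      have dg: "degree g \<le> k" unfolding g_def by (intro degree_sum_le) (auto intro: order_trans[OF degree_monom_le])
      then have dgk: "degree g = k" using gk le_degree[of g k] by simp
      have "poly h b = (\<Sum>j\<le>n. coeff h j * b ^ j)" by (simp add: poly_altdef n_def)
      also have "\<dots> = (\<Sum>j\<in>(\<lambda>i. p * i) ` {..k}. coeff h j * b ^ j) + (\<Sum>j\<in>{..n} - (\<lambda>i. p * i) ` {..k}. coeff h j * b ^ j)"
        using kp by (subst sum.subset_diff[of "(\<lambda>i. p * i) ` {..k}"]) auto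
      also have "(\<Sum>j\<in>(\<lambda>i. p * i) ` {..k}. coeff h j * b ^ j) = poly g (b ^ p)"
        using p0 by (subst sum.reindex) (auto simp: inj_on_def g_def poly_sum poly_monom power_mult)
      finally have "poly g (b ^ p) = poly h b - (\<Sum>j\<in>{..n} - (\<lambda>i. p * i) ` {..k}. coeff h j * b ^ j)" by simp
      also have "\<dots> \<in> \<mm>"
      proof (intro nonunit_diff h(3) nonunit_sum nonunit_mult(1) V_intros hm)
        fix j assume j: "j \<in> {..n} - (\<lambda>i. p * i) ` {..k}"
        show "\<not> p dvd j"
        proof
          assume "p dvd j"
          then obtain i where "j = p * i" by (elim dvdE)
          with j p0 kp show False by auto
        qed
      qed (use b in auto)
      finally have gb: "poly g (b ^ p) \<in> \<mm>" .
      have bp: "b ^ p \<in> V \<inter> L" using b by (auto intro: V_intros subring_power[OF L_ring])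
      obtain h' where h': "residue_minimal (b ^ p) h'" using residue_minimal_exists bp by blast
      have "degree h' \<le> k"
      proof (rule ccontr)
        assume "\<not> degree h' \<le> k"
        then have "coeff g k \<in> \<mm>"
          using h' g gb dgk unfolding residue_minimal_def residually_independent_def by auto
        then show False using gk one_not_nonunit by simp
      qed
      also have "k < degree h" using kp n0 prime_gt_1_nat[OF pp(1)] by (auto simp: n_def)
      finally show ?thesis
      proof (rule less.hyps[OF _ h' bp])
        fix k a assume "a \<in> V \<inter> F"
        then show "(b ^ p) ^ (p ^ k) - a \<notin> \<mm>" using nb[of a "Suc k"] by (simp add: power_mult)
      qed
    qed
  qed
  obtain h where "residue_minimal b h" using residue_minimal_exists b by blast
  then show ?thesis using main[OF _ b nb] by simp
qed

end

text \<open>Without a step the residue extension is purely inseparable and there is no tame ramification.\<close>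

locale no_galois_step = galois_step +
  assumes no_step: "\<not> has_step"
begin

lemma residue_power:
  assumes u: "u \<in> V \<inter> L"
  obtains k a where "a \<in> V \<inter> F" "u ^ (p ^ k) - a \<in> \<mm>"
proof -
  have "\<exists>k a. a \<in> V \<inter> F \<and> u ^ (p ^ k) - a \<in> \<mm>"
  proof (rule ccontr)
    assume *: "\<not> ?thesis"
    have has_step by (rule residue_separable_step[OF u]) (use * in blast)
    with no_step show False by simp
  qed
  then show thesis using that by blast
qed

text \<open>With z^l = c u, some power u^q with q = p^k is congruent to an element a of F, so u^q /
  a has a root y of order l in L by Hensel. Then z^q / y has l-th power c^q a in F, and its value is
  still outside the group of F because q is prime to l. \<open>ramified_step\<close> would apply to
  it.\<close>

lemma tame_step:
  assumes l: "prime l" "coprime l p" and z: "z \<in> L" and zl: "val_in F (z ^ l)"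
  shows "val_in F z"
proof (rule ccontr)
  assume nz: "\<not> val_in F z"
  have l0: "l > 0" using prime_gt_0_nat[OF l(1)] .
  have z0: "z \<noteq> 0" using val_in_nonzero[OF zl] l0 by auto
  obtain c where c: "c \<in> F" "c \<noteq> 0" "z ^ l / c \<in> V - \<mm>" using zl unfolding val_in_def by blast
  define u where "u = z ^ l / c"
  have uL: "u \<in> V \<inter> L"
    using c z F_subset unfolding u_def by (auto intro: subfield_divide[OF L] subring_power[OF L_ring])
  obtain k a where a: "a \<in> V \<inter> F" "u ^ (p ^ k) - a \<in> \<mm>" using residue_power[OF uL] .
  define q where "q = p ^ k"
  have uq: "u ^ q \<in> V - \<mm>" using c(3) unfolding u_def[symmetric] by (rule unit_power)
  have au: "a \<in> V - \<mm>" using unit_cong[OF uq, of a] a(2) cong_sym unfolding q_def by blast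
  then have a0: "a \<noteq> 0" "inverse a \<in> V" using unit_iff by auto
  define r where "r = u ^ q / a"
  have "r - 1 = (u ^ q - a) * inverse a" using a0 by (simp add: r_def field_simps)
  then have r1: "r - 1 \<in> \<mm>" using a nonunit_mult(1) a0 unfolding q_def by simp
  have rV: "r \<in> V" using V_cong[OF V_intros(2) r1] .
  have rL: "r \<in> L"
    unfolding r_def using uL a F_subset by (auto intro!: subfield_divide[OF L] subring_power[OF L_ring])
  define h where "h = monom 1 l - [:r:]"
  have "h \<in> polys_over (V \<inter> L)"
    unfolding h_def using rV rL
    by (intro polys_over_ring polys_over_monom polys_over_const is_subring_Int V L_ring subring_1) auto
  moreover have "lead_coeff h = 1" unfolding h_def by (rule monic_power_minus_const(2)[OF l0])
  moreover have "1 \<in> V \<inter> L" using V_intros(2) subring_1[OF L_ring] by simp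
  moreover have "poly h 1 \<in> \<mm>" using cong_sym[OF r1] by (simp add: h_def poly_monom)
  moreover have "poly (pderiv h) 1 \<notin> \<mm>"
    using coprime_unit[OF p l(2) l0] by (simp add: h_def pderiv_diff pderiv_monom poly_monom pderiv_pCons)
  ultimately obtain y where y: "y \<in> V \<inter> L" "poly h y = 0" "y - 1 \<in> \<mm>"
    using hensel_lift[OF L K_subset_L] by blast
  have yl: "y ^ l = r" using y(2) by (simp add: h_def poly_monom)
  have yu: "y \<in> V - \<mm>" using unit_cong[OF one_unit y(3)] .
  then have y0: "y \<noteq> 0" using nonunit_0 by auto
  define z1 where "z1 = z ^ q / y"
  have z10: "z1 \<noteq> 0" using z0 y0 by (simp add: z1_def)
  have z1L: "z1 \<in> L" unfolding z1_def using z y by (intro subfield_divide[OF L] subring_power[OF L_ring]) auto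
  have "z1 ^ l = (z ^ l) ^ q / r" by (simp add: z1_def power_divide yl power_mult[symmetric] mult.commute)
  also have "\<dots> = c ^ q * a" using c(2) a0 z0 by (simp add: r_def u_def power_divide)
  finally have z1l: "z1 ^ l = c ^ q * a" .
  have z1F: "z1 ^ l \<in> F" unfolding z1l using c a by (intro subfield_intros F) auto
  have "val_in F (z1 ^ l)" using val_in_self[OF z1F] z10 by simp
  moreover have "\<not> val_in F z1"
  proof
    assume "val_in F z1"
    moreover have "z ^ q / z1 \<in> V - \<mm>" using yu z0 by (simp add: z1_def)
    ultimately have "val_in F (z ^ q)" by (rule val_in_cong)
    moreover have "coprime l q" using l(2) by (simp add: q_def)
    ultimately show False using val_in_coprime_powers[OF F zl] l0 nz by blast
  qed
  moreover have "\<exists>h\<in>polys_over F. lead_coeff h = 1 \<and> degree h = l \<and> poly h (z1 ^ j) = 0" for j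
  proof -
    define h where "h = monom 1 l - [:(z1 ^ l) ^ j:]"
    have "degree h = l" "lead_coeff h = 1" unfolding h_def by (rule monic_power_minus_const[OF l0])+
    moreover have "poly h (z1 ^ j) = 0" by (simp add: h_def poly_monom power_mult[symmetric] mult.commute)
    moreover have "h \<in> polys_over F"
      unfolding h_def
      by (intro polys_over_ring polys_over_monom polys_over_const F_ring subring_1 subring_power[OF F_ring z1F])
    ultimately show ?thesis by blast
  qed
  ultimately obtain j where "z1 ^ j \<notin> F" "monogenic_union F (adjoin F (z1 ^ j))"
    using ramified_step[OF F l(1)] by blast
  then show False using no_step z1L subring_power[OF L_ring] by (auto simp: has_step_def)
qed

text \<open>The value group of L is torsion modulo that of F; \<open>tame_step\<close> strips all
  prime factors other than p from the order.\<close>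

lemma value_power:
  assumes "z \<in> L" "z \<noteq> 0"
  obtains k where "val_in F (z ^ (p ^ k))"
proof -
  have "N > 0 \<Longrightarrow> z \<in> L \<Longrightarrow> val_in F (z ^ N) \<Longrightarrow> \<exists>k. val_in F (z ^ (p ^ k))" for N z
  proof (induction N arbitrary: z rule: less_induct)
    case (less N)
    show ?case
    proof (cases "N = 1")
      case True
      then show ?thesis using less.prems by (intro exI[of _ 0]) simp
    next
      case False
      then obtain l where l: "prime l" "l dvd N" using prime_factor_nat by blast
      then obtain N' where N: "N = l * N'" by blast
      then have N': "N' < N" "N' > 0" using less.prems prime_gt_1_nat[OF l(1)] by auto
      show ?thesis
      proof (cases "l = p")
        case True
        then have "val_in F ((z ^ p) ^ N')" using less.prems N by (simp add: power_mult)
        then obtain k where "val_in F ((z ^ p) ^ (p ^ k))"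
          using less.IH[OF N', of "z ^ p"] less.prems subring_power[OF L_ring] by blast
        then show ?thesis by (intro exI[of _ "Suc k"]) (simp add: power_mult)
      next
        case False
        have "coprime l p"
          using p False l(1) primes_coprime[of l p] by (auto simp: residue_char_exponent_def)
        moreover have "val_in F ((z ^ N') ^ l)" using less.prems N by (simp add: power_mult[symmetric] mult.commute)
        ultimately have "val_in F (z ^ N')"
          using tame_step[OF l(1)] less.prems subring_power[OF L_ring] by blast
        then show ?thesis using less.IH[OF N'] less.prems by blast
      qed
    qed
  qed
  then show ?thesis using value_torsion[OF F K_subset assms(2)] assms(1) that by metis
qed

text \<open>Some p-power of e lies in F (1 + \<mm>). Nothing is said about e lying in L, so that the
  notion can be applied to approximating roots as well.\<close>

definition power_near :: "'a \<Rightarrow> bool"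
  where "power_near e \<longleftrightarrow> (\<exists>k. \<exists>c\<in>F. c \<noteq> 0 \<and> e ^ (p ^ k) / c - 1 \<in> \<mm>)"

lemma power_near_L:
  assumes e: "e \<in> L" "e \<noteq> 0"
  shows "power_near e"
proof -
  obtain k where "val_in F (e ^ (p ^ k))" using value_power[OF e] .
  then obtain c where c: "c \<in> F" "c \<noteq> 0" "e ^ (p ^ k) / c \<in> V - \<mm>" unfolding val_in_def by blast
  define u where "u = e ^ (p ^ k) / c"
  have uu: "u \<in> V - \<mm>" using c by (simp add: u_def)
  have "u \<in> V \<inter> L"
    using uu c e F_subset unfolding u_def by (auto intro!: subfield_divide[OF L] subring_power[OF L_ring])
  then obtain j a where a: "a \<in> V \<inter> F" "u ^ (p ^ j) - a \<in> \<mm>" using residue_power by blast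
  have "a \<in> V - \<mm>" using unit_cong[OF unit_power[OF uu] cong_sym[OF a(2)]] .
  then have a0: "a \<noteq> 0" "inverse a \<in> V" using unit_iff by auto
  have "e ^ (p ^ (k + j)) = (e ^ (p ^ k)) ^ (p ^ j)" by (simp add: power_add power_mult)
  then have "e ^ (p ^ (k + j)) / (c ^ (p ^ j) * a) = u ^ (p ^ j) / a" by (simp add: u_def power_divide)
  then have "e ^ (p ^ (k + j)) / (c ^ (p ^ j) * a) - 1 = (u ^ (p ^ j) - a) * inverse a"
    using a0 by (simp add: field_simps)
  also have "\<dots> \<in> \<mm>" using a a0 by (intro nonunit_mult)
  finally show ?thesis
    unfolding power_near_def using c a a0
    by (intro exI[of _ "k + j"] bexI[of _ "c ^ (p ^ j) * a"]) (auto intro: subfield_intros F)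
qed

text \<open>The p-power of e'/e is congruent to 1, because conjugation fixes the element of F that
  approximates the p-power of e. Frobenius is injective on residues.\<close>

lemma conj_near:
  assumes e: "e \<noteq> 0" "power_near e" and c: "conj_over F e e'"
  shows "e' / e - 1 \<in> \<mm>"
proof -
  obtain k d where d: "d \<in> F" "d \<noteq> 0" "e ^ (p ^ k) / d - 1 \<in> \<mm>" using e by (auto simp: power_near_def)
  have "conj_over F (inverse d * e ^ (p ^ k) - 1) (inverse d * e' ^ (p ^ k) - 1)"
    using d by (intro conj_over_translate conj_over_scale conj_over_power F c subfield_inverse subfield_intros)
  then have e': "e' ^ (p ^ k) / d - 1 \<in> \<mm>"
    using conj_nonunit[OF F K_subset _ d(3)] by (simp add: divide_inverse mult.commute)
  have "e' / e \<in> V" using conj_value[OF F K_subset c e(1)] by simp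
  moreover have eu: "inverse (e ^ (p ^ k) / d) \<in> V" using unit_cong[OF one_unit d(3)] unit_iff by blast
  moreover have "(e' / e) ^ (p ^ k) - 1 ^ (p ^ k) =
      ((e' ^ (p ^ k) / d - 1) - (e ^ (p ^ k) / d - 1)) * inverse (e ^ (p ^ k) / d)"
    using d e by (simp add: power_divide field_simps)
  moreover have "\<dots> \<in> \<mm>" using eu by (intro nonunit_mult(1) nonunit_diff e' d(3))
  ultimately show ?thesis using residue_root_unique[OF p, of "e' / e" 1 k] V_intros(2) by simp
qed

text \<open>A sum of \<open>d\<close> conjugates all congruent to \<open>e\<close> is congruent to \<open>d e\<close>, hence nonzero.\<close>

lemma mean_not_near:
  assumes A: "\<And>a. a \<in># A \<Longrightarrow> conj_over F y a" and d: "of_nat (size A) \<notin> \<mm>" and s: "sum_mset A \<in> F"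
    and e: "e = y - sum_mset A / of_nat (size A)" "power_near e"
  shows "e = 0"
proof (rule ccontr)
  assume e0: "e \<noteq> 0"
  define b where "b = sum_mset A / of_nat (size A)"
  have b: "b \<in> F" unfolding b_def by (intro subfield_divide F s subring_of_nat F_ring)
  have near: "(a - b) / e - 1 \<in> \<mm>" if "a \<in># A" for a
    using conj_near[OF e0 e(2), of "a - b"] conj_over_translate[OF F A[OF that] b] e(1) by (simp add: b_def)
  have "(\<Sum>a\<in>#B. (a - b) / e) - of_nat (size B) \<in> \<mm>" if "B \<subseteq># A" for B
    using that
  proof (induction B)
    case (add a B)
    have "B \<subseteq># A" using add.prems by (blast dest: mset_subset_eq_insertD subset_mset.less_imp_le)
    then have "((a - b) / e - 1) + ((\<Sum>a\<in>#B. (a - b) / e) - of_nat (size B)) \<in> \<mm>"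
      using add.prems near[of a] by (intro nonunit_add add.IH) (auto simp: insert_subset_eq_iff)
    then show ?case by (simp add: algebra_simps)
  qed (simp add: nonunit_0)
  moreover have "(\<Sum>a\<in>#B. (a - b) / e) = (sum_mset B - of_nat (size B) * b) / e" for B
    by (induction B) (auto simp: diff_divide_distrib add_divide_distrib algebra_simps)
  moreover have n0: "of_nat (size A) \<noteq> (0 :: 'a)" using d nonunit_0 by auto
  have "of_nat (size A) * b = sum_mset A"
    unfolding b_def times_divide_eq_right using n0 by (rule nonzero_mult_div_cancel_left)
  then have "sum_mset A - of_nat (size A) * b = 0" by (simp only: diff_self)
  ultimately have "- of_nat (size A) \<in> \<mm>" by (metis diff_0 div_0 subset_mset.order_refl)
  then show False using d nonunit_minus by fastforce
qed

end

section \<open>Subgroups of the Galois group, orbits and fixed fields\<close>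

definition comp_group :: "('a \<Rightarrow> 'a) set \<Rightarrow> ('a \<Rightarrow> 'a) monoid"
  where "comp_group H = \<lparr>carrier = H, monoid.mult = (\<circ>), one = id\<rparr>"

context simple_galois
begin

text \<open>Closure under inverses is not demanded: it follows from finiteness.\<close>

definition gal_subgroup :: "('a \<Rightarrow> 'a) set \<Rightarrow> bool"
  where "gal_subgroup H \<longleftrightarrow> H \<subseteq> gal F E \<and> id \<in> H \<and> (\<forall>\<sigma>\<in>H. \<forall>\<tau>\<in>H. \<sigma> \<circ> \<tau> \<in> H)"

definition fixed_field :: "('a \<Rightarrow> 'a) set \<Rightarrow> 'a set"
  where "fixed_field H = {x \<in> E. \<forall>\<sigma>\<in>H. \<sigma> x = x}"

lemma gal_subgroup_gal: "gal_subgroup (gal F E)"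
  by (auto simp: gal_subgroup_def gal_id gal_comp)

lemma gal_subgroupD:
  assumes "gal_subgroup H"
  shows "H \<subseteq> gal F E" "id \<in> H" "\<sigma> \<in> H \<Longrightarrow> \<tau> \<in> H \<Longrightarrow> \<sigma> \<circ> \<tau> \<in> H" "finite H"
  using assms finite_gal finite_subset by (auto simp: gal_subgroup_def)

text \<open>Left translation is injective on the finite set H, hence onto, which gives right
  inverses; the right inverse of a right inverse is the element itself.\<close>

lemma gal_subgroup_inverse:
  assumes H: "gal_subgroup H" and \<sigma>: "\<sigma> \<in> H"
  obtains \<tau> where "\<tau> \<in> H" "\<sigma> \<circ> \<tau> = id" "\<tau> \<circ> \<sigma> = id"
proof -
  have right: "\<exists>\<tau>\<in>H. \<sigma> \<circ> \<tau> = id" if \<sigma>: "\<sigma> \<in> H" for \<sigma>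
  proof -
    have "inj \<sigma>" using gal_inj gal_subgroupD(1)[OF H] \<sigma> by blast
    then have "inj_on (\<lambda>\<tau>. \<sigma> \<circ> \<tau>) H" by (auto intro!: inj_onI simp: fun_eq_iff inj_eq)
    moreover have "(\<lambda>\<tau>. \<sigma> \<circ> \<tau>) ` H \<subseteq> H" using gal_subgroupD(3)[OF H \<sigma>] by auto
    ultimately have "(\<lambda>\<tau>. \<sigma> \<circ> \<tau>) ` H = H" by (simp add: endo_inj_surj gal_subgroupD(4)[OF H])
    then show ?thesis using gal_subgroupD(2)[OF H] by (metis imageE)
  qed
  obtain \<tau> where \<tau>: "\<tau> \<in> H" "\<sigma> \<circ> \<tau> = id" using right[OF \<sigma>] by blast
  obtain \<rho> where \<rho>: "\<rho> \<in> H" "\<tau> \<circ> \<rho> = id" using right[OF \<tau>(1)] by blast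
  have "\<sigma> = \<rho>" using \<tau>(2) \<rho>(2) by (metis comp_assoc comp_id id_comp)
  then show ?thesis using that \<tau> \<rho> by blast
qed

lemma group_comp_group:
  assumes "gal_subgroup H"
  shows "group (comp_group H)"
proof (rule groupI)
  fix \<sigma> assume "\<sigma> \<in> carrier (comp_group H)"
  then obtain \<tau> where "\<tau> \<in> H" "\<tau> \<circ> \<sigma> = id" using gal_subgroup_inverse[OF assms, of \<sigma>] by (auto simp: comp_group_def)
  then show "\<exists>\<tau>\<in>carrier (comp_group H). \<tau> \<otimes>\<^bsub>comp_group H\<^esub> \<sigma> = \<one>\<^bsub>comp_group H\<^esub>"
    by (auto simp: comp_group_def)
qed (use gal_subgroupD[OF assms] in \<open>auto simp: comp_group_def comp_assoc\<close>)

lemma subgroup_comp_group: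
  assumes H: "gal_subgroup H" and N: "gal_subgroup N" "N \<subseteq> H"
  shows "subgroup N (comp_group H)"
proof (rule group.subgroupI[OF group_comp_group[OF H]])
  show "N \<subseteq> carrier (comp_group H)" "N \<noteq> {}"
    using N gal_subgroupD(2)[OF N(1)] by (auto simp: comp_group_def)
  fix \<sigma> assume \<sigma>: "\<sigma> \<in> N"
  then obtain \<tau> where \<tau>: "\<tau> \<in> N" "\<tau> \<circ> \<sigma> = id" using gal_subgroup_inverse[OF N(1) \<sigma>] by metis
  have "inv\<^bsub>comp_group H\<^esub> \<sigma> = \<tau>"
    using \<tau> \<sigma> N by (intro group.inv_equality[OF group_comp_group[OF H]]) (auto simp: comp_group_def)
  then show "inv\<^bsub>comp_group H\<^esub> \<sigma> \<in> N" using \<tau> by simp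
  fix \<rho> assume "\<rho> \<in> N"
  then show "\<sigma> \<otimes>\<^bsub>comp_group H\<^esub> \<rho> \<in> N" using gal_subgroupD(3)[OF N(1) \<sigma>] by (simp add: comp_group_def)
qed

lemma gal_subgroup_card_dvd:
  assumes H: "gal_subgroup H" and N: "gal_subgroup N" "N \<subseteq> H"
  shows "card N dvd card H"
proof -
  have "card (rcosets\<^bsub>comp_group H\<^esub> N) * card N = card H"
    using group.lagrange[OF group_comp_group[OF H] subgroup_comp_group[OF assms]]
    by (simp add: Coset.order_def comp_group_def)
  then show ?thesis by (metis dvd_triv_right)
qed

lemma gal_subgroup_sylow:
  assumes H: "gal_subgroup H" and p: "prime p" "card H = p ^ a * m"
  obtains N where "gal_subgroup N" "N \<subseteq> H" "card N = p ^ a"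
proof -
  have "\<exists>N. subgroup N (comp_group H) \<and> card N = p ^ a"
    using p gal_subgroupD(4)[OF H]
    by (intro sylow_thm[OF p(1) group_comp_group[OF H], of a m]) (auto simp: Coset.order_def comp_group_def)
  then obtain N where N: "subgroup N (comp_group H)" "card N = p ^ a" by blast
  have "gal_subgroup N" "N \<subseteq> H"
    using subgroup.subset[OF N(1)] subgroup.one_closed[OF N(1)] subgroup.m_closed[OF N(1)] gal_subgroupD(1)[OF H]
    by (auto simp: gal_subgroup_def comp_group_def)
  then show ?thesis using that N by blast
qed

context
  fixes H x
  assumes H: "gal_subgroup H" and x: "x \<in> E"
begin

definition "orb = (\<lambda>\<sigma>. \<sigma> x) ` H"
definition "stab = {\<sigma> \<in> H. \<sigma> x = x}"

lemma orb_finite: "finite orb"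
  unfolding orb_def using gal_subgroupD(4)[OF H] by simp

lemma orb_subset: "orb \<subseteq> E"
  unfolding orb_def using gal_closed[OF _ x] gal_subgroupD(1)[OF H] by blast

lemma orb_self: "x \<in> orb"
  unfolding orb_def using gal_subgroupD(2)[OF H] by (intro image_eqI[where x = id]) auto

lemma orb_conj: "y \<in> orb \<Longrightarrow> conj_over F x y"
  unfolding orb_def using gal_conj[OF _ x] gal_subgroupD(1)[OF H] by blast

lemma orb_perm:
  assumes \<sigma>: "\<sigma> \<in> H"
  shows "bij_betw \<sigma> orb orb"
proof -
  have "\<sigma> y \<in> orb" if y: "y \<in> orb" for y
  proof -
    obtain \<tau> where "\<tau> \<in> H" "y = \<tau> x" using y by (auto simp: orb_def)
    then have "\<sigma> y = (\<sigma> \<circ> \<tau>) x" "\<sigma> \<circ> \<tau> \<in> H" using gal_subgroupD(3)[OF H \<sigma>] by auto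
    then show ?thesis unfolding orb_def by blast
  qed
  moreover have "inj_on \<sigma> orb" using gal_inj gal_subgroupD(1)[OF H] \<sigma> inj_on_subset by blast
  ultimately show ?thesis using endo_inj_surj[OF orb_finite, of \<sigma>] by (auto simp: bij_betw_def)
qed

lemma gal_subgroup_stab: "gal_subgroup stab"
  using gal_subgroupD[OF H] by (auto simp: gal_subgroup_def stab_def)

lemma card_orb_stab: "card H = card orb * card stab"
proof -
  have fibre: "card {\<sigma> \<in> H. \<sigma> x = y} = card stab" if y: "y \<in> orb" for y
  proof -
    obtain \<rho> where \<rho>: "\<rho> \<in> H" "y = \<rho> x" using y by (auto simp: orb_def)
    obtain \<tau> where \<tau>: "\<tau> \<in> H" "\<rho> \<circ> \<tau> = id" "\<tau> \<circ> \<rho> = id" using gal_subgroup_inverse[OF H \<rho>(1)] .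
    have "bij_betw (\<lambda>\<sigma>. \<rho> \<circ> \<sigma>) stab {\<sigma> \<in> H. \<sigma> x = y}"
    proof (rule bij_betwI[where g = "\<lambda>\<sigma>. \<tau> \<circ> \<sigma>"])
      show "(\<lambda>\<sigma>. \<rho> \<circ> \<sigma>) \<in> stab \<rightarrow> {\<sigma> \<in> H. \<sigma> x = y}"
        using gal_subgroupD(3)[OF H \<rho>(1)] \<rho> by (auto simp: stab_def)
      have "\<tau> y = x" using \<tau>(3) \<rho>(2) by (metis comp_apply id_apply)
      then show "(\<lambda>\<sigma>. \<tau> \<circ> \<sigma>) \<in> {\<sigma> \<in> H. \<sigma> x = y} \<rightarrow> stab"
        using gal_subgroupD(3)[OF H \<tau>(1)] by (auto simp: stab_def)
      show "\<tau> \<circ> (\<rho> \<circ> \<sigma>) = \<sigma>" "\<rho> \<circ> (\<tau> \<circ> \<sigma>) = \<sigma>" for \<sigma> using \<tau> by (auto simp: comp_assoc[symmetric])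
    qed
    from bij_betw_same_card[OF this] show ?thesis by simp
  qed
  have "card H = card (\<Union>y\<in>orb. {\<sigma> \<in> H. \<sigma> x = y})"
    by (rule arg_cong[where f = card]) (auto simp: orb_def)
  also have "\<dots> = (\<Sum>y\<in>orb. card {\<sigma> \<in> H. \<sigma> x = y})"
    using gal_subgroupD(4)[OF H] by (intro card_UN_disjoint orb_finite) auto
  also have "\<dots> = card orb * card stab" using fibre by simp
  finally show ?thesis .
qed

lemma orb_sum_fixed: "\<Sum>orb \<in> fixed_field H"
  unfolding fixed_field_def
proof (intro CollectI conjI ballI)
  show "\<Sum>orb \<in> E" using orb_subset by (intro subring_sum[OF E_ring]) auto
  fix \<sigma> assume \<sigma>: "\<sigma> \<in> H"
  have "\<sigma> (\<Sum>orb) = (\<Sum>y\<in>orb. \<sigma> y)"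
    using orb_subset gal_subgroupD(1)[OF H] \<sigma> by (intro hom_on_sum[OF E_ring gal_hom]) auto
  also have "\<dots> = \<Sum>orb" by (rule sum.reindex_bij_betw[OF orb_perm[OF \<sigma>]])
  finally show "\<sigma> (\<Sum>orb) = \<Sum>orb" .
qed

text \<open>The polynomial with the orbit as its set of simple roots is defined over the fixed
  field, and any polynomial over F vanishing at x vanishes on the orbit.\<close>

lemma orb_minimal_poly:
  assumes fixed: "fixed_field H = F"
  shows "\<exists>h. minimal_poly F x h \<and> degree h = card orb"
proof -
  define h where "h = (\<Prod>y\<in>orb. [:- y, 1:])"
  have deg: "degree h = card orb"
    unfolding h_def by (subst degree_prod_eq_sum_degree) auto
  have "h \<in> polys_over F"
  proof (rule polys_overI)
    fix i
    have "coeff h i \<in> E"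
      unfolding h_def using orb_subset by (intro polys_overD polys_over_ring polys_over_linear E_ring) auto
    moreover have "\<sigma> (coeff h i) = coeff h i" if "\<sigma> \<in> H" for \<sigma>
      unfolding h_def using that gal_subgroupD(1)[OF H]
      by (intro hom_fixes_root_product[OF E_ring gal_hom] orb_finite orb_subset orb_perm) auto
    ultimately show "coeff h i \<in> F" using fixed by (auto simp: fixed_field_def)
  qed
  moreover have "lead_coeff h = 1" by (simp add: h_def lead_coeff_prod)
  moreover have "poly h x = 0" using orb_self orb_finite by (auto simp: h_def poly_prod)
  moreover have "q = 0 \<or> degree h \<le> degree q" if q: "q \<in> polys_over F" "poly q x = 0" for q
  proof (cases "q = 0")
    case False
    have "orb \<subseteq> {y. poly q y = 0}" using orb_conj q by (auto simp: conj_over_def)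
    then have "card orb \<le> card {y. poly q y = 0}" by (rule card_mono[OF poly_roots_finite[OF False]])
    also have "\<dots> \<le> degree q" by (rule card_poly_roots_bound[OF False])
    finally show ?thesis using deg by simp
  qed simp
  ultimately show ?thesis using deg unfolding minimal_poly_def by blast
qed

end

lemma fixed_field_ring: "gal_subgroup H \<Longrightarrow> is_subring (fixed_field H)"
  and fixed_field_contains: "gal_subgroup H \<Longrightarrow> F \<subseteq> fixed_field H"
proof -
  assume H: "gal_subgroup H"
  then have G: "\<sigma> \<in> gal F E" if "\<sigma> \<in> H" for \<sigma> using that gal_subgroupD(1) by blast
  show "is_subring (fixed_field H)"
    unfolding is_subring_iff
  proof (intro conjI ballI)
    show "1 \<in> fixed_field H"
      using hom_on_1[OF E_ring gal_hom[OF G]] subring_1[OF E_ring] by (simp add: fixed_field_def)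
    fix x y assume x: "x \<in> fixed_field H" and y: "y \<in> fixed_field H"
    then have E: "x \<in> E" "y \<in> E" by (auto simp: fixed_field_def)
    have "\<sigma> (x - y) = x - y" "\<sigma> (x * y) = x * y" if \<sigma>: "\<sigma> \<in> H" for \<sigma>
      using hom_on_diff[OF E_ring gal_hom[OF G[OF \<sigma>]] E] hom_on_mult[OF E_ring gal_hom[OF G[OF \<sigma>]] E] x y \<sigma>
      by (auto simp: fixed_field_def)
    then show "x - y \<in> fixed_field H" "x * y \<in> fixed_field H"
      using subring_diff[OF E_ring E] subring_mult[OF E_ring E] by (auto simp: fixed_field_def)
  qed
  show "F \<subseteq> fixed_field H" using F_subset gal_fix[OF G] by (auto simp: fixed_field_def)
qed

end

text \<open>Up to sign the constant coefficient is the product of the conjugates of y, which all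
  have the value of y.\<close>

lemma (in henselian_closure) minimal_poly_value:
  assumes F: "is_subfield F" "K \<subseteq> F" and m: "minimal_poly F y m" and y: "y \<noteq> 0"
  shows "val_in F (y ^ degree m)"
proof -
  obtain A where A: "size A = degree m" "m = (\<Prod>a\<in>#A. [:- a, 1:])" "\<And>a. a \<in># A \<Longrightarrow> conj_over F y a"
    using minimal_poly_splits[OF F(1) m] by metis
  have unit: "a / y \<in> V - \<mm>" if "a \<in># A" for a
    by (rule conj_value[OF F A(3)[OF that] y])
  have prod: "(\<Prod>a\<in>#B. - a) / y ^ size B \<in> V - \<mm>" if "set_mset B \<subseteq> set_mset A" for B
    using that
  proof (induction B)
    case empty
    show ?case using one_unit by simp
  next
    case (add a B)
    have "- (a / y) \<in> V - \<mm>"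
      using unit[of a] add.prems nonunit_minus[of "- (a / y)"] V_intros(5)[of "a / y"] by auto
    then have "- (a / y) * ((\<Prod>a\<in>#B. - a) / y ^ size B) \<in> V - \<mm>"
      using add by (intro unit_mult) auto
    then show ?case by simp
  qed
  have c: "coeff m 0 = (\<Prod>a\<in>#A. - a)"
    unfolding poly_0_coeff_0[symmetric] A(2) by (simp add: poly_prod_mset)
  have u: "coeff m 0 / y ^ degree m \<in> V - \<mm>" using prod[of A] A(1) c by simp
  then have "coeff m 0 \<noteq> 0" using nonunit_0 by auto
  moreover have "y ^ degree m / coeff m 0 \<in> V - \<mm>" using unit_inverse[OF u] by simp
  ultimately show ?thesis using polys_overD[OF minimal_polyD(1)[OF m]] by (intro val_inI[of "coeff m 0"])
qed

section \<open>Reduction to degree p, and the defect case\<close>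

context no_galois_step
begin

text \<open>The mean of the orbit exists and lies in F; by \<open>mean_not_near\<close> the
  difference of x and this mean is zero.\<close>

lemma orbit_prime_to_p:
  assumes H: "gal_subgroup H" "fixed_field H = F" and x: "x \<in> L" and card: "of_nat (card (orb H x)) \<notin> \<mm>"
  shows "x \<in> F"
proof -
  define A where "A = mset_set (orb H x)"
  have A: "size A = card (orb H x)" "sum_mset A = \<Sum>(orb H x)"
    by (simp_all add: A_def sum_unfold_sum_mset)
  define e where "e = x - sum_mset A / of_nat (size A)"
  have s: "sum_mset A \<in> F" using orb_sum_fixed[OF H(1) x] H(2) A by simp
  then have b: "sum_mset A / of_nat (size A) \<in> F" by (intro subfield_divide F subring_of_nat F_ring)
  have "e \<in> L" unfolding e_def using x b F_subset by (intro subring_diff[OF L_ring]) auto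
  have "e = 0"
  proof (rule ccontr)
    assume "e \<noteq> 0"
    then have "power_near e" using power_near_L \<open>e \<in> L\<close> by blast
    moreover have "conj_over F x a" if "a \<in># A" for a
      using that orb_conj[OF H(1) x] orb_finite[OF H(1) x] by (simp add: A_def)
    ultimately have "e = 0" using mean_not_near[of A x e] card A s e_def by simp
    with \<open>e \<noteq> 0\<close> show False by simp
  qed
  then show ?thesis using b by (simp add: e_def)
qed

text \<open>A subgroup \<open>H\<close> of minimal order with fixed field \<open>F\<close> is a \<open>p\<close>-group, since a Sylow subgroup
  has the same fixed field.\<close>

lemma degree_p_extension:
  assumes FL: "F \<noteq> L"
  obtains x where "prime p" "x \<in> L" "x \<notin> F"
    "\<And>y. y \<in> adjoin F x \<Longrightarrow> y \<notin> F \<Longrightarrow> \<exists>h. minimal_poly F y h \<and> degree h = p"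
proof -
  define P where "P n \<longleftrightarrow> (\<exists>H. gal_subgroup H \<and> fixed_field H = F \<and> card H = n)" for n
  have "fixed_field (gal F L) = F"
    using gal_fixed fixed_field_contains[OF gal_subgroup_gal] by (auto simp: fixed_field_def)
  then have "P (card (gal F L))" using gal_subgroup_gal by (auto simp: P_def)
  then obtain n where n: "P n" "\<And>k. P k \<Longrightarrow> n \<le> k" using exists_least_iff[of P] by (metis not_le_imp_less)
  then obtain H where H: "gal_subgroup H" "fixed_field H = F" "card H = n" by (auto simp: P_def)
  have n0: "n > 0" using H gal_subgroupD(2,4)[OF H(1)] card_gt_0_iff by blast
  have id_fixed: "fixed_field {id} = L" by (auto simp: fixed_field_def)
  have pp: "prime p"
  proof (rule ccontr)
    assume "\<not> prime p"
    then have "\<forall>n>0. of_nat n \<notin> \<mm>" using p by (auto simp: residue_char_exponent_def)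
    moreover have "card (orb H x) > 0" if "x \<in> L" for x
      using orb_self[OF H(1) that] orb_finite[OF H(1) that] card_gt_0_iff by blast
    ultimately have "L \<subseteq> F" using orbit_prime_to_p[OF H(1,2)] by blast
    then show False using FL F_subset by blast
  qed
  obtain a m where am: "n = p ^ a * m" "\<not> p dvd m"
    using n0 multiplicity_decompose'[of n p] prime_gt_1_nat[OF pp] by (metis neq0_conv not_prime_unit pp)
  obtain S where S: "gal_subgroup S" "S \<subseteq> H" "card S = p ^ a"
    using gal_subgroup_sylow[OF H(1) pp, of a m] H(3) am(1) by blast
  \<comment> \<open>The stabiliser of an element fixed by the Sylow subgroup has order divisible by
    p^a, so the orbit has order prime to p and the element lies in F.\<close>
  have "fixed_field S \<subseteq> F"
  proof
    fix x assume x: "x \<in> fixed_field S"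
    then have xL: "x \<in> L" by (simp add: fixed_field_def)
    have "S \<subseteq> stab H x" using x S(2) by (auto simp: fixed_field_def stab_def[OF H(1) xL])
    then have "p ^ a dvd card (stab H x)"
      using gal_subgroup_card_dvd[OF gal_subgroup_stab[OF H(1) xL] S(1)] S(3) by simp
    then have "card (orb H x) * p ^ a dvd p ^ a * m"
      using card_orb_stab[OF H(1) xL] H(3) am by (metis dvd_refl mult_dvd_mono)
    then have "card (orb H x) dvd m" using pp prime_gt_0_nat by (simp add: mult.commute)
    then have "\<not> p dvd card (orb H x)" using am(2) dvd_trans by blast
    then have "coprime (card (orb H x)) p" using prime_imp_coprime[OF pp] coprime_commute by blast
    moreover have "card (orb H x) > 0"
      using orb_self[OF H(1) xL] orb_finite[OF H(1) xL] card_gt_0_iff by blast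
    ultimately show "x \<in> F" using orbit_prime_to_p[OF H(1,2) xL] coprime_unit[OF p] by blast
  qed
  then have "P (p ^ a)" using S fixed_field_contains[OF S(1)] unfolding P_def by blast
  then have "n \<le> p ^ a" by (rule n(2))
  then have na: "n = p ^ a"
    using card_mono[OF gal_subgroupD(4)[OF H(1)] S(2)] S(3) H(3) by simp
  have "a > 0"
  proof (rule Nat.gr0I)
    assume "a = 0"
    then have "card H = 1" using na H by simp
    then have "H = {id}" using gal_subgroupD(2)[OF H(1)] by (metis card_1_singletonE singletonD)
    then show False using H(2) id_fixed FL by simp
  qed
  then obtain a' where a': "a = Suc a'" by (cases a) auto
  \<comment> \<open>A subgroup of index p has a fixed field larger than F, by minimality of the
    order of H, and the orbits of its fixed elements under H have order dividing p.\<close>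
  obtain N where N: "gal_subgroup N" "N \<subseteq> H" "card N = p ^ a'"
    using gal_subgroup_sylow[OF H(1) pp, of a' p] H(3) na a' by (auto simp: mult.commute)
  have "\<not> P (p ^ a')"
    using n(2)[of "p ^ a'"] na a' prime_gt_1_nat[OF pp] prime_gt_0_nat[OF pp] by auto
  then have "fixed_field N \<noteq> F" using N by (auto simp: P_def)
  then obtain x where x: "x \<in> fixed_field N" "x \<notin> F" using fixed_field_contains[OF N(1)] by blast
  have adj: "adjoin F x \<subseteq> fixed_field N"
    using adjoin_subset[OF fixed_field_ring[OF N(1)] fixed_field_contains[OF N(1)] x(1)] .
  have "\<exists>h. minimal_poly F y h \<and> degree h = p" if y: "y \<in> adjoin F x" "y \<notin> F" for y
  proof -
    have yN: "y \<in> fixed_field N" using adj y by blast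
    then have yL: "y \<in> L" by (simp add: fixed_field_def)
    have "N \<subseteq> stab H y" using yN N(2) by (auto simp: fixed_field_def stab_def[OF H(1) yL])
    then have "p ^ a' dvd card (stab H y)"
      using gal_subgroup_card_dvd[OF gal_subgroup_stab[OF H(1) yL] N(1)] N(3) by simp
    then have "card (orb H y) * p ^ a' dvd p ^ a"
      using card_orb_stab[OF H(1) yL] H(3) na by (metis dvd_refl mult_dvd_mono)
    then have "card (orb H y) dvd p" using prime_gt_0_nat[OF pp] by (simp add: a')
    then have "card (orb H y) = 1 \<or> card (orb H y) = p" using pp by (simp add: prime_nat_iff)
    moreover obtain h where h: "minimal_poly F y h" "degree h = card (orb H y)"
      using orb_minimal_poly[OF H(1) yL H(2)] by blast
    moreover have "degree h \<noteq> 1" using minimal_poly_degree_1[OF F h(1)] y(2) by blast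
    ultimately show ?thesis by auto
  qed
  then show ?thesis using that pp x by (auto simp: fixed_field_def)
qed

text \<open>With no best approximation of \<open>x\<close> in \<open>F\<close>, an element \<open>y\<close> of degree less than \<open>p\<close> cannot
  approximate \<open>x\<close> better than all of \<open>F\<close>: otherwise the mean \<open>b\<close> of its conjugates would satisfy
  \<open>y - b \<sim> x - b\<close>.\<close>

lemma approximate_root:
  assumes x: "x \<in> L" "x \<notin> F" and g: "g \<in> polys_over F" "g \<noteq> 0" "poly g y = 0"
    and g': "\<And>n. 0 < n \<Longrightarrow> n \<le> degree g \<Longrightarrow> of_nat n \<notin> \<mm>"
  obtains b where "b \<in> F" "(x - b) / (x - y) \<in> V"
proof -
  obtain h where h: "minimal_poly F y h" using minimal_poly_exists[OF F alg_F] .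
  have dh: "degree h \<le> degree g" using h g unfolding minimal_poly_def by blast
  obtain A where A: "size A = degree h" "h = (\<Prod>a\<in>#A. [:- a, 1:])"
    and conj: "\<And>a. a \<in># A \<Longrightarrow> conj_over F y a"
    using minimal_poly_splits[OF F h] by metis
  have monic: "degree (\<Prod>a\<in>#B. [:- a, 1:]) = size B \<and> coeff (\<Prod>a\<in>#B. [:- a, 1:]) (size B) = 1" for B :: "'a multiset"
  proof (induction B)
    case (add a B)
    then have "(\<Prod>a\<in>#B. [:- a, 1:]) \<noteq> 0" by auto
    then have "degree ([:- a, 1:] * (\<Prod>a\<in>#B. [:- a, 1:])) = Suc (size B)"
      using add by (subst degree_mult_eq) auto
    moreover have "lead_coeff ([:- a, 1:] * (\<Prod>a\<in>#B. [:- a, 1:])) = 1"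
      using add unfolding lead_coeff_mult by simp
    ultimately show ?case by (simp del: mult_pCons_left)
  qed simp
  \<comment> \<open>The sum of the conjugates is, up to sign, a coefficient of the minimal
    polynomial, so their mean lies in F.\<close>
  have vieta: "B \<noteq> {#} \<Longrightarrow> coeff (\<Prod>a\<in>#B. [:- a, 1:]) (size B - 1) = - sum_mset B" for B :: "'a multiset"
  proof (induction B)
    case (add a B)
    show ?case
    proof (cases "B = {#}")
      case False
      then obtain k where "size B = Suc k" by (cases "size B") auto
      then show ?thesis using add.IH[OF False] monic[of B] by simp
    qed simp
  qed simp
  have n0: "size A > 0" using A(1) minimal_poly_degree_pos[OF h] by simp
  have nm: "of_nat (size A) \<notin> \<mm>" using g'[of "size A"] n0 A(1) dh by simp
  have "A \<noteq> {#}" using n0 by auto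
  then have "sum_mset A = - coeff h (size A - 1)" unfolding A(2) using vieta[of A] by simp
  then have s: "sum_mset A \<in> F" using polys_overD[OF minimal_polyD(1)[OF h]] subring_minus[OF F_ring] by simp
  define b where "b = sum_mset A / of_nat (size A)"
  have b: "b \<in> F" unfolding b_def by (intro subfield_divide F s subring_of_nat F_ring)
  have "(x - b) / (x - y) \<in> V"
  proof (rule ccontr)
    assume "(x - b) / (x - y) \<notin> V"
    then have small: "(x - y) / (x - b) \<in> \<mm>" using divide_cases by blast
    have xb: "x - b \<noteq> 0" "x - b \<in> L" using x b F_subset by (auto intro: subring_diff[OF L_ring])
    obtain k c where c: "c \<in> F" "c \<noteq> 0" "(x - b) ^ (p ^ k) / c - 1 \<in> \<mm>"
      using power_near_L[OF xb(2,1)] by (auto simp: power_near_def)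
    \<comment> \<open>As x - y is negligible against x - b, the elements y - b and x - b differ by a
      factor in 1 + \<mm>. This carries \<open>power_near\<close> from x - b, an element of L, to y
      - b, which need not lie in L.\<close>
    have r: "(y - b) / (x - b) - 1 \<in> \<mm>"
    proof -
      have "(y - b) / (x - b) - 1 = - ((x - y) / (x - b))" using xb by (simp add: field_simps)
      then show ?thesis using nonunit_minus[OF small] by simp
    qed
    have rV: "(y - b) / (x - b) \<in> V" using V_cong[OF V_intros(2) r] .
    have "((y - b) / (x - b)) ^ (p ^ k) - 1 ^ (p ^ k) \<in> \<mm>" by (rule cong_power[OF r rV V_intros(2)])
    then have "((y - b) / (x - b)) ^ (p ^ k) * ((x - b) ^ (p ^ k) / c) - 1 * 1 \<in> \<mm>"
      using c(3) rV by (intro cong_mult V_intros) auto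
    then have "(y - b) ^ (p ^ k) / c - 1 \<in> \<mm>" using xb by (simp add: power_divide)
    then have "power_near (y - b)" unfolding power_near_def using c by blast
    then have "y - b = 0" using mean_not_near[OF conj nm s] by (simp add: b_def)
    then show False using r one_not_nonunit nonunit_minus[of "-1"] by simp
  qed
  then show ?thesis using that b by blast
qed

text \<open>Let g have degree below p and g(x) in \<open>V\<close>. Once a in F is closer to x than
  all roots r of g, each a - r has the value of x - r. Expanding g around a then gives the constant
  g(a), of the same value as g(x), times factors 1 + ((b - a)/(a - r)) X with coefficients in
  \<open>V\<close>.\<close>

lemma defect_step:
  assumes x: "x \<in> L" "x \<notin> F" and h: "minimal_poly F x h" "degree h = p" and pp: "prime p"
    and better: "\<And>a. a \<in> F \<Longrightarrow> \<exists>a'\<in>F. (x - a') / (x - a) \<in> \<mm>"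
  shows "monogenic_union F (adjoin F x)"
  unfolding monogenic_union_def
proof (intro allI impI)
  fix S assume S: "finite S" "S \<subseteq> V \<inter> adjoin F x"
  have xa: "x - a \<noteq> 0" if "a \<in> F" for a using that x by auto
  have "\<exists>g. g \<in> polys_over F \<and> y = poly g x \<and> (g = 0 \<or> degree g < p)" if y: "y \<in> S" for y
  proof -
    obtain g where "g \<in> polys_over F" "y = poly g x" "g = 0 \<or> degree g < degree h"
      using adjoin_reduced[OF F_ring minimal_polyD(1,2,4)[OF h(1)], of y] y S by blast
    then show ?thesis using h by blast
  qed
  then obtain g where g: "\<And>y. y \<in> S \<Longrightarrow> g y \<in> polys_over F" "\<And>y. y \<in> S \<Longrightarrow> y = poly (g y) x"
      "\<And>y. y \<in> S \<Longrightarrow> g y = 0 \<or> degree (g y) < p" by metis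
  define Y where "Y = (\<Union>y\<in>{y \<in> S. g y \<noteq> 0}. {r. poly (g y) r = 0})"
  have finY: "finite Y" unfolding Y_def using S by (auto intro: poly_roots_finite)
  have xr: "x \<noteq> r" and "\<exists>b\<in>F. (x - b) / (x - r) \<in> V" if r: "r \<in> Y" for r
  proof -
    obtain y where y: "y \<in> S" "g y \<noteq> 0" "poly (g y) r = 0" using r by (auto simp: Y_def)
    have d: "degree (g y) < p" using g(3)[OF y(1)] y by simp
    show "x \<noteq> r" using minimal_polyD(5)[OF h(1) g(1)[OF y(1)]] y d h(2) by blast
    have "of_nat n \<notin> \<mm>" if "0 < n" "n \<le> degree (g y)" for n
    proof -
      have "\<not> p dvd n" using that d nat_dvd_not_less[of n p] by simp
      then show ?thesis using coprime_unit[OF p _ that(1)] prime_imp_coprime[OF pp] coprime_commute by blast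
    qed
    then show "\<exists>b\<in>F. (x - b) / (x - r) \<in> V"
      using approximate_root[OF x g(1)[OF y(1)] y(2,3)] by blast
  qed
  then obtain B where B: "\<And>r. r \<in> Y \<Longrightarrow> B r \<in> F" "\<And>r. r \<in> Y \<Longrightarrow> (x - B r) / (x - r) \<in> V" by metis
  obtain b0 where b0: "b0 \<in> F" "\<And>r. r \<in> Y \<Longrightarrow> (x - b0) / (x - r) \<in> V"
  proof (cases "Y = {}")
    case True
    then show ?thesis using that[of 0] subring_0[OF F_ring] by auto
  next
    case False
    \<comment> \<open>\<open>dominant_element\<close> finds least values; applied to inverses it
      selects the \<open>B r\<close> closest to x.\<close>
    obtain r where r: "r \<in> Y" "\<And>s. s \<in> Y \<Longrightarrow> inverse (x - B s) / inverse (x - B r) \<in> V"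
      using dominant_element[OF finY False, of "\<lambda>r. inverse (x - B r)"] xa B(1)
      by (metis inverse_nonzero_iff_nonzero)
    have "(x - B r) / (x - s) \<in> V" if s: "s \<in> Y" for s
    proof -
      have "(inverse (x - B s) / inverse (x - B r)) * ((x - B s) / (x - s)) \<in> V"
        by (intro V_intros r B s)
      moreover have cancel: "inverse c / inverse d * (c / t) = d / t" if "c \<noteq> 0" for c d t :: 'a
        using that by (simp add: field_simps)
      ultimately show ?thesis unfolding cancel[OF xa[OF B(1)[OF s]]] by simp
    qed
    then show ?thesis using that[of "B r"] B r by blast
  qed
  \<comment> \<open>Two strict improvements over b0 are made: b - a then has the value of x - b, and
    both a and b are closer to x than every root in Y.\<close>
  obtain b where b: "b \<in> F" "(x - b) / (x - b0) \<in> \<mm>" using better[OF b0(1)] by blast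
  obtain a where a: "a \<in> F" "(x - a) / (x - b) \<in> \<mm>" using better[OF b(1)] by blast
  have nz: "x - a \<noteq> 0" "x - b \<noteq> 0" "x - b0 \<noteq> 0" using xa a b b0 by auto
  have "(b - a) / (x - b) = (x - a) / (x - b) - 1" using nz by (simp add: field_simps)
  moreover have "- 1 + (x - a) / (x - b) \<in> V - \<mm>"
    using a(2) one_unit V_intros(5)[OF V_intros(2)] nonunit_minus[of "-1"] by (intro unit_add_nonunit) auto
  ultimately have bau: "(b - a) / (x - b) \<in> V - \<mm>" by simp
  then have ba: "b - a \<noteq> 0" using nonunit_0 by auto
  define w where "w = (x - a) / (b - a)"
  have "w = ((x - a) / (x - b)) * ((x - b) / (b - a))" using nz by (simp add: w_def)
  moreover have "(x - b) / (b - a) \<in> V" using unit_inverse[OF bau] by simp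
  then have "((x - a) / (x - b)) * ((x - b) / (b - a)) \<in> \<mm>" by (rule nonunit_mult(1)[OF a(2)])
  ultimately have wV: "w \<in> V" using nonunit_in by (simp only:)
  note FX = is_subring_adjoin[OF F_ring, of x]
  have "inverse (b - a) \<in> F" using a b by (intro subfield_inverse F subring_diff F_ring)
  then have "(x - a) * inverse (b - a) \<in> adjoin F x"
    using a adjoin_contains[OF F_ring, of x] adjoin_generator[OF F_ring, of x]
    by (intro subring_mult[OF FX] subring_diff[OF FX]) auto
  then have wF: "w \<in> adjoin F x" by (simp add: w_def divide_inverse)
  have "S \<subseteq> adjoin (V \<inter> F) w"
  proof
    fix y assume y: "y \<in> S"
    define q where "q = pcompose (g y) [:a, b - a:]"
    have "[:a, b - a:] \<in> polys_over F"
      using a b by (intro polys_over_pCons polys_over_ring F_ring subring_diff)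
    then have qF: "q \<in> polys_over F" unfolding q_def by (intro polys_over_pcompose F_ring g(1)[OF y])
    have "a + w * (b - a) = x" using ba by (simp add: w_def)
    then have qw: "poly q w = y" using g(2)[OF y] by (simp add: q_def poly_pcompose mult.commute)
    have "q \<in> polys_over V"
    proof (cases "g y = 0")
      case True
      then show ?thesis by (simp add: q_def polys_over_ring(1)[OF V])
    next
      case False
      define c where "c = lead_coeff (g y)"
      obtain A where A: "g y = smult c (\<Prod>r\<in>#A. [:- r, 1:])"
        using alg_closed_imp_factorization[OF False] by (auto simp: c_def)
      have AY: "r \<in> Y" if "r \<in># A" for r
      proof -
        have "poly (g y) r = 0" using that by (subst A) (auto simp: poly_prod_mset)
        then show ?thesis using y False by (auto simp: Y_def)
      qed
      have unit: "(a - r) / (x - r) \<in> V - \<mm>" if r: "r \<in> Y" for r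
      proof -
        have "(x - a) / (x - r) = ((x - a) / (x - b)) * (((x - b) / (x - b0)) * ((x - b0) / (x - r)))"
          using nz by simp
        also have "\<dots> \<in> \<mm>" using a(2) b(2) b0(2)[OF r] by (intro nonunit_mult(1)[OF a(2)] V_intros) (auto intro: nonunit_in)
        finally have "1 + - ((x - a) / (x - r)) \<in> V - \<mm>" by (intro unit_add_nonunit one_unit nonunit_minus)
        moreover have "(a - r) / (x - r) = 1 + - ((x - a) / (x - r))" using xr[OF r] by (simp add: field_simps)
        ultimately show ?thesis by (simp only:)
      qed
      have lin: "(b - a) / (a - r) \<in> V" "a - r \<noteq> 0" if r: "r \<in> Y" for r
      proof -
        show ar: "a - r \<noteq> 0" using unit[OF r] nonunit_0 by auto
        have xar: "(x - r) / (a - r) \<in> V" using unit_inverse[OF unit[OF r]] by simp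
        have eq: "(b - a) / (a - r) = ((b - a) / (x - b)) * (((x - b) / (x - b0)) * ((x - b0) / (x - r))) * ((x - r) / (a - r))"
          using nz xr[OF r] by simp
        show "(b - a) / (a - r) \<in> V"
          unfolding eq using bau by (intro V_intros(4) xar nonunit_in[OF b(2)] b0(2)[OF r]) simp
      qed
      have pc: "pcompose (\<Prod>r\<in>#C. [:- r, 1:]) [:a, b - a:]
          = smult (\<Prod>r\<in>#C. a - r) (\<Prod>r\<in>#C. [:1, (b - a) / (a - r):])" if "set_mset C \<subseteq> Y" for C
        using that
      proof (induction C)
        case (add r C)
        have e: "pcompose [:- r, 1:] [:a, b - a:] = smult (a - r) [:1, (b - a) / (a - r):]"
          using lin(2)[of r] add.prems by (simp add: pcompose_pCons)
        have IH: "pcompose (\<Prod>r\<in>#C. [:- r, 1:]) [:a, b - a:]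
            = smult (\<Prod>r\<in>#C. a - r) (\<Prod>r\<in>#C. [:1, (b - a) / (a - r):])"
          using add by simp
        show ?case
          unfolding image_mset_add_mset prod_mset.add_mset pcompose_mult e IH
          by (simp only: mult_smult_left mult_smult_right smult_smult mult.commute)
      qed (simp add: one_pCons pcompose_pCons)
      have "set_mset A \<subseteq> Y" using AY by blast
      from pc[OF this] have "q = smult (c * (\<Prod>r\<in>#A. a - r)) (\<Prod>r\<in>#A. [:1, (b - a) / (a - r):])"
        unfolding q_def A by (simp add: pcompose_smult)
      \<comment> \<open>Since (a - r)/(x - r) is a unit for every root r, this constant is a unit
        times y.\<close>
      moreover have "c * (\<Prod>r\<in>#A. a - r) \<in> V"
      proof -
        have f: "(\<Prod>r\<in>#C. a - r) = (\<Prod>r\<in>#C. x - r) * (\<Prod>r\<in>#C. (a - r) / (x - r))" if "set_mset C \<subseteq> Y" for C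
          using that
        proof (induction C)
          case (add r C)
          then show ?case using xr[of r] by (simp add: field_simps)
        qed simp
        have AY': "set_mset A \<subseteq> Y" using AY by blast
        have yA: "y = c * (\<Prod>r\<in>#A. x - r)"
          using g(2)[OF y] unfolding A by (simp add: poly_prod_mset)
        have v: "(\<Prod>r\<in>#C. (a - r) / (x - r)) \<in> V" if "set_mset C \<subseteq> Y" for C
          using that
        proof (induction C)
          case (add r C)
          then have "(a - r) / (x - r) * (\<Prod>r\<in>#C. (a - r) / (x - r)) \<in> V"
            using unit[of r] by (intro V_intros) auto
          then show ?case by simp
        qed (simp add: V_intros)
        have "c * (\<Prod>r\<in>#A. a - r) = y * (\<Prod>r\<in>#A. (a - r) / (x - r))"
          unfolding f[OF AY'] yA by (simp only: mult.assoc)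
        then show ?thesis using V_intros(4)[OF _ v[OF AY']] S y by auto
      qed
      moreover have "(\<Prod>r\<in>#A. [:1, (b - a) / (a - r):]) \<in> polys_over V"
        using lin(1) AY by (intro polys_over_prod_mset polys_over_pCons polys_over_ring V V_intros) auto
      ultimately show ?thesis by (simp add: polys_over_smult[OF V])
    qed
    then have "q \<in> polys_over (V \<inter> F)" using qF by (simp add: polys_over_Int)
    then show "y \<in> adjoin (V \<inter> F) w" using adjoinI qw by blast
  qed
  then show "\<exists>w\<in>V \<inter> adjoin F x. S \<subseteq> adjoin (V \<inter> F) w" using wV wF by blast
qed

text \<open>By \<open>defect_step\<close>, x has a best approximation a0 in F; let z = x - a0. If z
  has a value outside the group of F, F(x)/F is ramified of degree p. If not, z = c u with a unit u.
  Residue degree p of u gives a residual step. Smaller residue degree is separable, so a root w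
  lifts; it has degree below p, lies in F, and a0 + c w approximates x better than a0.\<close>

lemma no_step_imp_eq: "F = L"
proof (rule ccontr)
  assume "F \<noteq> L"
  then obtain x where pp: "prime p" and x: "x \<in> L" "x \<notin> F"
    and deg: "\<And>y. y \<in> adjoin F x \<Longrightarrow> y \<notin> F \<Longrightarrow> \<exists>h. minimal_poly F y h \<and> degree h = p"
    using degree_p_extension by blast
  note FX = is_subring_adjoin[OF F_ring, of x]
  have sub: "F \<subseteq> adjoin F x" "x \<in> adjoin F x" using adjoin_contains[OF F_ring] adjoin_generator[OF F_ring] by auto
  have FXL: "adjoin F x \<subseteq> L" using adjoin_subset[OF L_ring F_subset x(1)] .
  have none: "\<not> monogenic_union F (adjoin F w)" if "w \<in> L" "w \<notin> F" for w
    using no_step that by (auto simp: has_step_def)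
  obtain h where h: "minimal_poly F x h" "degree h = p" using deg sub x by blast
  obtain a0 where a0: "a0 \<in> F" and best: "\<And>a. a \<in> F \<Longrightarrow> (x - a) / (x - a0) \<notin> \<mm>"
    using defect_step[OF x h pp] none[OF x] by blast
  define z where "z = x - a0"
  have zX: "z \<in> adjoin F x" unfolding z_def using sub a0 by (intro subring_diff[OF FX]) auto
  have zL: "z \<in> L" using zX FXL by auto
  have z0: "z \<noteq> 0" using a0 x by (auto simp: z_def)
  have zF: "z \<notin> F" using subring_add[OF F_ring _ a0, of z] x by (auto simp: z_def)
  show False
  proof (cases "val_in F z")
    case False
    obtain hz where hz: "minimal_poly F z hz" "degree hz = p" using deg zX zF by blast
    have zp: "val_in F (z ^ p)" using minimal_poly_value[OF F K_subset hz(1) z0] hz(2) by simp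
    have "\<exists>h\<in>polys_over F. lead_coeff h = 1 \<and> degree h = p \<and> poly h (z ^ j) = 0" if j: "\<not> p dvd j" for j
    proof -
      have "coprime p j" using prime_imp_coprime[OF pp j] .
      then have "\<not> val_in F (z ^ j)"
        using val_in_coprime_powers[OF F zp, of j] False prime_gt_0_nat[OF pp] by blast
      then have "z ^ j \<notin> F" using val_in_self z0 by (metis power_not_zero)
      then show ?thesis using deg[OF subring_power[OF FX zX]] minimal_polyD by blast
    qed
    then obtain j where "z ^ j \<notin> F" "monogenic_union F (adjoin F (z ^ j))"
      using ramified_step[OF F pp zp False] by blast
    then show False using none subring_power[OF L_ring zL] by blast
  next
    case True
    then obtain c where c: "c \<in> F" "c \<noteq> 0" "z / c \<in> V - \<mm>" unfolding val_in_def by blast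
    define u where "u = z / c"
    have uu: "u \<in> V - \<mm>" using c by (simp add: u_def)
    have uX: "u \<in> adjoin F x"
      unfolding u_def divide_inverse using zX subfield_inverse[OF F c(1)] sub by (intro subring_mult[OF FX]) auto
    have zu: "z = c * u" using c by (simp add: u_def)
    have uF: "u \<notin> F" using zF zu subring_mult[OF F_ring c(1)] by auto
    obtain hu where hu: "minimal_poly F u hu" "degree hu = p" using deg uX uF by blast
    obtain k where k: "residue_minimal u k" using residue_minimal_exists[of u] uu by blast
    show False
    proof (cases "degree k < p")
      case False
      then have "residually_independent F u (degree hu)"
        using k hu(2) unfolding residue_minimal_def residually_independent_def by auto
      then have "monogenic_union F (adjoin F u)"
        using residual_step[OF F minimal_polyD(1,2,4)[OF hu(1)]] uu by blast
      then show False using none uX FXL uF by blast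
    next
      case True
      have kP: "k \<in> polys_over (V \<inter> F)" "lead_coeff k = 1" "poly k u \<in> \<mm>" "residually_independent F u (degree k)"
        using k by (auto simp: residue_minimal_def)
      have k0: "degree k > 0"
      proof (rule Nat.gr0I)
        assume "degree k = 0"
        then have "k = 1" using kP(2) by (metis degree_eq_zeroE lead_coeff_pCons(2) one_pCons)
        then show False using kP(3) one_not_nonunit by simp
      qed
      have "\<not> p dvd degree k" using nat_dvd_not_less[OF k0 True] .
      then have dk: "of_nat (degree k) \<notin> \<mm>"
        using coprime_unit[OF p _ k0] prime_imp_coprime[OF pp] coprime_commute by blast
      have "poly (pderiv k) u \<notin> \<mm>"
      proof
        assume "poly (pderiv k) u \<in> \<mm>"
        then have "coeff (pderiv k) (degree k - 1) \<in> \<mm>"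
          using kP(4) polys_over_pderiv[OF VF_ring kP(1)] degree_pderiv_less[OF k0]
          unfolding residually_independent_def by blast
        then show False using dk kP(2) k0 by (simp add: coeff_pderiv)
      qed
      moreover have XF: "is_subfield (adjoin F x)" by (rule is_subfield_adjoin[OF F alg_F])
      moreover have "k \<in> polys_over (V \<inter> adjoin F x)"
        using kP(1) polys_over_mono[of "V \<inter> F" "V \<inter> adjoin F x"] sub by blast
      ultimately obtain w where w: "w \<in> V \<inter> adjoin F x" "poly k w = 0" "w - u \<in> \<mm>"
        using hensel_lift[of "adjoin F x" k u] K_subset sub kP uX uu by blast
      \<comment> \<open>Elements of F(x) outside F have degree exactly p, whereas w is a root of k
        with deg k < p.\<close>
      have wF: "w \<in> F"
      proof (rule ccontr)
        assume "w \<notin> F"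
        then obtain hw where hw: "minimal_poly F w hw" "degree hw = p" using deg w by blast
        have "k = 0"
          using minimal_polyD(5)[OF hw(1) _ w(2)] kP(1) True hw(2) by (auto simp: polys_over_Int)
        then show False using k0 by simp
      qed
      have "u - w \<noteq> 0" using wF uF by auto
      define a where "a = a0 + c * w"
      have "a \<in> F" unfolding a_def using a0 c wF by (intro subfield_intros F)
      moreover have "x - a = c * (u - w)" using zu by (simp add: a_def z_def algebra_simps)
      then have "(x - a) / (x - a0) = (u - w) * inverse u" using c zu by (simp add: z_def[symmetric] divide_inverse)
      then have "(x - a) / (x - a0) \<in> \<mm>"
        using cong_sym[OF w(3)] unit_inverse[OF uu] nonunit_mult(1) by simp
      ultimately show False using best by blast
    qed
  qed
qed

end

lemma (in galois_step) monogenic_step: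
  assumes "F \<noteq> L"
  obtains w where "w \<in> L" "w \<notin> F" "monogenic_union F (adjoin F w)"
proof (cases has_step)
  case True
  then show ?thesis using that by (auto simp: has_step_def)
next
  case False
  then interpret no_galois_step V K F L \<theta> p by unfold_locales
  show ?thesis using no_step_imp_eq assms by simp
qed

section \<open>Towers of monogenic extensions\<close>

lemma polys_over_image:
  fixes h :: "'a::zero \<Rightarrow> 'b::zero"
  assumes h: "inj h" "h 0 = 0" and p: "p \<in> polys_over (h ` R)"
  obtains q where "q \<in> polys_over R" "p = map_poly h q"
proof -
  define i where "i = inv_into UNIV h"
  have inv: "i (h x) = x" for x unfolding i_def using h(1) by simp
  have c: "coeff p j = h (i (coeff p j)) \<and> i (coeff p j) \<in> R" for j
    using polys_overD[OF p, of j] inv by auto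
  have "i 0 = 0" using inv[of 0] h(2) by simp
  then have "p = map_poly h (map_poly i p)" "map_poly i p \<in> polys_over R"
    using c h(2) by (auto simp: polys_over_def coeff_map_poly intro: poly_eqI)
  then show ?thesis using that by blast
qed

lemma is_subring_image:
  assumes "comm_ring_hom h" and A: "is_subring A"
  shows "is_subring (h ` A)"
proof -
  interpret h: comm_ring_hom h by (rule assms(1))
  show ?thesis
    unfolding is_subring_iff
  proof (intro conjI ballI)
    show "1 \<in> h ` A" using subring_1[OF A] h.hom_one by (metis imageI)
    fix x y assume "x \<in> h ` A" "y \<in> h ` A"
    then obtain a b where "a \<in> A" "b \<in> A" "x = h a" "y = h b" by blast
    then show "x - y \<in> h ` A" "x * y \<in> h ` A"
      using subring_diff[OF A, of a b] subring_mult[OF A, of a b]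
      by (simp_all flip: h.hom_minus h.hom_mult)
  qed
qed

text \<open>The last premise says that 1, w, ..., w^(d-1) with d = deg f are linearly independent
  over T, that is, T[X]/(f) maps isomorphically onto T[w]. No field of fractions is
  involved.\<close>

inductive tower :: "'a::comm_ring_1 set \<Rightarrow> 'a set \<Rightarrow> bool" for A
  where base: "tower A A"
  | step: "tower A T \<Longrightarrow> f \<in> polys_over T \<Longrightarrow> lead_coeff f = 1 \<Longrightarrow> poly f w = 0 \<Longrightarrow>
      (\<And>g. g \<in> polys_over T \<Longrightarrow> g = 0 \<or> degree g < degree f \<Longrightarrow> poly g w = 0 \<Longrightarrow> g = 0) \<Longrightarrow>
      tower A (adjoin T w)"

lemma tower_subring:
  assumes "tower A T" "is_subring A"
  shows "is_subring T \<and> A \<subseteq> T"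
  using assms
proof (induction rule: tower.induct)
  case (step T f w)
  then show ?case using is_subring_adjoin adjoin_contains[of T w] by blast
qed simp

text \<open>Towers are constructed inside the algebraic closure of L; this brings them back to L,
  generators and monic equations included.\<close>

lemma tower_pullback:
  fixes h :: "'a::idom \<Rightarrow> 'b::idom"
  assumes h: "comm_ring_hom h" "inj h" and A: "is_subring A"
  shows "tower (h ` A) T \<Longrightarrow> T \<subseteq> range h \<Longrightarrow> \<exists>T'. tower A T' \<and> T = h ` T'"
proof (induction rule: tower.induct)
  case base
  then show ?case by (auto intro: tower.base)
next
  case (step T f w)
  interpret h: comm_ring_hom h by (rule h(1))
  have A': "is_subring (h ` A)" by (rule is_subring_image[OF h(1) A])
  have Ti: "is_subring T" using tower_subring[OF step.hyps(1) A'] by simp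
  have sub: "T \<subseteq> range h" using adjoin_contains[OF Ti, of w] step.prems by blast
  then obtain T' where T': "tower A T'" "T = h ` T'" using step.IH by blast
  have T'i: "is_subring T'" using tower_subring[OF T'(1) A] by simp
  obtain v where v: "w = h v" using adjoin_generator[OF Ti, of w] step.prems by blast
  have poly: "poly (map_poly h p) (h x) = h (poly p x)" for p x
    by (induction p) (auto simp: map_poly_pCons h.hom_add h.hom_mult)
  have lift: "\<exists>q\<in>polys_over T'. p = map_poly h q" if "p \<in> polys_over T" for p
    using polys_over_image[of h p T'] that T'(2) h(2) by auto
  have push: "map_poly h q \<in> polys_over T" if "q \<in> polys_over T'" for q
    using that T'(2) by (auto simp: polys_over_def coeff_map_poly)
  have deg: "degree (map_poly h q) = degree q" for q
    using h(2) by (intro degree_map_poly) (metis h.hom_zero injD)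
  have zero: "map_poly h q = 0 \<longleftrightarrow> q = 0" for q
    using h(2) by (simp add: poly_eq_iff coeff_map_poly) (metis h.hom_zero injD)
  obtain f' where f': "f' \<in> polys_over T'" "f = map_poly h f'" using lift step.hyps by blast
  have "adjoin T w = h ` adjoin T' v"
  proof (intro Set.set_eqI iffI)
    fix y assume "y \<in> adjoin T w"
    then obtain p where "p \<in> polys_over T" "y = poly p w" by (rule adjoinE)
    then show "y \<in> h ` adjoin T' v" using lift[of p] v poly adjoinI by fastforce
  next
    fix y assume "y \<in> h ` adjoin T' v"
    then obtain q where "q \<in> polys_over T'" "y = h (poly q v)" by (auto elim: adjoinE)
    then show "y \<in> adjoin T w" using push v poly adjoinI by metis
  qed
  moreover have "tower A (adjoin T' v)"
  proof (rule tower.step[OF T'(1) f'(1)])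
    show "lead_coeff f' = 1"
      using step.hyps(3) f'(2) deg[of f'] h(2) by (simp add: coeff_map_poly) (metis h.hom_one injD)
    show "poly f' v = 0" using step.hyps(4) f'(2) v poly h(2) by (metis h.hom_zero injD)
    fix g assume g: "g \<in> polys_over T'" "g = 0 \<or> degree g < degree f'" "poly g v = 0"
    then have "map_poly h g = 0"
      using f'(2) v by (intro step.hyps(5) push) (auto simp: deg zero poly)
    then show "g = 0" by (simp add: zero)
  qed
  ultimately show ?case by blast
qed

text \<open>A basis of T multiplied by the powers w^i with i < deg f is a basis of T[w].\<close>

lemma tower_free:
  fixes A :: "'a::idom set"
  assumes "tower A T" and A: "is_subring A"
  shows "\<exists>E. finite E \<and> E \<subseteq> T \<and> (\<forall>x\<in>T. \<exists>c. (\<forall>e\<in>E. c e \<in> A) \<and> x = (\<Sum>e\<in>E. c e * e)) \<and>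
    (\<forall>c. (\<forall>e\<in>E. c e \<in> A) \<and> (\<Sum>e\<in>E. c e * e) = 0 \<longrightarrow> (\<forall>e\<in>E. c e = 0))"
  using assms(1)
proof (induction rule: tower.induct)
  case base
  show ?case using subring_1[OF A] by (intro exI[of _ "{1}"]) auto
next
  case (step T f w)
  from step.IH obtain E where E: "finite E" "E \<subseteq> T" "\<forall>x\<in>T. \<exists>c. (\<forall>e\<in>E. c e \<in> A) \<and> x = (\<Sum>e\<in>E. c e * e)"
    and ind': "\<forall>c. (\<forall>e\<in>E. c e \<in> A) \<and> (\<Sum>e\<in>E. c e * e) = 0 \<longrightarrow> (\<forall>e\<in>E. c e = 0)"
    by (elim exE conjE)
  have ind: "c e = 0" if "\<And>e. e \<in> E \<Longrightarrow> c e \<in> A" "(\<Sum>e\<in>E. c e * e) = 0" "e \<in> E" for c e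
    using spec[OF ind', of c] that by simp
  have T: "is_subring T" "A \<subseteq> T" using tower_subring[OF step.hyps(1) A] by auto
  have Tw: "is_subring (adjoin T w)" "T \<subseteq> adjoin T w" "w \<in> adjoin T w"
    using is_subring_adjoin[OF T(1)] adjoin_contains[OF T(1)] adjoin_generator[OF T(1)] by auto
  define d where "d = degree f"
  have w_ind: "u i = 0" if "i < d" "\<And>i. i < d \<Longrightarrow> u i \<in> T" "(\<Sum>i<d. u i * w ^ i) = 0" for u i
  proof -
    define g where "g = (\<Sum>i<d. monom (u i) i)"
    have "g \<in> polys_over T" unfolding g_def using that by (intro polys_over_ring polys_over_monom T) auto
    moreover have "degree g < d"
      unfolding g_def using that(1) by (intro degree_sum_less) (auto intro: le_less_trans[OF degree_monom_le])
    moreover have "poly g w = 0" using that(3) by (simp add: g_def poly_sum poly_monom)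
    ultimately have "g = 0" using step.hyps(5) by (simp add: d_def)
    moreover have "coeff g i = u i" using that(1) by (simp add: g_def coeff_sum)
    ultimately show ?thesis by simp
  qed
  define b where "b = (\<lambda>(e, i). e * w ^ i)"
  \<comment> \<open>Coefficients are indexed by the basis elements themselves, so distinct pairs (e,
    i) must give distinct products e w^i; a zero element of E would spoil this.\<close>
  have e0: "e \<noteq> 0" if e: "e \<in> E" for e
  proof
    assume "e = 0"
    then have "(\<Sum>e'\<in>E. (if e' = e then 1 else 0) * e') = 0" by (intro sum.neutral) auto
    then have "(if e = e then 1 else (0::'a)) = 0"
      using e subring_0[OF A] subring_1[OF A] by (intro ind[of "\<lambda>e'. if e' = e then 1 else 0" e]) auto
    then show False by simp
  qed
  have inj: "inj_on b (E \<times> {..<d})"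
  proof (rule inj_onI, clarify)
    fix e i e' i' assume *: "e \<in> E" "i < d" "e' \<in> E" "i' < d" "b (e, i) = b (e', i')"
    define u where "u k = (if k = i then e else 0) - (if k = i' then e' else 0)" for k
    have "(\<Sum>k<d. u k * w ^ k) = (\<Sum>k<d. if k = i then e * w ^ k else 0) - (\<Sum>k<d. if k = i' then e' * w ^ k else 0)"
      unfolding sum_subtractf[symmetric] by (intro sum.cong) (auto simp: u_def algebra_simps)
    also have "\<dots> = 0" using * by (simp add: b_def)
    finally have u0: "(\<Sum>k<d. u k * w ^ k) = 0" .
    have "(if k = i then e else 0) \<in> T" "(if k = i' then e' else 0) \<in> T" for k
      using *(1,3) E(2) subring_0[OF T(1)] by auto
    then have "u k \<in> T" for k unfolding u_def by (intro subring_diff[OF T(1)])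
    then have "u i = 0" using w_ind[OF *(2) _ u0] by simp
    then show "e = e' \<and> i = i'" using e0[OF *(1)] by (auto simp: u_def split: if_splits)
  qed
  define E' where "E' = b ` (E \<times> {..<d})"
  have sum_E': "(\<Sum>e'\<in>E'. c e' * e') = (\<Sum>i<d. (\<Sum>e\<in>E. c (b (e, i)) * e) * w ^ i)" for c
  proof -
    have "(\<Sum>e'\<in>E'. c e' * e') = (\<Sum>q\<in>E \<times> {..<d}. c (b q) * b q)"
      unfolding E'_def using inj by (simp add: sum.reindex)
    also have "\<dots> = (\<Sum>e\<in>E. \<Sum>i<d. c (b (e, i)) * e * w ^ i)"
      by (simp add: sum.cartesian_product b_def case_prod_beta mult.assoc)
    also have "\<dots> = (\<Sum>i<d. (\<Sum>e\<in>E. c (b (e, i)) * e) * w ^ i)"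
      by (subst sum.swap) (simp add: sum_distrib_right)
    finally show ?thesis .
  qed
  show ?case
  proof (intro exI[of _ E'] conjI ballI allI impI)
    show "finite E'" using E(1) by (simp add: E'_def)
    show "E' \<subseteq> adjoin T w"
      using E(2) Tw by (auto simp: E'_def b_def intro!: subring_mult[OF Tw(1)] subring_power[OF Tw(1)])
  next
    fix x assume "x \<in> adjoin T w"
    then obtain g where g: "g \<in> polys_over T" "x = poly g w" "g = 0 \<or> degree g < d"
      using adjoin_reduced[OF T(1) step.hyps(2,3,4)] unfolding d_def by metis
    have "\<forall>i. \<exists>c. (\<forall>e\<in>E. c e \<in> A) \<and> coeff g i = (\<Sum>e\<in>E. c e * e)" using E(3) g(1) by (auto simp: polys_overD)
    then obtain C where C: "\<And>i e. e \<in> E \<Longrightarrow> C i e \<in> A" "\<And>i. coeff g i = (\<Sum>e\<in>E. C i e * e)" by metis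
    define c where "c e' = (case inv_into (E \<times> {..<d}) b e' of (e, i) \<Rightarrow> C i e)" for e'
    have cb: "c (b (e, i)) = C i e" if "e \<in> E" "i < d" for e i
      using that inv_into_f_f[OF inj, of "(e, i)"] by (simp add: c_def)
    have "x = (\<Sum>i<d. coeff g i * w ^ i)" using g poly_eq_sum_less by metis
    also have "\<dots> = (\<Sum>i<d. (\<Sum>e\<in>E. c (b (e, i)) * e) * w ^ i)" using C(2) cb by simp
    also have "\<dots> = (\<Sum>e'\<in>E'. c e' * e')" by (rule sum_E'[symmetric])
    finally show "\<exists>c. (\<forall>e\<in>E'. c e \<in> A) \<and> x = (\<Sum>e\<in>E'. c e * e)"
      using cb C(1) by (intro exI[of _ c]) (auto simp: E'_def)
  next
    fix c e' assume c: "(\<forall>e\<in>E'. c e \<in> A) \<and> (\<Sum>e\<in>E'. c e * e) = 0" and e': "e' \<in> E'"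
    obtain e i where ei: "e \<in> E" "i < d" "e' = b (e, i)" using e' by (auto simp: E'_def)
    have cA: "c (b (e, i)) \<in> A" if "e \<in> E" "i < d" for e i using c that by (auto simp: E'_def)
    have uT: "(\<Sum>e\<in>E. c (b (e, i)) * e) \<in> T" if i: "i < d" for i
    proof (intro subring_sum[OF T(1)] subring_mult[OF T(1)])
      fix e assume "e \<in> E"
      then show "c (b (e, i)) \<in> T" "e \<in> T" using cA i E(2) T(2) by auto
    qed
    have "(\<Sum>i<d. (\<Sum>e\<in>E. c (b (e, i)) * e) * w ^ i) = 0" using c sum_E'[of c] by simp
    then have "(\<Sum>e\<in>E. c (b (e, i)) * e) = 0"
      using w_ind[of i "\<lambda>i. \<Sum>e\<in>E. c (b (e, i)) * e"] ei(2) uT by simp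
    then show "c e' = 0" using ind[of "\<lambda>e. c (b (e, i))" e] cA ei by simp
  qed
qed

subsection \<open>Polynomial rings in several variables\<close>

lemma mpoly_decompose: "p = (\<Sum>m\<in>Poly_Mapping.keys p. Poly_Mapping.single m (Poly_Mapping.lookup p m))"
  by (rule poly_mapping_eqI) (auto simp: lookup_sum lookup_single when_def in_keys_iff)

lemma mpoly_mult_decompose:
  fixes p q :: "'k::field mpoly"
  shows "p * q = (\<Sum>m\<in>Poly_Mapping.keys p. \<Sum>k\<in>Poly_Mapping.keys q.
    Poly_Mapping.single (m + k) (Poly_Mapping.lookup p m * Poly_Mapping.lookup q k))"
  by (subst (1) mpoly_decompose[of p], subst (1) mpoly_decompose[of q]) (simp add: sum_product mult_single)

lemma mpolys_single:
  "is_subring A \<Longrightarrow> c \<in> A \<Longrightarrow> Poly_Mapping.keys m \<subseteq> {..<n} \<Longrightarrow> Poly_Mapping.single m c \<in> mpolys A n"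
  by (auto simp: mpolys_def lookup_single when_def subring_0)

lemma mpolysD:
  assumes "p \<in> mpolys A n"
  shows "Poly_Mapping.lookup p m \<in> A" "m \<in> Poly_Mapping.keys p \<Longrightarrow> Poly_Mapping.keys m \<subseteq> {..<n}"
  using assms by (auto simp: mpolys_def)

lemma mpolys_mono: "m \<le> n \<Longrightarrow> mpolys A m \<subseteq> mpolys A n"
  by (fastforce simp: mpolys_def)

context
  fixes A :: "'k::field set"
  assumes A: "is_subring A"
begin

lemma mpolys_diff: "p \<in> mpolys A n \<Longrightarrow> q \<in> mpolys A n \<Longrightarrow> p - q \<in> mpolys A n"
proof -
  assume *: "p \<in> mpolys A n" "q \<in> mpolys A n"
  have "Poly_Mapping.keys m \<subseteq> {..<n}" if "m \<in> Poly_Mapping.keys (p - q)" for m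
  proof -
    have "m \<in> Poly_Mapping.keys p \<or> m \<in> Poly_Mapping.keys q" using that by (auto simp: in_keys_iff lookup_minus)
    then show ?thesis using * mpolysD(2) by blast
  qed
  then show ?thesis using * by (auto simp: mpolys_def lookup_minus intro: subring_diff[OF A])
qed

lemma mpolys_0: "0 \<in> mpolys A n"
  by (simp add: mpolys_def subring_0[OF A])

lemma mpolys_add: "p \<in> mpolys A n \<Longrightarrow> q \<in> mpolys A n \<Longrightarrow> p + q \<in> mpolys A n"
  using mpolys_diff[of p n "0 - q"] mpolys_diff[of 0 n q] mpolys_0 by simp

lemma mpolys_sum: "(\<And>i. i \<in> I \<Longrightarrow> f i \<in> mpolys A n) \<Longrightarrow> sum f I \<in> mpolys A n"
  by (induction I rule: infinite_finite_induct) (auto intro: mpolys_0 mpolys_add)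

lemma is_subring_mpolys: "is_subring (mpolys A n)"
  unfolding is_subring_iff
proof (intro conjI ballI)
  show "1 \<in> mpolys A n"
    using mpolys_single[OF A subring_1[OF A], of 0 n] by simp
  fix p q assume pq: "p \<in> mpolys A n" "q \<in> mpolys A n"
  show "p - q \<in> mpolys A n" using pq by (rule mpolys_diff)
  show "p * q \<in> mpolys A n"
    unfolding mpoly_mult_decompose
  proof (intro mpolys_sum mpolys_single A subring_mult[OF A] mpolysD(1)[OF pq(1)] mpolysD(1)[OF pq(2)])
    fix m k assume "m \<in> Poly_Mapping.keys p" "k \<in> Poly_Mapping.keys q"
    then show "Poly_Mapping.keys (m + k) \<subseteq> {..<n}"
      using keys_add[of m k] mpolysD(2)[OF pq(1), of m] mpolysD(2)[OF pq(2), of k] by blast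
  qed
qed

end

definition monomial_eval :: "(nat \<Rightarrow> 'l::field) \<Rightarrow> (nat \<Rightarrow>\<^sub>0 nat) \<Rightarrow> 'l"
  where "monomial_eval x m = (\<Prod>i\<in>Poly_Mapping.keys m. x i ^ Poly_Mapping.lookup m i)"

lemma monomial_eval_add: "monomial_eval x (a + b) = monomial_eval x a * monomial_eval x b"
proof -
  have *: "monomial_eval x m = (\<Prod>i\<in>S. x i ^ Poly_Mapping.lookup m i)" if "finite S" "Poly_Mapping.keys m \<subseteq> S" for m S
    unfolding monomial_eval_def using that by (intro prod.mono_neutral_left) (auto simp: in_keys_iff)
  define S where "S = Poly_Mapping.keys a \<union> Poly_Mapping.keys b"
  have "finite S" "Poly_Mapping.keys a \<subseteq> S" "Poly_Mapping.keys b \<subseteq> S" "Poly_Mapping.keys (a + b) \<subseteq> S"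
    using keys_add[of a b] by (auto simp: S_def)
  then show ?thesis using *[of S] by (simp add: lookup_add power_add prod.distrib)
qed

context
  fixes \<iota> :: "'k::field \<Rightarrow> 'l::field" and x :: "nat \<Rightarrow> 'l"
  assumes hom: "field_hom \<iota>"
begin

interpretation \<iota>: field_hom \<iota> by (rule hom)

lemma mpoly_eval_superset:
  "finite S \<Longrightarrow> Poly_Mapping.keys p \<subseteq> S \<Longrightarrow>
    mpoly_eval \<iota> x p = (\<Sum>m\<in>S. \<iota> (Poly_Mapping.lookup p m) * monomial_eval x m)"
  unfolding mpoly_eval_def monomial_eval_def[symmetric]
  by (intro sum.mono_neutral_left) (auto simp: in_keys_iff)

lemma mpoly_eval_add: "mpoly_eval \<iota> x (p + q) = mpoly_eval \<iota> x p + mpoly_eval \<iota> x q"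
proof -
  define S where "S = Poly_Mapping.keys p \<union> Poly_Mapping.keys q"
  have "finite S" "Poly_Mapping.keys p \<subseteq> S" "Poly_Mapping.keys q \<subseteq> S" "Poly_Mapping.keys (p + q) \<subseteq> S"
    using keys_add[of p q] by (auto simp: S_def)
  then show ?thesis
    using mpoly_eval_superset[of S] by (simp add: lookup_add \<iota>.hom_add distrib_right sum.distrib)
qed

lemma mpoly_eval_0: "mpoly_eval \<iota> x 0 = 0"
  by (simp add: mpoly_eval_def)

lemma mpoly_eval_uminus: "mpoly_eval \<iota> x (- p) = - mpoly_eval \<iota> x p"
  using mpoly_eval_add[of p "- p"] by (simp add: mpoly_eval_0 eq_neg_iff_add_eq_0 add.commute)

lemma mpoly_eval_diff: "mpoly_eval \<iota> x (p - q) = mpoly_eval \<iota> x p - mpoly_eval \<iota> x q"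
  using mpoly_eval_add[of p "- q"] by (simp add: mpoly_eval_uminus)

lemma mpoly_eval_sum: "mpoly_eval \<iota> x (sum f I) = (\<Sum>i\<in>I. mpoly_eval \<iota> x (f i))"
  by (induction I rule: infinite_finite_induct) (auto simp: mpoly_eval_0 mpoly_eval_add)

lemma mpoly_eval_single: "mpoly_eval \<iota> x (Poly_Mapping.single m c) = \<iota> c * monomial_eval x m"
  using mpoly_eval_superset[of "{m}" "Poly_Mapping.single m c"] by simp

lemma mpoly_eval_mult: "mpoly_eval \<iota> x (p * q) = mpoly_eval \<iota> x p * mpoly_eval \<iota> x q"
proof -
  have "mpoly_eval \<iota> x (p * q) = (\<Sum>m\<in>Poly_Mapping.keys p. \<Sum>k\<in>Poly_Mapping.keys q.
      (\<iota> (Poly_Mapping.lookup p m) * monomial_eval x m) * (\<iota> (Poly_Mapping.lookup q k) * monomial_eval x k))"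
    by (simp add: mpoly_mult_decompose mpoly_eval_sum mpoly_eval_single \<iota>.hom_mult monomial_eval_add mult_ac)
  also have "\<dots> = mpoly_eval \<iota> x p * mpoly_eval \<iota> x q"
    by (simp add: mpoly_eval_def monomial_eval_def sum_product)
  finally show ?thesis .
qed

lemma mpoly_eval_const: "mpoly_eval \<iota> x (Poly_Mapping.single 0 c) = \<iota> c"
  by (simp add: mpoly_eval_single monomial_eval_def)

lemma mpoly_eval_1: "mpoly_eval \<iota> x 1 = 1"
  using mpoly_eval_const[of 1] by simp

lemma mpoly_eval_power: "mpoly_eval \<iota> x (p ^ n) = mpoly_eval \<iota> x p ^ n"
  by (induction n) (auto simp: mpoly_eval_1 mpoly_eval_mult)

lemma mpoly_eval_in:
  assumes T: "is_subring T" "\<iota> ` A \<subseteq> T" and x: "\<And>i. i < n \<Longrightarrow> x i \<in> T" and p: "p \<in> mpolys A n"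
  shows "mpoly_eval \<iota> x p \<in> T"
  unfolding mpoly_eval_def
proof (intro subring_sum subring_mult subring_prod subring_power T)
  show "\<iota> (Poly_Mapping.lookup p m) \<in> T" for m using T(2) mpolysD(1)[OF p] by blast
  fix m i assume "m \<in> Poly_Mapping.keys p" "i \<in> Poly_Mapping.keys m"
  then show "x i \<in> T" using mpolysD(2)[OF p] x by blast
qed

end

definition mvar :: "nat \<Rightarrow> 'k::field mpoly"
  where "mvar n = Poly_Mapping.single (Poly_Mapping.single n 1) 1"

lemma mvar_power: "mvar n ^ k = Poly_Mapping.single (Poly_Mapping.single n k) 1"
  by (induction k) (auto simp: mvar_def mult_single single_add[symmetric])

lemma mpoly_eval_mvar: "field_hom \<iota> \<Longrightarrow> mpoly_eval \<iota> x (mvar i) = x i"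
proof -
  assume hom: "field_hom \<iota>"
  interpret \<iota>: field_hom \<iota> by (rule hom)
  show ?thesis
    using mpoly_eval_single[OF hom, of x "Poly_Mapping.single i 1" 1] by (simp add: mvar_def monomial_eval_def)
qed

lemma mvar_in: "is_subring A \<Longrightarrow> i < n \<Longrightarrow> mvar i \<in> mpolys A n"
  unfolding mvar_def by (intro mpolys_single) (auto intro: subring_1)

lemma mpoly_eval_cong:
  assumes "p \<in> mpolys A n" "\<And>i. i < n \<Longrightarrow> x i = y i"
  shows "mpoly_eval \<iota> x p = mpoly_eval \<iota> y p"
  unfolding mpoly_eval_def
proof (intro sum.cong refl arg_cong2[where f = "(*)"] prod.cong)
  fix m i assume "m \<in> Poly_Mapping.keys p" "i \<in> Poly_Mapping.keys m"
  then have "i < n" using mpolysD(2)[OF assms(1)] by blast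
  then show "x i ^ Poly_Mapping.lookup m i = y i ^ Poly_Mapping.lookup m i" using assms(2) by simp
qed

lemma single_split_variable:
  fixes c :: "'k::field"
  assumes "Poly_Mapping.keys m \<subseteq> {..<Suc n}"
  obtains m' k where "Poly_Mapping.keys m' \<subseteq> {..<n}"
    "Poly_Mapping.single m c = Poly_Mapping.single m' c * mvar n ^ k"
proof
  define k where "k = Poly_Mapping.lookup m n"
  define m' where "m' = m - Poly_Mapping.single n k"
  have "m = m' + Poly_Mapping.single n k"
    by (rule poly_mapping_eqI) (auto simp: m'_def k_def lookup_add lookup_minus lookup_single when_def)
  then show "Poly_Mapping.single m c = Poly_Mapping.single m' c * mvar n ^ k"
    by (simp add: mvar_power mult_single)
  show "Poly_Mapping.keys m' \<subseteq> {..<n}"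
  proof
    fix i assume i: "i \<in> Poly_Mapping.keys m'"
    then have "i \<noteq> n" "i \<in> Poly_Mapping.keys m"
      by (auto simp: m'_def k_def in_keys_iff lookup_minus lookup_single when_def split: if_splits)
    then show "i \<in> {..<n}" using assms by force
  qed
qed

subsection \<open>Ideals of subrings\<close>

lemma ring_on_cring:
  assumes "is_subring (R :: 'a::comm_ring_1 set)"
  shows "cring (ring_on R)"
proof -
  interpret U: cring "ring_of_type_algebra :: 'a ring" by (rule cring_from_type_algebra)
  interpret S: ring "ring_on R" using U.subring_is_ring[OF assms] .
  show ?thesis by unfold_locales (simp add: ring_of_type_algebra_def mult.commute)
qed

lemma ring_on_minus:
  assumes R: "is_subring (R :: 'a::comm_ring_1 set)" and x: "x \<in> R"
  shows "\<ominus>\<^bsub>ring_on R\<^esub> x = - x"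
proof -
  interpret S: cring "ring_on R" by (rule ring_on_cring[OF R])
  show ?thesis
    using S.minus_equality[of "- x" x] x subring_minus[OF R x] by (simp add: ring_of_type_algebra_def)
qed

lemma ideal_ring_on_iff:
  assumes R: "is_subring (R :: 'a::comm_ring_1 set)"
  shows "ideal I (ring_on R) \<longleftrightarrow> I \<subseteq> R \<and> 0 \<in> I \<and> (\<forall>a\<in>I. \<forall>b\<in>I. a + b \<in> I) \<and> (\<forall>a\<in>I. \<forall>r\<in>R. r * a \<in> I)"
proof
  assume I: "ideal I (ring_on R)"
  interpret I: ideal I "ring_on R" by (rule I)
  show "I \<subseteq> R \<and> 0 \<in> I \<and> (\<forall>a\<in>I. \<forall>b\<in>I. a + b \<in> I) \<and> (\<forall>a\<in>I. \<forall>r\<in>R. r * a \<in> I)"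
    using I.a_subset additive_subgroup.zero_closed[OF I.is_additive_subgroup]
      additive_subgroup.a_closed[OF I.is_additive_subgroup] I.I_l_closed
    by (auto simp: ring_of_type_algebra_def)
next
  assume *: "I \<subseteq> R \<and> 0 \<in> I \<and> (\<forall>a\<in>I. \<forall>b\<in>I. a + b \<in> I) \<and> (\<forall>a\<in>I. \<forall>r\<in>R. r * a \<in> I)"
  interpret S: cring "ring_on R" by (rule ring_on_cring[OF R])
  have neg: "- a \<in> I" if "a \<in> I" for a
    using * that subring_minus[OF R subring_1[OF R]] by (metis mult_minus1)
  have "subgroup I (add_monoid (ring_on R))"
  proof (rule S.add.subgroupI)
    show "I \<subseteq> carrier (ring_on R)" "I \<noteq> {}" using * by auto
    show "\<ominus>\<^bsub>ring_on R\<^esub> a \<in> I" if "a \<in> I" for a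
      using neg[OF that] ring_on_minus[OF R, of a] * that by auto
    show "a \<oplus>\<^bsub>ring_on R\<^esub> b \<in> I" if "a \<in> I" "b \<in> I" for a b
      using * that by (simp add: ring_of_type_algebra_def)
  qed
  then show "ideal I (ring_on R)"
    using * by (intro idealI S.ring_axioms) (auto simp: ring_of_type_algebra_def mult.commute)
qed

lemma ideal_ring_onD:
  assumes R: "is_subring (R :: 'a::comm_ring_1 set)" and I: "ideal I (ring_on R)"
  shows "I \<subseteq> R" "0 \<in> I" "a \<in> I \<Longrightarrow> b \<in> I \<Longrightarrow> a + b \<in> I" "a \<in> I \<Longrightarrow> r \<in> R \<Longrightarrow> r * a \<in> I"
    "a \<in> I \<Longrightarrow> b \<in> I \<Longrightarrow> a - b \<in> I" "(\<And>i. i \<in> J \<Longrightarrow> f i \<in> I) \<Longrightarrow> sum f J \<in> I"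
proof -
  note * = I[unfolded ideal_ring_on_iff[OF R]]
  show "I \<subseteq> R" "0 \<in> I" "a \<in> I \<Longrightarrow> b \<in> I \<Longrightarrow> a + b \<in> I" "a \<in> I \<Longrightarrow> r \<in> R \<Longrightarrow> r * a \<in> I" using * by auto
  show "a - b \<in> I" if "a \<in> I" "b \<in> I"
  proof -
    have "- 1 * b \<in> I" using * that subring_minus[OF R subring_1[OF R]] by blast
    then have "a + - 1 * b \<in> I" using * that by blast
    then show ?thesis by simp
  qed
  show "(\<And>i. i \<in> J \<Longrightarrow> f i \<in> I) \<Longrightarrow> sum f J \<in> I"
    by (induction J rule: infinite_finite_induct) (use * in auto)
qed

lemma genideal_ring_on:
  assumes R: "is_subring (R :: 'a::comm_ring_1 set)" and S: "S \<subseteq> R"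
  shows "ideal (genideal (ring_on R) S) (ring_on R)" "S \<subseteq> genideal (ring_on R) S"
    "ideal I (ring_on R) \<Longrightarrow> S \<subseteq> I \<Longrightarrow> genideal (ring_on R) S \<subseteq> I"
proof -
  interpret C: cring "ring_on R" by (rule ring_on_cring[OF R])
  show "ideal (genideal (ring_on R) S) (ring_on R)" "S \<subseteq> genideal (ring_on R) S"
    using C.genideal_ideal[of S] C.genideal_self[of S] S by auto
  show "ideal I (ring_on R) \<Longrightarrow> S \<subseteq> I \<Longrightarrow> genideal (ring_on R) S \<subseteq> I"
    by (rule C.genideal_minimal)
qed

subsection \<open>Towers are complete intersections\<close>

lemma presentation_base:
  assumes \<iota>: "field_hom \<iota>" and A: "is_subring A"
  shows "presentation \<iota> A (\<iota> ` A) 0 0 x f"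
proof -
  interpret \<iota>: field_hom \<iota> by (rule \<iota>)
  have *: "p = Poly_Mapping.single 0 (Poly_Mapping.lookup p 0)" if p: "p \<in> mpolys A 0" for p
  proof (rule poly_mapping_eqI)
    fix m
    show "Poly_Mapping.lookup p m = Poly_Mapping.lookup (Poly_Mapping.single 0 (Poly_Mapping.lookup p 0)) m"
    proof (cases "m = 0")
      case False
      then have "m \<notin> Poly_Mapping.keys p" using mpolysD(2)[OF p, of m] by auto
      then show ?thesis using False by (simp add: in_keys_iff lookup_single)
    qed simp
  qed
  have ev: "mpoly_eval \<iota> x p = \<iota> (Poly_Mapping.lookup p 0)" if "p \<in> mpolys A 0" for p
    using *[OF that] mpoly_eval_const[OF \<iota>] by metis
  have "mpoly_eval \<iota> x ` mpolys A 0 = \<iota> ` A"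
  proof (intro Set.set_eqI iffI)
    fix y assume "y \<in> mpoly_eval \<iota> x ` mpolys A 0"
    then show "y \<in> \<iota> ` A" using ev mpolysD(1) by force
  next
    fix y assume "y \<in> \<iota> ` A"
    then obtain a where "a \<in> A" "y = \<iota> a" by auto
    then show "y \<in> mpoly_eval \<iota> x ` mpolys A 0"
      using mpolys_single[OF A, of a 0 0] mpoly_eval_const[OF \<iota>, of x a] by force
  qed
  moreover have "{p \<in> mpolys A 0. mpoly_eval \<iota> x p = 0} = {0}"
    using ev * mpolys_0[OF A] mpoly_eval_0[OF \<iota>] by (auto, metis single_zero)
  moreover have "genideal (ring_on (mpolys A 0)) {} = {0}"
  proof
    note R = is_subring_mpolys[OF A, of 0]
    show "genideal (ring_on (mpolys A 0)) {} \<subseteq> {0}"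
      using mpolys_0[OF A] by (intro genideal_ring_on(3)[OF R]) (auto simp: ideal_ring_on_iff[OF R])
    show "{0} \<subseteq> genideal (ring_on (mpolys A 0)) {}"
      using ideal_ring_onD(2)[OF R genideal_ring_on(1)[OF R]] by auto
  qed
  ultimately show ?thesis by (simp add: presentation_def)
qed

text \<open>One generator and one relation are added, which keeps their numbers equal. The relation
  G lifts the monic equation of w. Modulo the relations every polynomial reduces to degree below d
  in the new variable, and independence of the powers of w leaves the old relations only.\<close>

lemma presentation_step:
  assumes \<iota>: "field_hom \<iota>" and A: "is_subring A" and T: "is_subring T" "\<iota> ` A \<subseteq> T"
    and pres: "presentation \<iota> A T n n x f"
    and F: "F \<in> polys_over T" "lead_coeff F = 1" "poly F w = 0"
    and ind: "\<And>g. g \<in> polys_over T \<Longrightarrow> g = 0 \<or> degree g < degree F \<Longrightarrow> poly g w = 0 \<Longrightarrow> g = 0"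
  shows "\<exists>y g. presentation \<iota> A (adjoin T w) (Suc n) (Suc n) y g"
proof -
  interpret \<iota>: field_hom \<iota> by (rule \<iota>)
  have fA: "\<And>j. j < n \<Longrightarrow> f j \<in> mpolys A n" and im: "mpoly_eval \<iota> x ` mpolys A n = T"
    and ker: "{p \<in> mpolys A n. mpoly_eval \<iota> x p = 0} = genideal (ring_on (mpolys A n)) (f ` {..<n})"
    using pres by (auto simp: presentation_def)
  define d where "d = degree F"
  define y where "y = x(n := w)"
  let ?R = "mpolys A (Suc n)"
  let ?ev = "mpoly_eval \<iota> y"
  have R: "is_subring ?R" and Rn: "is_subring (mpolys A n)" by (rule is_subring_mpolys[OF A])+
  note Ri = subring_intros[OF R]
  have sub: "mpolys A n \<subseteq> ?R" by (rule mpolys_mono) simp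
  have ev_n: "?ev p = mpoly_eval \<iota> x p" if "p \<in> mpolys A n" for p
    using that by (intro mpoly_eval_cong) (auto simp: y_def)
  have ev_X: "?ev (mvar n) = w" by (simp add: mpoly_eval_mvar[OF \<iota>] y_def)
  have X: "mvar n \<in> ?R" by (rule mvar_in[OF A]) simp
  have "\<exists>q\<in>mpolys A n. t = mpoly_eval \<iota> x q" if "t \<in> T" for t using that im by blast
  then obtain rep where rep: "\<And>t. t \<in> T \<Longrightarrow> rep t \<in> mpolys A n \<and> mpoly_eval \<iota> x (rep t) = t" by metis
  define \<phi> where "\<phi> i = rep (coeff F i)" for i
  have \<phi>: "\<phi> i \<in> mpolys A n" "?ev (\<phi> i) = coeff F i" for i
    using rep[OF polys_overD[OF F(1), of i]] ev_n by (auto simp: \<phi>_def)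
  \<comment> \<open>The lower coefficients are lifted by arbitrary preimages, the leading one by 1,
    so that reduction modulo G needs no division.\<close>
  define G where "G = mvar n ^ d + (\<Sum>i<d. \<phi> i * mvar n ^ i)"
  define g where "g = f(n := G)"
  have GR: "G \<in> ?R" unfolding G_def using \<phi>(1) sub X by (intro Ri) auto
  have gR: "g j \<in> ?R" if "j < Suc n" for j
    using that fA[of j] sub GR by (cases "j = n") (auto simp: g_def)
  have evG: "?ev G = 0"
  proof -
    have "?ev G = w ^ d + (\<Sum>i<d. coeff F i * w ^ i)"
      by (simp add: G_def mpoly_eval_add[OF \<iota>] mpoly_eval_sum[OF \<iota>] mpoly_eval_mult[OF \<iota>]
          mpoly_eval_power[OF \<iota>] ev_X \<phi>(2))
    also have "\<dots> = poly F w"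
      using F(2) unfolding poly_altdef by (simp add: d_def lessThan_Suc_atMost[symmetric])
    finally show ?thesis using F(3) by simp
  qed
  have evg: "?ev (g j) = 0" if "j < Suc n" for j
  proof (cases "j = n")
    case True
    then show ?thesis using evG by (simp add: g_def)
  next
    case False
    then have j: "j < n" using that by simp
    then have "f j \<in> genideal (ring_on (mpolys A n)) (f ` {..<n})"
      using genideal_ring_on(2)[OF Rn, of "f ` {..<n}"] fA by auto
    then have "mpoly_eval \<iota> x (f j) = 0" using ker by blast
    then show ?thesis using ev_n[OF fA[OF j]] False by (simp add: g_def)
  qed
  note Tw = is_subring_adjoin[OF T(1), of w]
  have Tsub: "T \<subseteq> adjoin T w" "w \<in> adjoin T w" using adjoin_contains[OF T(1)] adjoin_generator[OF T(1)] by auto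
  have image: "?ev ` ?R = adjoin T w"
  proof
    have "x i \<in> T" if "i < n" for i
      using mvar_in[OF A that] mpoly_eval_mvar[OF \<iota>, of x i] im by (metis imageI)
    then have "y i \<in> adjoin T w" if "i < Suc n" for i
      using that Tsub by (cases "i = n") (auto simp: y_def)
    then show "?ev ` ?R \<subseteq> adjoin T w"
      using mpoly_eval_in[OF \<iota> Tw, of A "Suc n" y] T Tsub by blast
    show "adjoin T w \<subseteq> ?ev ` ?R"
    proof
      fix z assume "z \<in> adjoin T w"
      then obtain h where h: "h \<in> polys_over T" "z = poly h w" by (rule adjoinE)
      define q where "q = (\<Sum>i\<le>degree h. rep (coeff h i) * mvar n ^ i)"
      have repc: "rep (coeff h i) \<in> mpolys A n" "?ev (rep (coeff h i)) = coeff h i" for i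
        using rep[OF polys_overD[OF h(1)]] ev_n by auto
      then have "q \<in> ?R" unfolding q_def using sub X by (intro Ri) auto
      moreover have "?ev q = z"
        by (simp add: q_def h(2) poly_altdef mpoly_eval_sum[OF \<iota>] mpoly_eval_mult[OF \<iota>]
            mpoly_eval_power[OF \<iota>] ev_X repc(2))
      ultimately show "z \<in> ?ev ` ?R" by blast
    qed
  qed
  define I where "I = genideal (ring_on ?R) (g ` {..<Suc n})"
  have gsub: "g ` {..<Suc n} \<subseteq> ?R" using gR by blast
  have I: "ideal I (ring_on ?R)" "g ` {..<Suc n} \<subseteq> I"
    unfolding I_def by (rule genideal_ring_on[OF R gsub])+
  note ID = ideal_ring_onD[OF R I(1)]
  have kernel: "ideal {p \<in> ?R. ?ev p = 0} (ring_on ?R)"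
    unfolding ideal_ring_on_iff[OF R]
    by (auto simp: mpoly_eval_0[OF \<iota>] mpoly_eval_add[OF \<iota>] mpoly_eval_mult[OF \<iota>] intro: Ri)
  have I_ker: "I \<subseteq> {p \<in> ?R. ?ev p = 0}"
    unfolding I_def using evg gR by (intro genideal_ring_on(3)[OF R gsub kernel]) auto
  \<comment> \<open>Polynomials congruent modulo the ideal I to one of degree below d in the last
    variable, with coefficients in the first n variables.\<close>
  define NF where "NF = {p. \<exists>q. (\<forall>i. q i \<in> mpolys A n) \<and> p - (\<Sum>i<d. q i * mvar n ^ i) \<in> I}"
  have NF0: "0 \<in> NF"
    unfolding NF_def using mpolys_0[OF A] ID(2) by (auto intro!: exI[of _ "\<lambda>_. 0"])
  have NF_diff: "p - p' \<in> NF" if "p \<in> NF" "p' \<in> NF" for p p'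
  proof -
    obtain q q' where q: "\<forall>i. q i \<in> mpolys A n" "p - (\<Sum>i<d. q i * mvar n ^ i) \<in> I"
      and q': "\<forall>i. q' i \<in> mpolys A n" "p' - (\<Sum>i<d. q' i * mvar n ^ i) \<in> I"
      using \<open>p \<in> NF\<close> \<open>p' \<in> NF\<close> unfolding NF_def by blast
    have "(p - p') - (\<Sum>i<d. (q i - q' i) * mvar n ^ i)
        = (p - (\<Sum>i<d. q i * mvar n ^ i)) - (p' - (\<Sum>i<d. q' i * mvar n ^ i))"
      by (simp add: algebra_simps sum_subtractf)
    also have "\<dots> \<in> I" using q(2) q'(2) by (rule ID(5))
    finally show ?thesis
      unfolding NF_def using q(1) q'(1) by (auto intro!: exI[of _ "\<lambda>i. q i - q' i"] mpolys_diff[OF A])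
  qed
  have NF_add: "p + p' \<in> NF" if "p \<in> NF" "p' \<in> NF" for p p'
    using NF_diff[OF that(1) NF_diff[OF NF0 that(2)]] by simp
  have NF_sum: "sum h J \<in> NF" if "\<And>j. j \<in> J \<Longrightarrow> h j \<in> NF" for h :: "'c \<Rightarrow> _" and J
    using that by (induction J rule: infinite_finite_induct) (auto intro: NF0 NF_add)
  have NF_I: "p \<in> NF" if "p \<in> I" for p
    unfolding NF_def using that mpolys_0[OF A] by (auto intro!: exI[of _ "\<lambda>_. 0"])
  have NF_monomial: "q * mvar n ^ k \<in> NF" if "q \<in> mpolys A n" for q k
    using that
  proof (induction k arbitrary: q rule: less_induct)
    case (less k)
    show ?case
    proof (cases "k < d")
      case True
      have "(\<Sum>i<d. (if i = k then q else 0) * mvar n ^ i) = (\<Sum>i<d. if i = k then q * mvar n ^ i else 0)"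
        by (intro sum.cong) auto
      also have "\<dots> = q * mvar n ^ k" using True by simp
      finally show ?thesis
        unfolding NF_def using less.prems ID(2) mpolys_0[OF A]
        by (auto intro!: exI[of _ "\<lambda>i. if i = k then q else 0"])
    next
      case False
      \<comment> \<open>Replacing the top power by means of G leaves exponents k - d + i with i < d,
        all smaller than k.\<close>
      then have "mvar n ^ k = mvar n ^ (k - d) * (mvar n ^ d :: 'a mpoly)" by (simp add: power_add[symmetric])
      then have "q * mvar n ^ k = q * mvar n ^ (k - d) * G - (\<Sum>i<d. (q * \<phi> i) * mvar n ^ (k - d + i))"
        by (simp add: G_def algebra_simps sum_distrib_left power_add)
      moreover have "q * mvar n ^ (k - d) * G \<in> I"
        using less.prems sub X I(2) by (intro ID(4) Ri) (auto simp: g_def)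
      moreover have "(\<Sum>i<d. (q * \<phi> i) * mvar n ^ (k - d + i)) \<in> NF"
        using False less.prems \<phi>(1) by (intro NF_sum less.IH subring_mult[OF Rn]) auto
      ultimately show ?thesis using NF_diff NF_I by simp
    qed
  qed
  have NF_all: "p \<in> NF" if p: "p \<in> ?R" for p
  proof -
    have "Poly_Mapping.single m (Poly_Mapping.lookup p m) \<in> NF" if mk: "m \<in> Poly_Mapping.keys p" for m
    proof -
      obtain m' k where "Poly_Mapping.keys m' \<subseteq> {..<n}" "Poly_Mapping.single m (Poly_Mapping.lookup p m)
          = Poly_Mapping.single m' (Poly_Mapping.lookup p m) * mvar n ^ k"
        using single_split_variable[OF mpolysD(2)[OF p mk]] by blast
      then show ?thesis using NF_monomial mpolys_single[OF A mpolysD(1)[OF p]] by simp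
    qed
    then show ?thesis by (subst mpoly_decompose) (rule NF_sum)
  qed
  have "{p \<in> ?R. ?ev p = 0} \<subseteq> I"
  proof
    fix p assume p: "p \<in> {p \<in> ?R. ?ev p = 0}"
    then obtain q where q: "\<And>i. q i \<in> mpolys A n" "p - (\<Sum>i<d. q i * mvar n ^ i) \<in> I"
      using NF_all unfolding NF_def by blast
    have "?ev (p - (\<Sum>i<d. q i * mvar n ^ i)) = 0" using q(2) I_ker by blast
    then have sum0: "(\<Sum>i<d. ?ev (q i) * w ^ i) = 0"
      using p by (simp add: mpoly_eval_diff[OF \<iota>] mpoly_eval_sum[OF \<iota>] mpoly_eval_mult[OF \<iota>]
          mpoly_eval_power[OF \<iota>] ev_X)
    have qT: "?ev (q i) \<in> T" for i using ev_n[OF q(1)] im q(1) by (metis imageI)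
    define h where "h = (\<Sum>i<d. monom (?ev (q i)) i)"
    have "h = 0"
    proof (rule ind)
      show "h \<in> polys_over T" unfolding h_def by (intro polys_over_ring polys_over_monom T(1) qT)
      show "poly h w = 0" using sum0 by (simp add: h_def poly_sum poly_monom)
      show "h = 0 \<or> degree h < degree F"
      proof (cases "d = 0")
        case False
        then have "degree h < d"
          unfolding h_def by (intro degree_sum_less) (auto intro: le_less_trans[OF degree_monom_le])
        then show ?thesis by (simp add: d_def)
      qed (simp add: h_def)
    qed
    \<comment> \<open>The coefficient q i evaluates to 0 in T, so it lies in the ideal of the given
      presentation, whose generators are among those of I.\<close>
    have "q i \<in> I" if i: "i < d" for i
    proof -
      have "coeff h i = ?ev (q i)" using i by (simp add: h_def coeff_sum)
      then have "mpoly_eval \<iota> x (q i) = 0" using \<open>h = 0\<close> ev_n[OF q(1)] by simp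
      then have "q i \<in> genideal (ring_on (mpolys A n)) (f ` {..<n})" using q(1) ker by blast
      moreover have "genideal (ring_on (mpolys A n)) (f ` {..<n}) \<subseteq> I \<inter> mpolys A n"
      proof (rule genideal_ring_on(3)[OF Rn])
        show "f ` {..<n} \<subseteq> mpolys A n" using fA by auto
        have "f j = g j" if "j < n" for j using that by (simp add: g_def)
        then have "f j \<in> I" if "j < n" for j using that I(2) by (metis imageI lessThan_iff less_Suc_eq subsetD)
        then show "f ` {..<n} \<subseteq> I \<inter> mpolys A n" using fA by auto
        show "ideal (I \<inter> mpolys A n) (ring_on (mpolys A n))"
          unfolding ideal_ring_on_iff[OF Rn]
          using ID sub by (auto intro: subring_0[OF Rn] subring_add[OF Rn] subring_mult[OF Rn])
      qed
      ultimately show ?thesis by blast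
    qed
    then have "(\<Sum>i<d. mvar n ^ i * q i) \<in> I" using X by (intro ID(6) ID(4) Ri) auto
    then have "(p - (\<Sum>i<d. q i * mvar n ^ i)) + (\<Sum>i<d. mvar n ^ i * q i) \<in> I" using q(2) by (intro ID(3))
    then show "p \<in> I" by (simp add: mult.commute)
  qed
  then have "{p \<in> ?R. ?ev p = 0} = I" using I_ker by blast
  then have "presentation \<iota> A (adjoin T w) (Suc n) (Suc n) y g"
    unfolding presentation_def using gR image by (simp add: I_def)
  then show ?thesis by blast
qed

lemma tower_presentation:
  assumes \<iota>: "field_hom \<iota>" and A: "is_subring A" and T: "tower (\<iota> ` A) T"
  shows "\<exists>n x f. presentation \<iota> A T n n x f"
  using T
proof (induction rule: tower.induct)
  case base
  show ?case using presentation_base[OF \<iota> A] by blast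
next
  case (step T f w)
  interpret \<iota>: field_hom \<iota> by (rule \<iota>)
  have "is_subring (\<iota> ` A)" by (rule is_subring_image[OF \<iota>.comm_ring_hom_axioms A])
  then have "is_subring T" "\<iota> ` A \<subseteq> T" using tower_subring[OF step.hyps(1)] by auto
  then show ?case using step presentation_step[OF \<iota> A] by metis
qed

text \<open>Incomparability: for \<open>x\<close> in the larger prime only, a monic \<open>p\<close> over \<open>A\<close> of least degree with
  \<open>p(x)\<close> in the smaller prime can be divided by \<open>x\<close>.\<close>

lemma integral_fibre_dim:
  assumes \<iota>: "field_hom \<iota>" and A: "is_subring A" and T: "is_subring T" "\<iota> ` A \<subseteq> T"
    and integral: "\<And>x. x \<in> T \<Longrightarrow> \<exists>p\<in>polys_over (\<iota> ` A). lead_coeff p = 1 \<and> poly p x = 0"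
    and ne: "spec_fibre \<iota> A T P \<noteq> {}"
  shows "has_krull_dim (spec_fibre \<iota> A T P) 0"
proof -
  have "has_chain (spec_fibre \<iota> A T P) 0" using ne by (auto simp: has_chain_def)
  moreover have False if Q: "Q0 \<in> spec_fibre \<iota> A T P" "Q1 \<in> spec_fibre \<iota> A T P" "Q0 \<subset> Q1" for Q0 Q1
  proof -
    interpret Q0: primeideal Q0 "ring_on T" using Q(1) by (simp add: spec_fibre_def)
    interpret Q1: primeideal Q1 "ring_on T" using Q(2) by (simp add: spec_fibre_def)
    note D0 = ideal_ring_onD[OF T(1) Q0.ideal_axioms] and D1 = ideal_ring_onD[OF T(1) Q1.ideal_axioms]
    have prime: "a \<in> Q0 \<or> b \<in> Q0" if "a \<in> T" "b \<in> T" "a * b \<in> Q0" for a b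
      using Q0.I_prime[of a b] that by (simp add: ring_of_type_algebra_def)
    have one: "1 \<notin> Q0"
    proof
      assume "1 \<in> Q0"
      then have "r \<in> Q0" if "r \<in> T" for r using D0(4)[of 1 r] that by simp
      then show False using Q0.I_notcarr D0(1) by auto
    qed
    have contr: "{a \<in> A. \<iota> a \<in> Q0} = {a \<in> A. \<iota> a \<in> Q1}" using Q by (simp add: spec_fibre_def)
    obtain x where x: "x \<in> Q1" "x \<notin> Q0" using Q(3) by blast
    then have xT: "x \<in> T" using D1(1) by blast
    have "poly p x \<notin> Q0" if "p \<in> polys_over (\<iota> ` A)" "lead_coeff p = 1" for p
      using that
    proof (induction p)
      case (pCons a p)
      have a: "a \<in> \<iota> ` A" and p: "p \<in> polys_over (\<iota> ` A)"
        using polys_overD[OF pCons.prems(1), of 0] polys_overD[OF pCons.prems(1), of "Suc _"]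
        by (auto intro: polys_overI)
      show ?case
      proof (cases "p = 0")
        case True
        then show ?thesis using pCons.prems(2) one by simp
      next
        case False
        show ?thesis
        proof
          assume *: "poly (pCons a p) x \<in> Q0"
          have pT: "poly p x \<in> T" by (rule poly_in_subring'[OF T p xT])
          have "poly p x * x \<in> Q1" using D1(4)[OF x(1) pT] .
          then have "poly (pCons a p) x - poly p x * x \<in> Q1" using * Q(3) by (intro D1(5)) auto
          then have "a \<in> Q1" by (simp add: mult.commute)
          \<comment> \<open>The constant coefficient comes from A, and both primes contract to the
            same prime of A.\<close>
          then have aQ: "a \<in> Q0" using a contr by auto
          have "poly (pCons a p) x - a \<in> Q0" using * aQ by (rule D0(5))
          then have "x * poly p x \<in> Q0" by simp
          then have "poly p x \<in> Q0" using prime[OF xT pT] x by blast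
          moreover have "lead_coeff p = 1" using pCons.prems(2) False by simp
          ultimately show False using pCons.IH p by blast
        qed
      qed
    qed simp
    then show False using integral[OF xT] D0(2) by metis
  qed
  then have "\<not> has_chain (spec_fibre \<iota> A T P) (Suc 0)" unfolding has_chain_def by auto
  ultimately show ?thesis by (simp add: has_krull_dim_def)
qed

text \<open>The presentation is global, so g = 1 serves at every prime; the expected fibre dimension
  n - n = 0 is supplied by integrality.\<close>

lemma presentation_complete_intersection:
  assumes \<iota>: "field_hom \<iota>" and A: "is_subring A" and T: "is_subring T" "\<iota> ` A \<subseteq> T"
    and integral: "\<And>x. x \<in> T \<Longrightarrow> \<exists>p\<in>polys_over (\<iota> ` A). lead_coeff p = 1 \<and> poly p x = 0"
    and pres: "presentation \<iota> A T n n x f"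
  shows "relative_complete_intersection \<iota> A T"
  unfolding relative_complete_intersection_def
proof (intro allI impI)
  fix Q assume "primeideal Q (ring_on T)"
  then interpret Q: primeideal Q "ring_on T" .
  note D = ideal_ring_onD[OF T(1) Q.ideal_axioms]
  have "1 \<notin> Q"
  proof
    assume "1 \<in> Q"
    then have "r \<in> Q" if "r \<in> T" for r using D(4)[of 1 r] that by simp
    then show False using Q.I_notcarr D(1) by auto
  qed
  moreover have "localise_at T 1 = T" by (auto simp: localise_at_def)
  moreover have "relative_global_complete_intersection \<iota> A T"
    unfolding relative_global_complete_intersection_def
    using pres integral_fibre_dim[OF \<iota> A T integral] by (intro exI[of _ n] exI[of _ x] exI[of _ f]) auto
  ultimately show "\<exists>g\<in>T - Q. relative_global_complete_intersection \<iota> A (localise_at T g)"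
    using subring_1[OF T(1)] by (intro bexI[of _ 1]) auto
qed

section \<open>Towers in the integral closure\<close>

context henselian_closure
begin

definition tower_union :: "'a set \<Rightarrow> bool"
  where "tower_union F \<longleftrightarrow>
    (\<forall>S. finite S \<longrightarrow> S \<subseteq> V \<inter> F \<longrightarrow> (\<exists>T. tower (V \<inter> K) T \<and> S \<subseteq> T \<and> T \<subseteq> V \<inter> F))"

text \<open>The finitely many coefficients of the minimal polynomial of v and of the expressions for
  S lie in \<open>V\<close> \<inter> F, hence in one tower T below F. Over that T the element v has
  the same monic equation and generates a ring containing S.\<close>

lemma tower_union_step:
  assumes F: "is_subfield F" "K \<subseteq> F" and F': "is_subfield F'" "F \<subseteq> F'"
    and good: "tower_union F" and mono: "monogenic_union F F'"
  shows "tower_union F'"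
  unfolding tower_union_def
proof (intro allI impI)
  fix S assume S: "finite S" "S \<subseteq> V \<inter> F'"
  obtain v where v: "v \<in> V \<inter> F'" "S \<subseteq> adjoin (V \<inter> F) v"
    using mono S unfolding monogenic_union_def by blast
  obtain m where m: "minimal_poly F v m" using minimal_poly_exists[OF F(1) alg_over_mono[OF F(2) alg]] .
  have "\<exists>g. g \<in> polys_over (V \<inter> F) \<and> s = poly g v" if "s \<in> S" for s
    using v(2) that adjoinE by blast
  then obtain g where g: "\<And>s. s \<in> S \<Longrightarrow> g s \<in> polys_over (V \<inter> F)" "\<And>s. s \<in> S \<Longrightarrow> s = poly (g s) v" by metis
  define C where "C = range (coeff m) \<union> (\<Union>s\<in>S. range (coeff (g s)))"
  have fin: "finite (range (coeff q))" for q :: "'a poly"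
  proof (rule finite_subset)
    show "range (coeff q) \<subseteq> insert 0 (coeff q ` {..degree q})"
      by (auto simp: image_iff) (metis atMost_iff coeff_eq_0 not_le_imp_less)
  qed simp
  have "finite C" unfolding C_def using fin S(1) by blast
  moreover have "C \<subseteq> V \<inter> F"
    using minimal_poly_in_V[OF F m] v g(1) by (auto simp: C_def polys_over_def)
  ultimately obtain T where T: "tower (V \<inter> K) T" "C \<subseteq> T" "T \<subseteq> V \<inter> F"
    using good unfolding tower_union_def by blast
  have Ti: "is_subring T"
    using tower_subring[OF T(1) is_subring_Int[OF V subfield_subring[OF K]]] by simp
  have gT: "g s \<in> polys_over T" if "s \<in> S" for s
    using T(2) that unfolding C_def polys_over_def by blast
  have mT: "m \<in> polys_over T" using T(2) by (auto simp: C_def polys_over_def)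
  have "tower (V \<inter> K) (adjoin T v)"
  proof (rule tower.step[OF T(1) mT minimal_polyD(2)[OF m] minimal_polyD(4)[OF m]])
    fix q assume q: "q \<in> polys_over T" "q = 0 \<or> degree q < degree m" "poly q v = 0"
    then have "q \<in> polys_over F" using T(3) polys_over_mono[of T F] by blast
    then show "q = 0" using minimal_polyD(5)[OF m] q by blast
  qed
  moreover have "S \<subseteq> adjoin T v"
  proof
    fix s assume s: "s \<in> S"
    have "poly (g s) v \<in> adjoin T v" by (rule adjoinI[OF gT[OF s]])
    then show "s \<in> adjoin T v" using g(2)[OF s] by simp
  qed
  moreover have "T \<subseteq> V \<inter> F'" using T(3) F'(2) by blast
  then have "adjoin T v \<subseteq> V \<inter> F'"
    by (rule adjoin_subset[OF is_subring_Int[OF V subfield_subring[OF F'(1)]] _ v(1)])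
  ultimately show "\<exists>T. tower (V \<inter> K) T \<and> S \<subseteq> T \<and> T \<subseteq> V \<inter> F'" by blast
qed

text \<open>The induction is on the degree of \<theta> over F, which drops strictly when F is
  enlarged inside L = F(\<theta>).\<close>

theorem tower_union_galois:
  assumes "simple_galois K L \<theta>"
  shows "tower_union L"
proof -
  interpret G: simple_galois K L \<theta> by (rule assms)
  obtain p where p: "residue_char_exponent p" using residue_char_exponent_exists by blast
  have "tower_union L"
    if "is_subfield F" "K \<subseteq> F" "F \<subseteq> L" "tower_union F" "minimal_poly F \<theta> m" for F m
    using that
  proof (induction "degree m" arbitrary: F m rule: less_induct)
    case less
    note FF = less.prems(1-3) and m = less.prems(5)
    show ?case
    proof (cases "F = L")
      case True
      then show ?thesis using less.prems by simp
    next
      case False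
      have L_eq: "L = adjoin F \<theta>"
        using adjoin_mono[OF FF(2), of \<theta>] adjoin_subset[OF G.E_ring FF(3) G.theta_in] G.E_eq by blast
      interpret galois_step V K F L \<theta> p
        by unfold_locales
          (use FF p L_eq sep_over_mono[OF FF(2) G.sep_theta] G.normal conj_over_mono[OF FF(2)] in auto)
      obtain w where w: "w \<in> L" "w \<notin> F" "monogenic_union F (adjoin F w)" using monogenic_step[OF False] .
      define F' where "F' = adjoin F w"
      have F': "is_subfield F'" "F \<subseteq> F'" "F' \<subseteq> L" "w \<in> F'"
        unfolding F'_def using is_subfield_adjoin[OF FF(1) alg_F] adjoin_contains[OF F_ring]
          adjoin_subset[OF L_ring FF(3) w(1)] adjoin_generator[OF F_ring] by auto
      obtain m' where m': "minimal_poly F' \<theta> m'"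
        using minimal_poly_exists[OF F'(1) alg_over_mono[OF F'(2) alg_F]] .
      have mF': "m \<in> polys_over F'" using minimal_polyD(1)[OF m] polys_over_mono[OF F'(2)] by blast
      have le: "degree m' \<le> degree m"
        using m' mF' minimal_polyD(3,4)[OF m] unfolding minimal_poly_def by blast
      \<comment> \<open>Write w = g(\<theta>) with g over F of degree below deg m. If \<theta> kept
        its degree over F(w), the polynomial g - w would have to vanish, making w the constant
        coefficient of g and an element of F.\<close>
      have "degree m' \<noteq> degree m"
      proof
        assume eq: "degree m' = degree m"
        obtain g where g: "g \<in> polys_over F" "w = poly g \<theta>" "g = 0 \<or> degree g < degree m"
          using adjoin_reduced[OF F_ring minimal_polyD(1,2,4)[OF m], of w] w(1) L_eq by blast
        have "g - [:w:] \<in> polys_over F'"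
          using g(1) polys_over_mono[OF F'(2)] F'(4) subfield_subring[OF F'(1)]
          by (intro polys_over_ring polys_over_const) auto
        moreover have "degree (g - [:w:]) < degree m'"
          using g(3) minimal_poly_degree_pos[OF m] eq by (auto intro: degree_diff_less)
        moreover have "poly (g - [:w:]) \<theta> = 0" using g(2) by simp
        ultimately have "g - [:w:] = 0" using minimal_polyD(5)[OF m'] by blast
        then have "w = coeff g 0" by simp
        then show False using w(2) polys_overD[OF g(1)] by simp
      qed
      then have "degree m' < degree m" using le by simp
      moreover have "tower_union F'"
        using tower_union_step[OF FF(1,2) F'(1,2) less.prems(4)] w(3) by (simp add: F'_def)
      ultimately show ?thesis using less.hyps[of m' F'] F' FF(2) m' by blast
    qed
  qed
  moreover have "tower_union K"
    unfolding tower_union_def by (auto intro: tower.base)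
  moreover obtain m where "minimal_poly K \<theta> m" using minimal_poly_exists[OF K alg] .
  ultimately show ?thesis using K G.F_subset by blast
qed

end

section \<open>Galois extensions of a Henselian valued field\<close>

lemma maximalideal_nonunits:
  assumes A: "valuation_ring A" and M: "maximalideal M (ring_on A)"
  shows "M = nonunits A"
proof -
  interpret valued_field A by unfold_locales (rule A)
  interpret M: maximalideal M "ring_on A" by (rule M)
  note D = ideal_ring_onD[OF V M.ideal_axioms]
  have "ideal (nonunits A) (ring_on A)"
    unfolding ideal_ring_on_iff[OF V] using nonunit_in nonunit_0 nonunit_add nonunit_mult(2) by auto
  moreover have "M \<subseteq> nonunits A"
  proof
    fix x assume x: "x \<in> M"
    show "x \<in> nonunits A"
    proof (rule ccontr)
      assume "x \<notin> nonunits A"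
      then have "inverse x \<in> A" "x \<noteq> 0" using D(1) x unit_iff[of x] by auto
      then have "1 \<in> M" using D(4)[OF x, of "inverse x"] by simp
      then have "r \<in> M" if "r \<in> A" for r using D(4)[of 1 r] that by simp
      then show False using M.I_notcarr D(1) by auto
    qed
  qed
  ultimately have "nonunits A = M \<or> nonunits A = A"
    using M.I_maximal[of "nonunits A"] nonunit_in by auto
  then show ?thesis using one_not_nonunit V_intros(2) by auto
qed

text \<open>There is a nonzero element without inverse in A; if two of its powers agreed, its
  inverse would be one of its powers.\<close>

lemma valuation_ring_not_field_infinite:
  assumes A: "valuation_ring (A :: 'k::field set)" and nf: "\<not> Ring.field (ring_on A)"
  shows "infinite (UNIV :: 'k set)"
proof -
  interpret valued_field A by unfold_locales (rule A)
  interpret R: cring "ring_on A" by (rule ring_on_cring[OF V])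
  obtain a where a: "a \<in> A" "a \<noteq> 0" "inverse a \<notin> A"
  proof -
    have "\<exists>a\<in>A. a \<noteq> 0 \<and> inverse a \<notin> A"
    proof (rule ccontr)
      assume *: "\<not> ?thesis"
      have "Units (ring_on A) = A - {0}"
      proof (intro Set.set_eqI iffI)
        fix u assume "u \<in> Units (ring_on A)"
        then show "u \<in> A - {0}" by (auto simp: Units_def ring_of_type_algebra_def)
      next
        fix u assume "u \<in> A - {0}"
        then have "u \<in> A" "inverse u \<in> A" "inverse u * u = 1" "u * inverse u = 1" using * by auto
        then show "u \<in> Units (ring_on A)" unfolding Units_def ring_of_type_algebra_def by auto
      qed
      then have "Units (ring_on A) = carrier (ring_on A) - {\<zero>\<^bsub>ring_on A\<^esub>}"
        by (simp add: ring_of_type_algebra_def)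
      then show False using R.cring_fieldI nf by blast
    qed
    then show ?thesis using that by blast
  qed
  have "a ^ i \<noteq> a ^ j" if "i < j" for i j
  proof
    assume "a ^ i = a ^ j"
    moreover have "a ^ j = a ^ i * (a ^ (j - i - 1) * a)"
      using that by (simp add: power_add[symmetric] power_Suc2[symmetric] del: power_Suc)
    ultimately have "a ^ (j - i - 1) * a = 1" using a(2) by simp
    then have "inverse a = a ^ (j - i - 1)" by (simp add: inverse_unique mult.commute)
    then show False using a V_intros(7) by simp
  qed
  then have "a ^ i = a ^ j \<Longrightarrow> i = j" for i j by (metis nat_neq_iff)
  then have "inj (\<lambda>i. a ^ i)" by (rule injI)
  then have "infinite (range (\<lambda>i. a ^ i))" by (rule range_inj_infinite)
  then show ?thesis using infinite_super[of "range (\<lambda>i. a ^ i)" UNIV] by simp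
qed

lemma map_poly_comm_ring_hom:
  assumes "comm_ring_hom h"
  shows "map_poly h (p * q) = map_poly h p * map_poly h q" "poly (map_poly h p) (h x) = h (poly p x)"
    "h (of_nat n) = of_nat n"
proof -
  interpret h: comm_ring_hom h by (rule assms)
  show "map_poly h (p * q) = map_poly h p * map_poly h q"
    by (intro poly_eqI) (simp add: coeff_map_poly coeff_mult h.hom_sum h.hom_mult)
  show "poly (map_poly h p) (h x) = h (poly p x)"
    by (induction p) (auto simp: map_poly_pCons h.hom_add h.hom_mult)
  show "h (of_nat n) = of_nat n" by (induction n) (auto simp: h.hom_add)
qed

lemma map_poly_pderiv:
  fixes h :: "'a::idom \<Rightarrow> 'b::idom"
  assumes "comm_ring_hom h"
  shows "map_poly h (pderiv p) = pderiv (map_poly h p)"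
proof -
  interpret h: comm_ring_hom h by (rule assms)
  have "h (of_nat (Suc n) * c) = of_nat (Suc n) * h c" for n c
    unfolding h.hom_mult map_poly_comm_ring_hom(3)[OF assms] ..
  then show ?thesis by (intro poly_eqI) (simp only: coeff_map_poly[of h, OF h.hom_zero] coeff_pderiv)
qed

locale galois_setup =
  fixes \<iota> :: "'k::field \<Rightarrow> 'l::field" and A :: "'k set"
  assumes val: "valuation_ring A" and hens: "henselian A" and not_field: "\<not> Ring.field (ring_on A)"
    and \<iota>: "field_hom \<iota>" and gal: "finite_galois \<iota>"
begin

sublocale \<iota>: field_hom \<iota> by (rule \<iota>)

definition h :: "'k \<Rightarrow> 'l alg_closure" where "h x = to_ac (\<iota> x)"

lemma \<iota>_inj: "inj \<iota>"
  by (rule injI) simp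

lemma h_hom: "comm_ring_hom h"
  by unfold_locales (auto simp: h_def \<iota>.hom_add \<iota>.hom_mult)

sublocale h: comm_ring_hom h by (rule h_hom)

lemma to_ac_hom: "comm_ring_hom to_ac"
  by unfold_locales auto

lemma h_inj: "inj h"
  using \<iota>_inj by (auto simp: h_def inj_def)

lemma h_inverse: "h (inverse x) = inverse (h x)"
  by (simp add: h_def \<iota>.hom_inverse)

lemma map_h: "map_poly h p = map_poly to_ac (map_poly \<iota> p)"
  by (subst map_poly_map_poly) (auto simp: h_def comp_def intro!: map_poly_cong)

lemma A_ring: "is_subring A"
  using val by (simp add: valuation_ring_def)

lemma K_subfield: "is_subfield (range h)"
  unfolding is_subfield_def is_subring_iff
  by (auto simp flip: h.hom_minus h.hom_mult h_inverse) (metis h.hom_one rangeI)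

lemma L_subfield: "is_subfield (range to_ac)"
  unfolding is_subfield_def is_subring_iff
  by (auto simp flip: to_ac_diff to_ac_mult to_ac_inverse)

lemma infinite_range_h: "infinite (range h)"
  using valuation_ring_not_field_infinite[OF val not_field] h_inj finite_imageD by blast

lemma separable_normal_poly:
  obtains p where "map_poly h p \<in> polys_over (range h)" "poly (map_poly h p) (to_ac x) = 0"
    "poly (pderiv (map_poly h p)) (to_ac x) \<noteq> 0" "\<And>y. poly (map_poly h p) y = 0 \<Longrightarrow> y \<in> range to_ac"
proof -
  obtain p where p: "Factorial_Ring.irreducible p" "poly (map_poly \<iota> p) x = 0" "coprime p (pderiv p)"
    using gal unfolding finite_galois_def separable_extension_def by blast
  have p0: "p \<noteq> 0" using p(1) by auto
  let ?P = "map_poly h p"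
  have PK: "?P \<in> polys_over (range h)" by (auto simp: polys_over_def coeff_map_poly)
  have Px: "poly ?P (to_ac x) = 0"
    unfolding map_h map_poly_comm_ring_hom(2)[OF to_ac_hom] p(2) by simp
  have inj_map: "q = q'" if "map_poly h q = map_poly h q'" for q q'
    using that h_inj by (simp add: poly_eq_iff coeff_map_poly inj_eq)
  have "poly (pderiv ?P) (to_ac x) \<noteq> 0"
  proof
    assume D: "poly (pderiv ?P) (to_ac x) = 0"
    have "?P \<noteq> 0" using p0 inj_map[of p 0] by auto
    then have "alg_over (range h) (to_ac x)" unfolding alg_over_def using PK Px by blast
    then obtain m where m: "minimal_poly (range h) (to_ac x) m" using minimal_poly_exists[OF K_subfield] by blast
    note lift = polys_over_image[OF h_inj h.hom_zero, of _ UNIV]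
    obtain m0 where m0: "m = map_poly h m0" using lift minimal_polyD(1)[OF m] by blast
    have dvd: "m0 dvd q" if q: "poly (map_poly h q) (to_ac x) = 0" for q
    proof -
      have "map_poly h q \<in> polys_over (range h)" by (auto simp: polys_over_def coeff_map_poly)
      then obtain s where s: "s \<in> polys_over (range h)" "map_poly h q = m * s"
        using minimal_poly_dvd[OF K_subfield m _ q] by blast
      obtain s0 where "s = map_poly h s0" using lift s(1) by blast
      then have "map_poly h q = map_poly h (m0 * s0)"
        using s(2) m0 map_poly_comm_ring_hom(1)[OF h_hom] by simp
      then have "q = m0 * s0" by (rule inj_map)
      then show ?thesis by simp
    qed
    have "m0 dvd p" "m0 dvd pderiv p"
      using dvd Px D map_poly_pderiv[OF h_hom, of p] by auto
    then have "is_unit m0" using p(3) coprime_common_divisor by blast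
    then obtain u where "1 = m0 * u" by (elim dvdE)
    then have "map_poly h 1 = m * map_poly h u" using m0 map_poly_comm_ring_hom(1)[OF h_hom] by metis
    then have "1 = m * map_poly h u" by (simp add: map_poly_1')
    then have "poly 1 (to_ac x) = 0" using minimal_polyD(4)[OF m] by (metis mult_zero_left poly_mult)
    then show False by simp
  qed
  moreover have "y \<in> range to_ac" if y: "poly ?P y = 0" for y
  proof -
    obtain rs where rs: "map_poly \<iota> p = smult (\<iota> (lead_coeff p)) (\<Prod>r\<leftarrow>rs. [:- r, 1:])"
      using gal p(1,2) unfolding finite_galois_def normal_extension_def by blast
    have ev: "poly (map_poly to_ac (\<Prod>r\<leftarrow>rs. [:- r, 1:])) y = (\<Prod>r\<leftarrow>rs. y - to_ac r)" for rs
      by (induction rs)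
        (simp_all add: map_poly_1' map_poly_comm_ring_hom(1)[OF to_ac_hom] map_poly_pCons del: mult_pCons_left)
    have "poly ?P y = to_ac (\<iota> (lead_coeff p)) * (\<Prod>r\<leftarrow>rs. y - to_ac r)"
      unfolding map_h rs by (simp add: ev[symmetric] map_poly_smult)
    then have "(\<Prod>r\<leftarrow>rs. y - to_ac r) = 0" using y p0 by simp
    then show ?thesis by (auto simp: prod_list_zero_iff)
  qed
  ultimately show ?thesis using that PK Px by blast
qed

text \<open>The primitive element is built from a finite spanning set E of L over K; the elements of
  L lying in K(\<theta>) form a K-subspace containing E.\<close>

lemma simple_galois_exists: "\<exists>\<theta>. simple_galois (range h) (range to_ac) \<theta>"
proof -
  note R = subfield_subring[OF K_subfield]
  have sep: "sep_over (range h) (to_ac x)" for x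
    using separable_normal_poly[of x] unfolding sep_over_def by metis
  have KL: "range h \<subseteq> range to_ac" by (auto simp: h_def)
  obtain E where E: "finite E" "module.span (\<lambda>c x. \<iota> c * x) E = UNIV"
    using gal unfolding finite_galois_def finite_extension_def by blast
  obtain c where c: "\<forall>y\<in>to_ac ` E. c y \<in> range h"
      "to_ac ` E \<subseteq> adjoin (range h) (\<Sum>y\<in>to_ac ` E. c y * y)"
    using primitive_element[OF K_subfield infinite_range_h L_subfield KL, of "to_ac ` E"] sep sep_over_alg E(1)
    by blast
  define \<theta> where "\<theta> = (\<Sum>y\<in>to_ac ` E. c y * y)"
  note AR = is_subring_adjoin[OF R, of \<theta>]
  have "\<theta> \<in> range to_ac"
    unfolding \<theta>_def using c(1) KL
    by (intro subring_sum[OF subfield_subring[OF L_subfield]] subring_mult[OF subfield_subring[OF L_subfield]]) auto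
  then obtain t where t: "\<theta> = to_ac t" by blast
  interpret M: Modules.module "\<lambda>c x. \<iota> c * x"
    by unfold_locales (simp_all add: algebra_simps \<iota>.hom_add \<iota>.hom_mult)
  have sub: "to_ac x \<in> adjoin (range h) \<theta>" for x
  proof -
    have "M.subspace {x. to_ac x \<in> adjoin (range h) \<theta>}"
    proof (rule M.subspaceI)
      show "0 \<in> {x. to_ac x \<in> adjoin (range h) \<theta>}" using subring_0[OF AR] by simp
      show "x + y \<in> {x. to_ac x \<in> adjoin (range h) \<theta>}"
        if "x \<in> {x. to_ac x \<in> adjoin (range h) \<theta>}" "y \<in> {x. to_ac x \<in> adjoin (range h) \<theta>}" for x y
        using that subring_add[OF AR] by simp
      show "\<iota> c * x \<in> {x. to_ac x \<in> adjoin (range h) \<theta>}"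
        if "x \<in> {x. to_ac x \<in> adjoin (range h) \<theta>}" for c x
      proof -
        have "h c \<in> adjoin (range h) \<theta>" using adjoin_contains[OF R] by blast
        then show ?thesis using that subring_mult[OF AR, of "h c" "to_ac x"] by (simp add: h_def)
      qed
    qed
    moreover have "E \<subseteq> {x. to_ac x \<in> adjoin (range h) \<theta>}" using c(2) by (auto simp: \<theta>_def)
    ultimately have "module.span (\<lambda>c x. \<iota> c * x) E \<subseteq> {x. to_ac x \<in> adjoin (range h) \<theta>}"
      by (intro M.span_minimal)
    then show ?thesis using E(2) by auto
  qed
  have "simple_galois (range h) (range to_ac) \<theta>"
  proof
    show "is_subfield (range h)" by (rule K_subfield)
    show "range to_ac = adjoin (range h) \<theta>"
      using sub adjoin_subset[OF subfield_subring[OF L_subfield] KL] \<open>\<theta> \<in> range to_ac\<close> by blast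
    show "sep_over (range h) \<theta>" unfolding t by (rule sep)
    fix y assume "conj_over (range h) \<theta> y"
    then show "y \<in> range to_ac"
      using separable_normal_poly[of t] unfolding t conj_over_def by metis
  qed
  then show ?thesis by blast
qed

lemma valuation_exists: "\<exists>V. valuation_ring V \<and> V \<inter> range h = h ` A"
proof -
  have hA: "is_subring (h ` A)" by (rule is_subring_image[OF h_hom A_ring])
  have "x \<in> h ` A \<or> inverse x \<in> h ` A" if "x \<in> range h" for x
  proof -
    obtain k where k: "x = h k" using \<open>x \<in> range h\<close> by blast
    have "k \<in> A \<or> inverse k \<in> A" using val by (simp add: valuation_ring_def)
    then show ?thesis unfolding k h_inverse[symmetric] by blast
  qed
  then show ?thesis using valuation_extension[OF K_subfield hA] by blast
qed

text \<open>Nonunits of V in the image of K are the images of nonunits of A, so the lifting property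
  is inherited from A. The algebraic closure of L is algebraic over K by norms from L.\<close>

lemma henselian_closure_exists: "\<exists>V. henselian_closure V (range h) \<and> V \<inter> range h = h ` A"
proof -
  obtain V where VA: "valuation_ring V" "V \<inter> range h = h ` A" using valuation_exists by blast
  interpret valued_field V by unfold_locales (rule VA(1))
  have hV: "h x \<in> V \<longleftrightarrow> x \<in> A" for x
  proof -
    have "h x \<in> V \<longleftrightarrow> h x \<in> V \<inter> range h" by simp
    then show ?thesis unfolding VA(2) inj_image_mem_iff[OF h_inj] .
  qed
  have hm: "h x \<in> \<mm> \<longleftrightarrow> x \<in> nonunits A" for x
  proof -
    have "h x = 0 \<longleftrightarrow> x = 0" by (simp add: h_def)
    then show ?thesis by (simp add: nonunits_def hV h_inverse[symmetric])
  qed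
  obtain \<theta> where "simple_galois (range h) (range to_ac) \<theta>" using simple_galois_exists by blast
  then interpret G: simple_galois "range h" "range to_ac" \<theta> .
  have "henselian_closure V (range h)"
  proof
    show "is_subfield (range h)" "infinite (range h)" by (rule K_subfield infinite_range_h)+
    fix x :: "'l alg_closure"
    obtain p where p: "p \<noteq> 0" "poly (map_poly to_ac p) x = 0" using alg_closure_algebraic .
    have "map_poly to_ac p \<noteq> 0" using p(1) by (simp add: poly_eq_iff coeff_map_poly)
    then have "alg_over (range to_ac) x"
      unfolding alg_over_def using p by (intro bexI[of _ "map_poly to_ac p"]) (auto simp: polys_over_def coeff_map_poly)
    then show "alg_over (range h) x" by (rule G.alg_over_trans)
  next
    fix f a\<^sub>0
    assume f: "f \<in> polys_over (V \<inter> range h)" "lead_coeff f = 1" and a: "a\<^sub>0 \<in> V \<inter> range h"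
      and root: "poly f a\<^sub>0 \<in> \<mm>" "poly (pderiv f) a\<^sub>0 \<notin> \<mm>"
    obtain g where g: "g \<in> polys_over A" "f = map_poly h g"
      using polys_over_image[OF h_inj h.hom_zero, of f A] f(1) VA(2) by auto
    obtain b where b: "b \<in> A" "a\<^sub>0 = h b" using a VA(2) by auto
    have deg: "degree f = degree g"
      unfolding g(2) using h_inj h.hom_zero by (intro degree_map_poly) (metis injD)
    have "h (lead_coeff g) = h 1" using f(2) deg by (simp add: g(2) coeff_map_poly)
    then have monic: "lead_coeff g = 1" using h_inj injD by metis
    have root': "poly g b \<in> nonunits A" "poly (pderiv g) b \<notin> nonunits A"
      using root unfolding g(2) b(2) map_poly_pderiv[OF h_hom, symmetric] map_poly_comm_ring_hom(2)[OF h_hom] hm by auto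
    obtain M where M: "maximalideal M (ring_on A)" and lift:
      "\<forall>f a\<^sub>0. (\<forall>i. coeff f i \<in> A) \<and> lead_coeff f = 1 \<and> a\<^sub>0 \<in> A \<and> poly f a\<^sub>0 \<in> M \<and> poly (pderiv f) a\<^sub>0 \<notin> M \<longrightarrow>
        (\<exists>a\<in>A. poly f a = 0 \<and> a - a\<^sub>0 \<in> M)"
      using hens unfolding henselian_def by blast
    have "\<exists>c\<in>A. poly g c = 0 \<and> c - b \<in> nonunits A"
      using spec[OF spec[OF lift[unfolded maximalideal_nonunits[OF val M]], of g], of b]
        monic root' b(1) polys_overD[OF g(1)] by simp
    then obtain c where c: "c \<in> A" "poly g c = 0" "c - b \<in> nonunits A" by blast
    have "h c \<in> V \<inter> range h" using c(1) hV by blast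
    moreover have "poly f (h c) = 0" unfolding g(2) map_poly_comm_ring_hom(2)[OF h_hom] using c(2) by simp
    moreover have "h c - a\<^sub>0 \<in> \<mm>" using c(3) hm[of "c - b"] by (simp add: b(2) h.hom_minus)
    ultimately show "\<exists>a\<in>V \<inter> range h. poly f a = 0 \<and> a - a\<^sub>0 \<in> \<mm>" by blast
  qed
  then show ?thesis using VA(2) by blast
qed

lemma complete_intersection_subalgebra:
  assumes S: "finite S" "S \<subseteq> integral_closure_in \<iota> A"
  shows "\<exists>T. subalgebra_of \<iota> A T (integral_closure_in \<iota> A) \<and> free_of_finite_rank \<iota> A T \<and>
    relative_complete_intersection \<iota> A T \<and> S \<subseteq> T"
proof -
  obtain V where V: "henselian_closure V (range h)" "V \<inter> range h = h ` A" using henselian_closure_exists by blast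
  interpret H: henselian_closure V "range h" by (rule V(1))
  obtain \<theta> where \<theta>: "simple_galois (range h) (range to_ac) \<theta>" using simple_galois_exists by blast
  have closure: "x \<in> integral_closure_in \<iota> A \<longleftrightarrow>
      (\<exists>q\<in>polys_over (\<iota> ` A). lead_coeff q = 1 \<and> poly q x = 0)" for x
  proof
    assume "x \<in> integral_closure_in \<iota> A"
    then obtain p where p: "\<forall>i. coeff p i \<in> A" "lead_coeff p = 1" "poly (map_poly \<iota> p) x = 0"
      by (auto simp: integral_closure_in_def)
    then show "\<exists>q\<in>polys_over (\<iota> ` A). lead_coeff q = 1 \<and> poly q x = 0"
      by (intro bexI[of _ "map_poly \<iota> p"]) (auto simp: polys_over_def coeff_map_poly degree_map_poly)
  next
    assume "\<exists>q\<in>polys_over (\<iota> ` A). lead_coeff q = 1 \<and> poly q x = 0"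
    then obtain q where q: "q \<in> polys_over (\<iota> ` A)" "lead_coeff q = 1" "poly q x = 0" by blast
    obtain p where p: "p \<in> polys_over A" "q = map_poly \<iota> p"
      using polys_over_image[OF \<iota>_inj _ q(1)] by auto
    then show "x \<in> integral_closure_in \<iota> A"
      using q by (auto simp: integral_closure_in_def polys_over_def coeff_map_poly degree_map_poly)
  qed
  \<comment> \<open>The integral closure of A in L is the part of V lying in L, which makes the
    towers in V available.\<close>
  have in_V: "x \<in> integral_closure_in \<iota> A \<longleftrightarrow> to_ac x \<in> V" for x
  proof
    assume "x \<in> integral_closure_in \<iota> A"
    then obtain p where p: "\<forall>i. coeff p i \<in> A" "lead_coeff p = 1" "poly (map_poly \<iota> p) x = 0"
      by (auto simp: integral_closure_in_def)
    show "to_ac x \<in> V"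
    proof (rule H.integral_in_V)
      show "map_poly h p \<in> polys_over V" using p(1) V(2) by (auto simp: polys_over_def coeff_map_poly)
      have "degree (map_poly h p) = degree p"
        using h_inj h.hom_zero by (intro degree_map_poly) (metis injD)
      then show "lead_coeff (map_poly h p) = 1" using p(2) by (simp add: coeff_map_poly)
      show "poly (map_poly h p) (to_ac x) = 0"
        unfolding map_h map_poly_comm_ring_hom(2)[OF to_ac_hom] using p(3) by simp
    qed
  next
    assume "to_ac x \<in> V"
    then obtain p where p: "p \<in> polys_over (h ` A)" "lead_coeff p = 1" "poly p (to_ac x) = 0"
      using H.V_integral V(2) by metis
    have "p \<in> polys_over (to_ac ` \<iota> ` A)" using p(1) by (simp add: h_def image_image)
    then obtain q where q: "q \<in> polys_over (\<iota> ` A)" "p = map_poly to_ac q"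
      by (rule polys_over_image[OF inj_to_ac to_ac_0])
    have "degree p = degree q" unfolding q(2) by (intro degree_map_poly) simp
    then have "lead_coeff q = 1" using p(2) q(2) by (simp add: coeff_map_poly)
    moreover have "poly q x = 0" using p(3) unfolding q(2) map_poly_comm_ring_hom(2)[OF to_ac_hom] by simp
    ultimately show "x \<in> integral_closure_in \<iota> A" using closure q(1) by blast
  qed
  have "finite (to_ac ` S)" "to_ac ` S \<subseteq> V \<inter> range to_ac" using S in_V by auto
  then obtain T0 where T0: "tower (V \<inter> range h) T0" "to_ac ` S \<subseteq> T0" "T0 \<subseteq> V \<inter> range to_ac"
    using spec[OF H.tower_union_galois[OF \<theta>, unfolded H.tower_union_def], of "to_ac ` S"] by auto
  have \<iota>A: "is_subring (\<iota> ` A)" by (rule is_subring_image[OF \<iota>.comm_ring_hom_axioms A_ring])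
  have "V \<inter> range h = to_ac ` \<iota> ` A" using V(2) by (auto simp: h_def)
  then obtain T where T: "tower (\<iota> ` A) T" "T0 = to_ac ` T"
    using tower_pullback[OF to_ac_hom inj_to_ac \<iota>A, of T0] T0 by auto
  have Ti: "is_subring T" "\<iota> ` A \<subseteq> T" using tower_subring[OF T(1) \<iota>A] by auto
  have TB: "T \<subseteq> integral_closure_in \<iota> A" using T0(3) T(2) in_V by auto
  have ST: "S \<subseteq> T" using T0(2) unfolding T(2) by (simp add: inj_image_subset_iff[OF inj_to_ac])
  obtain n x f where "presentation \<iota> A T n n x f" using tower_presentation[OF \<iota> A_ring T(1)] by blast
  then have "relative_complete_intersection \<iota> A T"
    using TB closure by (intro presentation_complete_intersection[OF \<iota> A_ring Ti]) auto
  moreover have "free_of_finite_rank \<iota> A T"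
  proof -
    obtain E where E: "finite E" "E \<subseteq> T" "\<forall>x\<in>T. \<exists>c. (\<forall>e\<in>E. c e \<in> \<iota> ` A) \<and> x = (\<Sum>e\<in>E. c e * e)"
      and ind: "\<forall>c. (\<forall>e\<in>E. c e \<in> \<iota> ` A) \<and> (\<Sum>e\<in>E. c e * e) = 0 \<longrightarrow> (\<forall>e\<in>E. c e = 0)"
      using tower_free[OF T(1) \<iota>A] by (elim exE conjE)
    have "\<exists>c. (\<forall>e\<in>E. c e \<in> A) \<and> x = (\<Sum>e\<in>E. \<iota> (c e) * e)" if x: "x \<in> T" for x
    proof -
      obtain c where c: "\<forall>e\<in>E. c e \<in> \<iota> ` A" "x = (\<Sum>e\<in>E. c e * e)" using bspec[OF E(3) x] by (elim exE conjE)
      have "\<forall>e\<in>E. \<exists>a. a \<in> A \<and> c e = \<iota> a" using c(1) by auto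
      then obtain d where d: "\<And>e. e \<in> E \<Longrightarrow> d e \<in> A" "\<And>e. e \<in> E \<Longrightarrow> c e = \<iota> (d e)" by metis
      then show ?thesis using c(2) by (intro exI[of _ d]) simp
    qed
    moreover have "\<forall>e\<in>E. c e = 0" if "\<forall>e\<in>E. c e \<in> A" "(\<Sum>e\<in>E. \<iota> (c e) * e) = 0" for c
      using spec[OF ind, of "\<lambda>e. \<iota> (c e)"] that by simp
    ultimately show ?thesis unfolding free_of_finite_rank_def using E(1,2) by (intro exI[of _ E]) blast
  qed
  ultimately show ?thesis using Ti TB ST unfolding subalgebra_of_def by blast
qed

end

theorem theorem6p2:
  fixes \<iota> :: "'k::field \<Rightarrow> 'l::field" and A :: "'k set" and S :: "'l set"
  assumes "valuation_ring A" and "henselian A"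
    and not_field: "\<not> Ring.field (ring_on A)"
    and "field_hom \<iota>" and "finite_galois \<iota>"
    and "finite S" and "S \<subseteq> integral_closure_in \<iota> A"
  shows "\<exists>B'. subalgebra_of \<iota> A B' (integral_closure_in \<iota> A) \<and>
           free_of_finite_rank \<iota> A B' \<and>
           relative_complete_intersection \<iota> A B' \<and>
           S \<subseteq> B'"
proof -
  interpret galois_setup \<iota> A
    by (intro galois_setup.intro assms)
  show ?thesis by (rule complete_intersection_subalgebra) fact+
qed

end
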